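(* Let $q_0$ be a prime power, $q=q_0^2$, let $n\ge2$ divide $q_0+1$, and let $\mathcal X_n$ be the smooth projective model over $\mathbb F_q$ of $$y^n=f(x),\qquad f(x)=-\bigl(x^{q_0+1}+1\bigr).$$ Put $d=q_0+1$ and $c=\gcd(n,d)$. Then $c=n$; $n$ is prime to the characteristic and $n\mid q-1$; $f$ is separable of degree $d\ge3$ and splits into distinct linear factors over $\mathbb F_q$; $f(a)\in(\mathbb F_q^* )^n$ for every $a\in\mathbb F_q$ with $f(a)\ne0$ (that is, $\delta=0$); and $$g_{\mathcal X}=\frac{(n-1)(q_0-1)}{2},\qquad N=n(q_0^2-q_0-1),\qquad M=q_0^2-2,$$ where $g_{\mathcal X}$ is the genus of $\mathcal X_n$. The curve $\mathcal X_n$ is the quotient of the Hermitian curve $\mathcal X_{q_0+1}$ by the subgroup of order $\frac{q_0+1}{n}$ of $\langle\tau\rangle$, all $d$ points of $\mathrm{Ram}$ and all $c$ points of $D_\infty$ are $\mathbb F_q$-rational, and $\mathcal X_n$ is $\mathbb F_q$-maximal. Moreover $$t(s)=n(q_0-1-\mu(s)),\qquad W(\mathcal X_n)=\{s:q_0\le s\le q_0^2-2-q_0\},$$ the latter being nonempty for $q_0\ge3$, and for $s\in W(\mathcal X_n)$ $$\dim\operatorname{Hull}(\mathcal C_s)=n\,\mu(s)-q_0-\frac{(n-1)(q_0-1)}{2}.$$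
   Context: Notation for a curve $y^n=f(x)$ over $\mathbb F_q$ with $f$ of degree $d$ split into distinct linear factors over $\mathbb F_q$, $n\mid q-1$, $c=\gcd(n,d)$: $\mathrm{Ram}$ is the reduced divisor of the $d$ points over the roots of $f$; $D_\infty$ is the reduced divisor of the $c$ geometric points over $x=\infty$; $D$ is the sum of all $\mathbb F_q$-rational points lying over $\mathbb A^1(\mathbb F_q)$ and not on $\mathrm{Ram}$, $N=\deg D$; $\delta=\#\{a\in\mathbb F_q:f(a)\ne0,\ f(a)\notin(\mathbb F_q^* )^n\}$; $M=\frac{(q-1)n}{c}-1$; $\mu(s)=\min\{s,M-s\}$; $t(s)=2g_{\mathcal X}-2-c\,\mu(s)+d+n\delta$; the window is the set of integers $W=\{s\ge1:t(s)<0\}$. On $\mathcal X_{q_0+1}$, $\tau(x,y)=(x,\zeta y)$ with $\zeta$ a primitive $(q_0+1)$-th root of unity. A curve of genus $g$ over $\mathbb F_{q_0^2}$ is maximal if it has $q_0^2+1+2gq_0$ rational points. $\mathcal C_s\subseteq\mathbb F_q^N$ is the image of evaluation of $L(sD_\infty)$ at the points of $D$, where $L(G)=\{h:\operatorname{div}(h)+G\ge0\}\cup\{0\}$; $\operatorname{Hull}(C)=C\cap C^\perp$ for the standard bilinear form. *)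

theory Defs
  imports
    "HOL-Algebra.Algebraic_Closure_Type"
    "HOL-Algebra.Bij"
    "HOL-Algebra.Generated_Groups"
    "HOL-Number_Theory.Prime_Powers"
    "HOL-Library.Function_Algebras"
    "HOL-Library.Cardinality"
begin

section \<open>Function fields inside an algebraic closure of K(x)\<close>

text \<open>
  A smooth projective curve over the field K = 'k is represented by its function field, a subfield
  of a fixed algebraic closure of the rational function field K(x).  The closed points of the curve
  are the places of the function field (the normalised discrete valuations trivial on K); the
  K-rational points are the places of degree one.
\<close>

type_synonym 'k cover = "'k poly fract alg_closure"

text \<open>A place is given by its valuation; as a total function to the integers it takes the dummy
  value 0 at the zero element and outside the function field.\<close>

type_synonym 'k place = "'k cover \<Rightarrow> int"
type_synonym 'k divisor = "'k place \<Rightarrow> int"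

definition cst :: "'k::field \<Rightarrow> 'k cover" where
  "cst c = to_ac (to_fract [:c:])"

definition xcoord :: "'k::field cover" where
  "xcoord = to_ac (to_fract [:0, 1:])"

definition is_subfield :: "'a::field set \<Rightarrow> bool" where
  "is_subfield L \<longleftrightarrow> 0 \<in> L \<and> 1 \<in> L \<and>
     (\<forall>a\<in>L. \<forall>b\<in>L. a - b \<in> L \<and> a * b \<in> L) \<and> (\<forall>a\<in>L. inverse a \<in> L)"

text \<open>The condition that y satisfies y^n = f(x), and the field K(x, y) it generates.  Under this
  condition K(x, y) is the function field of the smooth projective model of y^n = f(x) (provided
  that this curve is irreducible).\<close>

definition on_curve :: "'k::field poly \<Rightarrow> nat \<Rightarrow> 'k cover \<Rightarrow> bool" where
  "on_curve f n y \<longleftrightarrow> y ^ n = poly (map_poly cst f) xcoord"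

definition curve_field :: "'k::field cover \<Rightarrow> 'k cover set" where
  "curve_field y = is_subfield hull (range cst \<union> {xcoord, y})"

definition places :: "'k::field cover set \<Rightarrow> 'k place set" where
  "places F = {v. (\<forall>a. a \<notin> F \<or> a = 0 \<longrightarrow> v a = 0) \<and>
     v ` (F - {0}) = UNIV \<and>
     (\<forall>a \<in> F - {0}. \<forall>b \<in> F - {0}. v (a * b) = v a + v b \<and>
        (a + b \<noteq> 0 \<longrightarrow> v (a + b) \<ge> min (v a) (v b))) \<and>
     (\<forall>c. c \<noteq> 0 \<longrightarrow> v (cst c) = 0)}"

definition valuation_ring :: "'k::field cover set \<Rightarrow> 'k place \<Rightarrow> 'k cover set" where
  "valuation_ring F v = {a \<in> F. a = 0 \<or> v a \<ge> 0}"

definition valuation_ideal :: "'k::field cover set \<Rightarrow> 'k place \<Rightarrow> 'k cover set" where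
  "valuation_ideal F v = {a \<in> F. a = 0 \<or> v a > 0}"

text \<open>The dimension over K of the residue field O/P: the largest number of elements of O whose
  residue classes modulo P are linearly independent over K.\<close>

definition place_degree :: "'k::field cover set \<Rightarrow> 'k place \<Rightarrow> nat" where
  "place_degree F v = (GREATEST m. \<exists>B. finite B \<and> card B = m \<and> B \<subseteq> valuation_ring F v \<and>
     (\<forall>u. (\<Sum>b\<in>B. cst (u b) * b) \<in> valuation_ideal F v \<longrightarrow> (\<forall>b\<in>B. u b = 0)))"

definition rational_places :: "'k::field cover set \<Rightarrow> 'k place set" where
  "rational_places F = {v \<in> places F. place_degree F v = 1}"

section \<open>Divisors, Riemann-Roch spaces and the genus\<close>

definition divisors :: "'k::field cover set \<Rightarrow> 'k divisor set" where
  "divisors F = {A. finite {v. A v \<noteq> 0} \<and> {v. A v \<noteq> 0} \<subseteq> places F}"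

definition div_degree :: "'k::field cover set \<Rightarrow> 'k divisor \<Rightarrow> int" where
  "div_degree F A = (\<Sum>v | A v \<noteq> 0. A v * int (place_degree F v))"

definition reduced_divisor :: "'k::field place set \<Rightarrow> 'k divisor" where
  "reduced_divisor S = (\<lambda>v. if v \<in> S then 1 else 0)"

definition RR_space :: "'k::field cover set \<Rightarrow> 'k divisor \<Rightarrow> 'k cover set" where
  "RR_space F G = {h \<in> F. h \<noteq> 0 \<longrightarrow> (\<forall>v \<in> places F. v h + G v \<ge> 0)}"

definition RR_dim :: "'k::field cover set \<Rightarrow> 'k divisor \<Rightarrow> nat" where
  "RR_dim F G = vector_space.dim (\<lambda>c h. cst c * h) (RR_space F G)"

text \<open>The genus is the maximum of deg A - dim L(A) + 1 over all divisors A.\<close>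

definition genus :: "'k::field cover set \<Rightarrow> int" where
  "genus F = (GREATEST g. \<exists>A \<in> divisors F. g = div_degree F A - int (RR_dim F A) + 1)"

definition is_maximal :: "'k::{field,finite} cover set \<Rightarrow> nat \<Rightarrow> bool" where
  "is_maximal F q0 \<longleftrightarrow> CARD('k) = q0 ^ 2 \<and> finite (rational_places F) \<and>
     int (card (rational_places F)) = int q0 ^ 2 + 1 + 2 * genus F * int q0"

section \<open>Automorphisms and quotients\<close>

definition field_isos :: "'k::field cover set \<Rightarrow> 'k cover set \<Rightarrow> ('k cover \<Rightarrow> 'k cover) set" where
  "field_isos F F' = {\<phi>. bij_betw \<phi> F F' \<and>
     (\<forall>a\<in>F. \<forall>b\<in>F. \<phi> (a + b) = \<phi> a + \<phi> b \<and> \<phi> (a * b) = \<phi> a * \<phi> b) \<and>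
     (\<forall>c. \<phi> (cst c) = cst c)}"

text \<open>The automorphism group over K of the function field, as a subset of \<open>BijGroup F\<close>.\<close>

definition field_auts :: "'k::field cover set \<Rightarrow> ('k cover \<Rightarrow> 'k cover) set" where
  "field_auts F = Bij F \<inter> field_isos F F"

definition fixed_field ::
    "'k::field cover set \<Rightarrow> ('k cover \<Rightarrow> 'k cover) set \<Rightarrow> 'k cover set" where
  "fixed_field F G = {a \<in> F. \<forall>\<sigma>\<in>G. \<sigma> a = a}"

text \<open>The quotient of the curve with function field H by a finite group G of automorphisms is the
  smooth projective curve whose function field is the fixed field of G (up to K-isomorphism).\<close>

definition is_quotient_curve ::
    "'k::field cover set \<Rightarrow> 'k cover set \<Rightarrow> ('k cover \<Rightarrow> 'k cover) set \<Rightarrow> bool" where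
  "is_quotient_curve F H G \<longleftrightarrow>
     finite G \<and> subgroup G (BijGroup H) \<and> G \<subseteq> field_auts H \<and>
     field_isos F (fixed_field H G) \<noteq> {}"

definition primitive_root_of_unity :: "nat \<Rightarrow> 'k::field \<Rightarrow> bool" where
  "primitive_root_of_unity m \<zeta> \<longleftrightarrow> m > 0 \<and> \<zeta> ^ m = 1 \<and> (\<forall>k. 0 < k \<and> k < m \<longrightarrow> \<zeta> ^ k \<noteq> 1)"

text \<open>The action on functions of the automorphism (x, y) \<mapsto> (x, \<zeta> y).\<close>

definition is_tau :: "'k::field cover \<Rightarrow> 'k \<Rightarrow> ('k cover \<Rightarrow> 'k cover) \<Rightarrow> bool" where
  "is_tau y \<zeta> \<tau> \<longleftrightarrow> \<tau> \<in> field_auts (curve_field y) \<and> \<tau> xcoord = xcoord \<and> \<tau> y = cst \<zeta> * y"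

section \<open>Distinguished points of y^n = f(x), numerical invariants\<close>

text \<open>The polynomial f is meant to be a product of distinct linear factors over K.  A set of geometric
  points stable under Frobenius is encoded by its closed points; since K is perfect, the sum of
  their degrees is the number of geometric points.\<close>

definition lies_over :: "'k::field place \<Rightarrow> 'k \<Rightarrow> bool" where
  "lies_over v a \<longleftrightarrow> v (xcoord - cst a) > 0"

definition ram_places :: "'k::field poly \<Rightarrow> 'k cover set \<Rightarrow> 'k place set" where
  "ram_places f F = {v \<in> places F. \<exists>a. poly f a = 0 \<and> lies_over v a}"

definition inf_places :: "'k::field cover set \<Rightarrow> 'k place set" where
  "inf_places F = {v \<in> places F. v xcoord < 0}"

definition D_inf :: "'k::field cover set \<Rightarrow> 'k divisor" where
  "D_inf F = reduced_divisor (inf_places F)"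

definition eval_places :: "'k::field poly \<Rightarrow> 'k cover set \<Rightarrow> 'k place set" where
  "eval_places f F = {v \<in> rational_places F. \<exists>a. lies_over v a} - ram_places f F"

definition D_eval :: "'k::field poly \<Rightarrow> 'k cover set \<Rightarrow> 'k divisor" where
  "D_eval f F = reduced_divisor (eval_places f F)"

definition delta :: "'k::field poly \<Rightarrow> nat \<Rightarrow> nat" where
  "delta f n = card {a. poly f a \<noteq> 0 \<and> poly f a \<notin> {b ^ n | b. b \<noteq> 0}}"

text \<open>The division is exact.\<close>

definition M_num :: "'k::{field,finite} poly \<Rightarrow> nat \<Rightarrow> int" where
  "M_num f n = (int CARD('k) - 1) * int n div int (gcd n (degree f)) - 1"

definition mu :: "'k::{field,finite} poly \<Rightarrow> nat \<Rightarrow> int \<Rightarrow> int" where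
  "mu f n s = min s (M_num f n - s)"

definition t_num :: "'k::{field,finite} poly \<Rightarrow> nat \<Rightarrow> 'k cover set \<Rightarrow> int \<Rightarrow> int" where
  "t_num f n F s = 2 * genus F - 2 - int (gcd n (degree f)) * mu f n s
     + int (degree f) + int n * int (delta f n)"

definition window :: "'k::{field,finite} poly \<Rightarrow> nat \<Rightarrow> 'k cover set \<Rightarrow> int set" where
  "window f n F = {s. s \<ge> 1 \<and> t_num f n F s < 0}"

section \<open>Codes\<close>

text \<open>The value at a rational place of a function that is regular there: its residue class.\<close>

definition eval_at :: "'k::field place \<Rightarrow> 'k cover \<Rightarrow> 'k" where
  "eval_at v h = (THE c. h - cst c = 0 \<or> v (h - cst c) > 0)"

text \<open>The coordinates of the ambient space of a code are indexed by a finite set S of places; words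
  are functions that vanish outside S.\<close>

definition words :: "'k::field place set \<Rightarrow> ('k place \<Rightarrow> 'k) set" where
  "words S = {u. \<forall>v. v \<notin> S \<longrightarrow> u v = 0}"

definition dual_code ::
    "'k::field place set \<Rightarrow> ('k place \<Rightarrow> 'k) set \<Rightarrow> ('k place \<Rightarrow> 'k) set" where
  "dual_code S C = {u \<in> words S. \<forall>w\<in>C. (\<Sum>v\<in>S. u v * w v) = 0}"

definition code_hull ::
    "'k::field place set \<Rightarrow> ('k place \<Rightarrow> 'k) set \<Rightarrow> ('k place \<Rightarrow> 'k) set" where
  "code_hull S C = C \<inter> dual_code S C"

definition code_dim :: "('k::field place \<Rightarrow> 'k) set \<Rightarrow> nat" where
  "code_dim C = vector_space.dim (\<lambda>c u. (\<lambda>v. c * u v)) C"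

definition code :: "'k::field poly \<Rightarrow> 'k cover set \<Rightarrow> int \<Rightarrow> ('k place \<Rightarrow> 'k) set" where
  "code f F s = {(\<lambda>v. if v \<in> eval_places f F then eval_at v h else 0) | h.
     h \<in> RR_space F (\<lambda>v. s * D_inf F v)}"

end

theory Submission
  imports Defs "HOL-Computational_Algebra.Formal_Laurent_Series"
begin

text \<open>
  The argument treats the curves \<open>y ^ n = f(x)\<close> over a field of \<open>q\<close> elements, where \<open>f\<close> is a constant
  times \<open>d = n e\<close> distinct linear factors and the leading coefficient and all values of \<open>f\<close> are
  \<open>n\<close>-th powers.  The polynomial \<open>- (x ^ (q0 + 1) + 1)\<close> has these properties over a field with \<open>q0 ^ 2\<close>
  elements because \<open>a \<mapsto> a ^ (q0 + 1)\<close> is the norm to the subfield with \<open>q0\<close> elements, all of whose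
  nonzero fibres have \<open>q0 + 1\<close> elements (\<open>card_power_fibres\<close>).

  \<^bold>\<open>The field.\<close>  Since \<open>f\<close> has a simple zero, \<open>y\<close> has degree \<open>n\<close> over \<open>K(x)\<close>.  Since \<open>K\<close> contains \<open>n\<close>
  roots of unity of order dividing \<open>n\<close>, the extension \<open>K(x, y)\<close> of \<open>K(x)\<close> is Galois with group
  \<open>y \<mapsto> u y\<close>, and averaging over the group against a character isolates a single summand of
  \<open>\<Sum>j<n. a j * y ^ j\<close> (\<open>isotypic_projection\<close>).  This is why all Riemann-Roch spaces below are spanned
  by monomials.

  \<^bold>\<open>The places.\<close>  Places exist because \<open>K(x, y)\<close> embeds into Laurent series over the algebraic closure
  of \<open>K\<close>: after \<open>x \<mapsto> \<alpha> + t ^ n\<close> or \<open>x \<mapsto> 1 / t\<close> the order of \<open>f(x)\<close> is divisible by \<open>n\<close>, so \<open>f(x)\<close> has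
  an \<open>n\<close>-th root (\<open>exists_place_over\<close>, \<open>exists_infinite_place\<close>).  There are not too many of them because
  a function \<open>p(x) / r(x)\<close> has at most \<open>n * max (degree p) (degree r)\<close> zeros, counted with
  multiplicity and degree (\<open>zeros_bound\<close>).  The Galois group moves one place over \<open>x = a\<close> through all
  \<open>n\<close> values of \<open>y\<close>, so over a point that is not a zero of \<open>f\<close>, and likewise at infinity, the bound is
  attained by \<open>n\<close> rational places (\<open>unramified_fibre\<close>); over a zero of \<open>f\<close> it leaves room for one
  rational place (\<open>fibre_ramified\<close>).  Adding up the rational places shows that the curve is maximal.

  \<^bold>\<open>The genus.\<close>  The space \<open>L(s D_inf)\<close> consists of the sums \<open>\<Sum>j<n. a j * y ^ j\<close> with
  \<open>degree (a j) + j * e \<le> s\<close> (\<open>RR_space_D_inf\<close>), so \<open>deg - dim + 1\<close> takes the value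
  \<open>(n - 1) (d - 2) / 2\<close> at \<open>s D_inf\<close> for large \<open>s\<close>.  No divisor \<open>A\<close> exceeds it: a polynomial \<open>z(x)\<close> with
  sufficiently high zeros embeds \<open>L(A)\<close> into some \<open>L(m D_inf)\<close>, where its codimension is at most the
  degree of the difference of the two divisors, and \<open>z\<close> has no more zeros than poles
  (\<open>Riemann_bound\<close>).  Dimensions are computed throughout by counting elements, as \<open>K\<close> is finite.

  \<^bold>\<open>The codes.\<close>  Words are values of \<open>\<Sum>j<n. A j * y ^ j\<close> at the points \<open>(a, b)\<close> with
  \<open>b ^ n = f(a) \<noteq> 0\<close>.  The sum of \<open>b ^ k\<close> over all \<open>b\<close> vanishes unless \<open>n\<close> divides \<open>k\<close>, and the sum of a
  polynomial of degree less than \<open>q\<close> over all \<open>a\<close> is minus its coefficient of degree \<open>q - 1\<close>.  Hence the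
  dual of the code of \<open>L(s D_inf)\<close> is the code of \<open>y L((q - 2 - s - e) D_inf)\<close> (\<open>dual_code_eq\<close>): the
  product of two functions has too small a degree to contribute, and a function outside that space
  is detected by one monomial that brings the product to degree exactly \<open>q - 1\<close>.  For \<open>s\<close> in the window
  evaluation is injective on both spaces, so the hull is the code of their intersection
  \<open>y L((\<mu> - e) D_inf)\<close>, and its dimension is a number of monomials.

  \<^bold>\<open>The quotient.\<close>  If \<open>z ^ (n m) = f(x) = y ^ n\<close>, then \<open>y\<close> is a constant times \<open>z ^ m\<close>, and averaging over
  the automorphisms \<open>z \<mapsto> u z\<close> with \<open>u ^ m = 1\<close> shows that their fixed field is \<open>K(x, z ^ m)\<close>.
\<close>


section \<open>Ring homomorphisms and evaluation of polynomials\<close>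

locale ring_map =
  fixes \<phi> :: "'a::comm_ring_1 \<Rightarrow> 'b::comm_ring_1"
  assumes one [simp]: "\<phi> 1 = 1"
    and add: "\<phi> (a + b) = \<phi> a + \<phi> b"
    and mult: "\<phi> (a * b) = \<phi> a * \<phi> b"
begin

lemma zero [simp]: "\<phi> 0 = 0"
  using add[of 0 0] by simp

lemma uminus: "\<phi> (- a) = - \<phi> a"
  using add[of a "- a"] by (simp add: eq_neg_iff_add_eq_0 add.commute)

lemma diff: "\<phi> (a - b) = \<phi> a - \<phi> b"
  using add[of a "- b"] by (simp add: uminus)

lemma power: "\<phi> (a ^ k) = \<phi> a ^ k"
  by (induction k) (simp_all add: mult)

lemma sum: "\<phi> (\<Sum>i\<in>A. g i) = (\<Sum>i\<in>A. \<phi> (g i))"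
  by (induction A rule: infinite_finite_induct) (simp_all add: add)

lemma prod: "\<phi> (\<Prod>i\<in>A. g i) = (\<Prod>i\<in>A. \<phi> (g i))"
  by (induction A rule: infinite_finite_induct) (simp_all add: mult)

lemma map_poly_plus: "map_poly \<phi> (p + q) = map_poly \<phi> p + map_poly \<phi> q"
  by (simp add: poly_eq_iff coeff_map_poly add)

lemma map_poly_times: "map_poly \<phi> (p * q) = map_poly \<phi> p * map_poly \<phi> q"
proof (induction p)
  case (pCons a p)
  have "map_poly \<phi> (smult a q) = smult (\<phi> a) (map_poly \<phi> q)"
    by (simp add: poly_eq_iff coeff_map_poly mult)
  then show ?case
    using pCons by (simp add: map_poly_plus map_poly_pCons)
qed simp

end

definition eval_hom :: "('a::comm_ring_1 \<Rightarrow> 'b::comm_ring_1) \<Rightarrow> 'b \<Rightarrow> 'a poly \<Rightarrow> 'b" where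
  "eval_hom \<phi> Y p = poly (map_poly \<phi> p) Y"

context ring_map
begin

lemma ring_map_eval_hom: "ring_map (eval_hom \<phi> Y)"
  by standard (simp_all add: eval_hom_def map_poly_plus map_poly_times map_poly_1)

lemma eval_hom_const [simp]: "eval_hom \<phi> Y [:c:] = \<phi> c"
  by (simp add: eval_hom_def map_poly_pCons)

lemma eval_hom_monom: "eval_hom \<phi> Y (monom c i) = \<phi> c * Y ^ i"
  by (simp add: eval_hom_def map_poly_monom poly_monom)

lemma eval_hom_pCons: "eval_hom \<phi> Y (pCons c p) = \<phi> c + Y * eval_hom \<phi> Y p"
  by (simp add: eval_hom_def map_poly_pCons)

end

lemma poly_as_sum_below:
  assumes "\<And>i. i \<ge> N \<Longrightarrow> coeff p i = 0"
  shows "p = (\<Sum>i<N. monom (coeff p i) i)"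
proof (rule poly_eqI)
  fix k
  have "coeff (\<Sum>i<N. monom (coeff p i) i) k = (\<Sum>i<N. if i = k then coeff p k else 0)"
    by (simp add: coeff_sum if_distrib cong: if_cong)
  also have "\<dots> = coeff p k"
    using assms[of k] by (cases "k < N") auto
  finally show "coeff p k = coeff (\<Sum>i<N. monom (coeff p i) i) k" ..
qed

lemma (in ring_map) eval_hom_eq_sum:
  assumes "\<And>i. i \<ge> N \<Longrightarrow> coeff p i = 0"
  shows "eval_hom \<phi> Y p = (\<Sum>i<N. \<phi> (coeff p i) * Y ^ i)"
proof -
  interpret E: ring_map "eval_hom \<phi> Y" by (rule ring_map_eval_hom)
  show ?thesis
    by (subst poly_as_sum_below[OF assms], simp, simp add: E.sum eval_hom_monom)
qed

section \<open>Constants, the coordinate x, and the polynomials in x\<close>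

definition cx :: "'k::field poly \<Rightarrow> 'k cover" where
  "cx p = to_ac (to_fract p)"

interpretation cx: ring_map cx
  by standard (simp_all add: cx_def)

lemma cx_eq_0_iff [simp]: "cx p = 0 \<longleftrightarrow> p = 0"
  by (simp add: cx_def)

lemma cx_eq_iff [simp]: "cx p = cx q \<longleftrightarrow> p = q"
  by (simp add: cx_def)

lemma cst_eq_cx: "cst c = cx [:c:]"
  by (simp add: cst_def cx_def)

lemma xcoord_eq_cx: "xcoord = cx [:0, 1:]"
  by (simp add: xcoord_def cx_def)

interpretation cst: ring_map cst
  by standard (simp_all add: cst_eq_cx pCons_one flip: cx.add cx.mult)

lemma cst_eq_0_iff [simp]: "cst c = 0 \<longleftrightarrow> c = 0"
  by (simp add: cst_eq_cx)

lemma cst_eq_iff [simp]: "cst c = cst d \<longleftrightarrow> c = d"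
  by (simp add: cst_eq_cx)

lemma eval_cst_xcoord: "eval_hom cst xcoord p = cx p"
proof (induction p)
  case (pCons c p)
  have "cx (pCons c p) = cx [:c:] + cx [:0, 1:] * cx p"
    by (simp flip: cx.add cx.mult)
  then show ?case
    by (simp only: cst.eval_hom_pCons pCons.IH flip: cst_eq_cx xcoord_eq_cx)
qed (simp add: eval_hom_def)

lemma on_curve_iff: "on_curve f n y \<longleftrightarrow> y ^ n = cx f"
  using eval_cst_xcoord[of f] by (simp add: on_curve_def eval_hom_def)

lemma (in ring_map) eval_hom_smult: "eval_hom \<phi> Y (smult c p) = \<phi> c * eval_hom \<phi> Y p"
proof (induction p)
  case (pCons a p)
  then show ?case by (simp add: eval_hom_pCons mult algebra_simps)
qed (simp add: eval_hom_def)

section \<open>The extension of the rational function field by an n-th root\<close>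

locale kummer =
  fixes f :: "'k::field poly" and n :: nat and y :: "'k cover"
  assumes y_power: "y ^ n = cx f"
    and n_pos: "n > 0"
    and f_nonzero: "f \<noteq> 0"
    and simple_root: "\<exists>a. order a f = 1"
begin

lemma y_nonzero: "y \<noteq> 0"
  using y_power f_nonzero n_pos by (auto simp: power_0_left)

definition relation :: "'k poly poly" where
  "relation = monom 1 n - [:f:]"

lemma degree_relation: "degree relation = n" and lead_coeff_relation: "lead_coeff relation = 1"
proof -
  have c: "coeff relation i = (if i = n then 1 else if i = 0 then - f else 0)" for i
    using n_pos by (auto simp: relation_def coeff_pCons split: nat.splits)
  show d: "degree relation = n"
    by (rule antisym) (auto intro!: degree_le le_degree simp: c)
  show "lead_coeff relation = 1"
    by (simp add: d c)
qed

lemma eval_relation: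
  assumes "ring_map \<phi>" "Y ^ n = \<phi> f"
  shows "eval_hom \<phi> Y relation = 0"
proof -
  interpret ring_map \<phi> by fact
  interpret E: ring_map "eval_hom \<phi> Y" by (rule ring_map_eval_hom)
  show ?thesis
    by (simp add: relation_def E.diff eval_hom_monom assms(2))
qed

lemma reduce_mod_relation:
  obtains Q R where "P = relation * Q + R" "degree R < n"
proof -
  obtain Q R where qr: "pseudo_divmod P relation = (Q, R)" by fastforce
  have "relation \<noteq> 0" using lead_coeff_relation by auto
  from pseudo_divmod[OF this qr] have "P = relation * Q + R" "R = 0 \<or> degree R < n"
    using lead_coeff_relation by (simp_all add: degree_relation)
  then show thesis using that[of Q R] n_pos by fastforce
qed

abbreviation E :: "'k poly poly \<Rightarrow> 'k cover" where "E \<equiv> eval_hom cx y"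

sublocale E: ring_map E
  by (rule cx.ring_map_eval_hom)

text \<open>
  The powers of \<open>y\<close> below \<open>n\<close> are independent over \<open>K(x)\<close>.  The roots of a relation \<open>S\<close> of minimal
  degree \<open>m\<close> are roots of \<open>Y ^ n - f\<close>, so the \<open>n\<close>-th power of their product is \<open>f ^ m\<close> up to sign.  Hence
  \<open>f ^ m\<close> is an \<open>n\<close>-th power in \<open>K(x)\<close> up to sign, and counting multiplicities at a simple zero of \<open>f\<close>
  shows that \<open>n\<close> divides \<open>m\<close>.
\<close>

lemma eval_eq_0_imp_degree_ge:
  assumes "R \<noteq> 0" "E R = 0"
  shows "degree R \<ge> n"
proof (rule ccontr)
  assume less: "\<not> degree R \<ge> n"
  define S where "S = arg_min degree (\<lambda>R. R \<noteq> 0 \<and> E R = 0)"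
  have S: "S \<noteq> 0" "E S = 0" and S_min: "\<And>T. T \<noteq> 0 \<Longrightarrow> E T = 0 \<Longrightarrow> degree S \<le> degree T"
    using arg_min_nat_lemma[of "\<lambda>R. R \<noteq> 0 \<and> E R = 0" R degree] assms by (auto simp: S_def)
  define m where "m = degree S"
  have mn: "m < n" using S_min[OF assms] less by (simp add: m_def)
  have m0: "m > 0"
  proof (rule ccontr)
    assume "\<not> m > 0"
    then obtain c where "S = [:c:]" using degree_eq_zeroE[of S] by (auto simp: m_def)
    with S show False by simp
  qed
  obtain Q T where QT: "pseudo_divmod relation S = (Q, T)" by fastforce
  \<comment> \<open>Pseudo-division of the relation by \<open>S\<close>: the remainder vanishes by minimality.\<close>
  define l where "l = lead_coeff S"
  define k where "k = Suc (degree relation) - degree S"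
  have div: "smult (l ^ k) relation = S * Q + T" and T: "T = 0 \<or> degree T < degree S"
    using pseudo_divmod[OF S(1) QT] by (auto simp: l_def k_def)
  have l0: "l \<noteq> 0" using S by (simp add: l_def)
  have "E T = 0"
    using arg_cong[OF div, of E] eval_relation[of cx y] y_power S
    by (simp add: cx.eval_hom_smult E.add E.mult cx.ring_map_axioms)
  with T S_min have "T = 0" by fastforce
  define S' where "S' = map_poly cx S"
  have deg': "degree S' = m" and lc': "lead_coeff S' = cx l" and S'0: "S' \<noteq> 0"
  proof -
    show "degree S' = m" unfolding S'_def m_def by (rule degree_map_poly) simp
    then show "lead_coeff S' = cx l" by (simp add: S'_def coeff_map_poly l_def m_def)
    with l0 show "S' \<noteq> 0" by auto
  qed
  obtain A where A: "size A = m" "S' = smult (cx l) (\<Prod>r\<in>#A. [:-r, 1:])"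
    using alg_closed_imp_factorization[OF S'0] deg' lc' by auto
  have root: "r ^ n = cx f" if "r \<in># A" for r
  proof -
    interpret R: ring_map "eval_hom cx r" by (rule cx.ring_map_eval_hom)
    from that obtain B where "A = add_mset r B" by (metis insert_DiffM)
    then have "poly S' r = 0" by (subst A(2)) simp
    then have "eval_hom cx r S = 0" by (simp add: eval_hom_def S'_def)
    with arg_cong[OF div, of "eval_hom cx r"] \<open>T = 0\<close> l0
    have "eval_hom cx r relation = 0"
      by (simp add: cx.eval_hom_smult R.add R.mult)
    then show ?thesis
      by (simp add: relation_def R.diff cx.eval_hom_monom)
  qed
  have c0: "cx (coeff S 0) = cx l * (\<Prod>r\<in>#A. - r)"
  proof -
    have "cx (coeff S 0) = poly S' 0" by (simp add: S'_def poly_0_coeff_0 coeff_map_poly)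
    also have "\<dots> = cx l * (\<Prod>r\<in>#A. - r)"
      by (subst A(2)) (simp add: poly_prod_mset)
    finally show ?thesis .
  qed
  have "(\<Prod>r\<in>#A. - r) ^ n = (\<Prod>r\<in>#A. (- r) ^ n)"
    by (induction A) (simp_all only: image_mset_empty prod_mset_empty power_one image_mset_add_mset
        prod_mset.add_mset power_mult_distrib)
  also have "\<dots> = (\<Prod>r\<in>#A. (- 1) ^ n * cx f)"
    by (rule arg_cong[of _ _ prod_mset], rule image_mset_cong) (metis power_minus root)
  also have "\<dots> = ((- 1) ^ n * cx f) ^ m"
    using A(1) by simp
  finally have "cx (coeff S 0) ^ n = cx l ^ n * ((- 1) ^ n * cx f) ^ m"
    by (simp add: c0 power_mult_distrib)
  also have "\<dots> = cx (l ^ n * ((- 1) ^ n * f) ^ m)"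
    by (simp add: cx.mult cx.power cx.uminus)
  also have "cx (coeff S 0) ^ n = cx (coeff S 0 ^ n)"
    by (simp add: cx.power)
  finally have eq: "coeff S 0 ^ n = l ^ n * ((- 1) ^ n * f) ^ m"
    by (simp only: cx_eq_iff)
  obtain a where a: "order a f = 1" using simple_root by blast
  have order_power: "order a (p ^ j) = j * order a p" if "p \<noteq> 0" for p j
    using that by (induction j) (simp_all add: order_mult)
  have c00: "coeff S 0 \<noteq> 0"
    using eq l0 f_nonzero n_pos by (auto simp: power_0_left)
  have "order a ((- 1) ^ n * f) = 1"
    using a by (cases "even n") simp_all
  with arg_cong[OF eq, of "order a"] c00 l0 f_nonzero
  have "n * order a (coeff S 0) = n * order a l + m"
    by (simp add: order_mult order_power)
  then have "n dvd m"
    by (metis dvd_add_right_iff dvd_triv_left)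
  with m0 mn show False by (auto dest: dvd_imp_le)
qed

lemma E_eq_0_imp_dvd: assumes "E P = 0" shows "relation dvd P"
proof -
  obtain Q R where QR: "P = relation * Q + R" "degree R < n" by (rule reduce_mod_relation)
  have "E R = 0"
    using arg_cong[OF QR(1), of E] assms eval_relation[of cx y] y_power
    by (simp add: E.add E.mult cx.ring_map_axioms)
  with eval_eq_0_imp_degree_ge[of R] QR have "R = 0" by force
  with QR show ?thesis by simp
qed

lemma eval_hom_eq_0:
  assumes "ring_map \<phi>" "Y ^ n = \<phi> f" "E P = 0"
  shows "eval_hom \<phi> Y P = 0"
proof -
  interpret ring_map \<phi> by fact
  interpret E': ring_map "eval_hom \<phi> Y" by (rule ring_map_eval_hom)
  obtain Q where "P = relation * Q" using E_eq_0_imp_dvd[OF assms(3)] by blast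
  then show ?thesis using eval_relation[OF assms(1,2)] by (simp add: E'.mult)
qed

text \<open>
  The field \<open>K(x, y)\<close>: denominators in \<open>K[x]\<close> suffice, since \<open>y\<close> is integral over \<open>K[x]\<close>.
\<close>

definition Kxy :: "'k cover set" where
  "Kxy = {E P / cx b | P b. b \<noteq> 0}"

lemma Kxy_I: "b \<noteq> 0 \<Longrightarrow> E P / cx b \<in> Kxy"
  by (auto simp: Kxy_def)

lemma Kxy_E:
  assumes "h \<in> Kxy" obtains P b where "h = E P / cx b" "b \<noteq> 0"
  using assms by (auto simp: Kxy_def)

lemma cx_Kxy [simp]: "cx p \<in> Kxy"
  using Kxy_I[of 1 "[:p:]"] by simp

lemma cst_Kxy [simp]: "cst c \<in> Kxy" by (simp add: cst_eq_cx)

lemma E_Kxy [simp]: "E P \<in> Kxy"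
  using Kxy_I[of 1 P] by simp

lemma E_y: "E [:0, 1:] = y"
  using cx.eval_hom_pCons[of y 0 "[:1:]"] by (simp only: cx.eval_hom_const cx.zero cx.one) simp

lemma y_Kxy [simp]: "y \<in> Kxy" using E_Kxy[of "[:0,1:]"] by (simp only: E_y)

lemma Kxy_add [simp]: assumes "g \<in> Kxy" "h \<in> Kxy" shows "g + h \<in> Kxy"
proof -
  obtain P b Q c where g: "g = E P / cx b" "b \<noteq> 0" and h: "h = E Q / cx c" "c \<noteq> 0"
    using assms by (metis Kxy_E)
  have "g + h = E ([:c:] * P + [:b:] * Q) / cx (b * c)"
    using g h by (simp add: E.add E.mult cx.eval_hom_smult cx.mult field_simps)
  then show ?thesis using g h Kxy_I[of "b * c"] by simp
qed

lemma Kxy_mult [simp]: assumes "g \<in> Kxy" "h \<in> Kxy" shows "g * h \<in> Kxy"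
proof -
  obtain P b Q c where g: "g = E P / cx b" "b \<noteq> 0" and h: "h = E Q / cx c" "c \<noteq> 0"
    using assms by (metis Kxy_E)
  have "g * h = E (P * Q) / cx (b * c)"
    using g h by (simp add: E.mult cx.mult)
  then show ?thesis using g h Kxy_I[of "b * c"] by simp
qed

lemma Kxy_uminus [simp]: "g \<in> Kxy \<Longrightarrow> - g \<in> Kxy"
  using Kxy_mult[OF cst_Kxy[of "-1"], of g] by (simp add: cst.uminus del: Kxy_mult cst_Kxy)

lemma Kxy_diff [simp]: "g \<in> Kxy \<Longrightarrow> h \<in> Kxy \<Longrightarrow> g - h \<in> Kxy"
  using Kxy_add[of g "- h"] by (simp del: Kxy_add)

lemma Kxy_0 [simp]: "0 \<in> Kxy" and Kxy_1 [simp]: "1 \<in> Kxy"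
  using cst_Kxy[of 0] cst_Kxy[of 1] by (simp_all del: cst_Kxy)

lemma Kxy_power [simp]: "g \<in> Kxy \<Longrightarrow> g ^ k \<in> Kxy"
  by (induction k) auto

lemma Kxy_sum [simp]: "(\<And>i. i \<in> A \<Longrightarrow> g i \<in> Kxy) \<Longrightarrow> (\<Sum>i\<in>A. g i) \<in> Kxy"
  by (induction A rule: infinite_finite_induct) auto

lemma Kxy_prod [simp]: "(\<And>i. i \<in> A \<Longrightarrow> g i \<in> Kxy) \<Longrightarrow> (\<Prod>i\<in>A. g i) \<in> Kxy"
  by (induction A rule: infinite_finite_induct) auto

text \<open>
  The extension of a homomorphism \<open>\<phi>\<close> on \<open>K[x]\<close> to \<open>K(x, y)\<close> that sends \<open>y\<close> to \<open>Y\<close>.  It serves both for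
  the Galois action (with values in the same field) and for Laurent expansions at a point.
\<close>

definition lift :: "('k poly \<Rightarrow> 'b::field) \<Rightarrow> 'b \<Rightarrow> 'k cover \<Rightarrow> 'b" where
  "lift \<phi> Y h = (let (P, b) = SOME (P, b). b \<noteq> 0 \<and> h = E P / cx b in eval_hom \<phi> Y P / \<phi> b)"

context
  fixes \<phi> :: "'k poly \<Rightarrow> 'b::field" and Y :: 'b
  assumes \<phi>: "ring_map \<phi>" and inj: "\<And>p. \<phi> p = 0 \<Longrightarrow> p = 0" and Y: "Y ^ n = \<phi> f"
begin

interpretation \<phi>: ring_map \<phi> by (rule \<phi>)
interpretation E': ring_map "eval_hom \<phi> Y" by (rule \<phi>.ring_map_eval_hom)

text \<open>
  The value does not depend on the chosen fraction, because every relation satisfied by \<open>y\<close> is a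
  multiple of \<open>Y ^ n - f\<close> and hence is satisfied by \<open>Y\<close>.
\<close>

lemma lift_eq:
  assumes "b \<noteq> 0" shows "lift \<phi> Y (E P / cx b) = eval_hom \<phi> Y P / \<phi> b"
proof -
  define Pb where "Pb = (SOME (Q, c). c \<noteq> 0 \<and> E P / cx b = E Q / cx c)"
  obtain Q c where Qc: "Pb = (Q, c)" by fastforce
  have "c \<noteq> 0 \<and> E P / cx b = E Q / cx c"
    using someI[of "\<lambda>(Q, c). c \<noteq> 0 \<and> E P / cx b = E Q / cx c" "(P, b)"] assms Qc
    by (auto simp: Pb_def)
  then have c: "c \<noteq> 0" and eq: "E P / cx b = E Q / cx c" by auto
  have "E ([:c:] * P - [:b:] * Q) = 0"
    using eq c assms by (simp add: E.diff E.mult cx.eval_hom_smult field_simps)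
  then have "eval_hom \<phi> Y ([:c:] * P - [:b:] * Q) = 0"
    by (rule eval_hom_eq_0[OF \<phi> Y])
  then have "\<phi> c * eval_hom \<phi> Y P = \<phi> b * eval_hom \<phi> Y Q"
    by (simp add: E'.diff \<phi>.eval_hom_smult)
  moreover have "\<phi> c \<noteq> 0" "\<phi> b \<noteq> 0" using inj c assms by auto
  moreover have "lift \<phi> Y (E P / cx b) = eval_hom \<phi> Y Q / \<phi> c"
    unfolding lift_def Pb_def[symmetric] Qc by simp
  ultimately show ?thesis by (simp add: frac_eq_eq mult.commute)
qed

lemma lift_E: "lift \<phi> Y (E P) = eval_hom \<phi> Y P"
  using lift_eq[of 1 P] by simp

lemma lift_cx: "lift \<phi> Y (cx p) = \<phi> p"
  using lift_E[of "[:p:]"] by simp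

lemma lift_normal_form:
  assumes "b \<noteq> 0"
  shows "lift \<phi> Y ((\<Sum>j<n. cx (a j) * y ^ j) / cx b) = (\<Sum>j<n. \<phi> (a j) * Y ^ j) / \<phi> b"
proof -
  have "(\<Sum>j<n. cx (a j) * y ^ j) = E (\<Sum>j<n. monom (a j) j)"
    by (simp add: E.sum cx.eval_hom_monom)
  then show ?thesis
    using assms by (simp add: lift_eq E'.sum \<phi>.eval_hom_monom)
qed

lemma lift_y: "lift \<phi> Y y = Y"
  using lift_E[of "[:0,1:]"] \<phi>.eval_hom_pCons[of Y 0 "[:1:]"]
  by (simp only: E_y \<phi>.eval_hom_const \<phi>.zero \<phi>.one) simp

lemma lift_add: assumes "g \<in> Kxy" "h \<in> Kxy" shows "lift \<phi> Y (g + h) = lift \<phi> Y g + lift \<phi> Y h"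
proof -
  obtain P b Q c where g: "g = E P / cx b" "b \<noteq> 0" and h: "h = E Q / cx c" "c \<noteq> 0"
    using assms by (metis Kxy_E)
  have "g + h = E ([:c:] * P + [:b:] * Q) / cx (b * c)"
    using g h by (simp add: E.add E.mult cx.eval_hom_smult cx.mult field_simps)
  moreover have "\<phi> b \<noteq> 0" "\<phi> c \<noteq> 0" using inj g h by auto
  ultimately have "lift \<phi> Y (g + h) = eval_hom \<phi> Y P / \<phi> b + eval_hom \<phi> Y Q / \<phi> c"
    using g(2) h(2) by (simp add: lift_eq E'.add \<phi>.eval_hom_smult \<phi>.mult add_divide_distrib)
  then show ?thesis
    using g h by (simp add: lift_eq)
qed

lemma lift_mult: assumes "g \<in> Kxy" "h \<in> Kxy" shows "lift \<phi> Y (g * h) = lift \<phi> Y g * lift \<phi> Y h"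
proof -
  obtain P b Q c where g: "g = E P / cx b" "b \<noteq> 0" and h: "h = E Q / cx c" "c \<noteq> 0"
    using assms by (metis Kxy_E)
  have "g * h = E (P * Q) / cx (b * c)"
    using g h by (simp add: E.mult cx.mult)
  then show ?thesis
    using g h by (simp add: lift_eq E'.mult \<phi>.mult)
qed

end

lemma Kxy_normal_form:
  assumes "h \<in> Kxy"
  obtains a b where "b \<noteq> 0" "h = (\<Sum>j<n. cx (a j) * y ^ j) / cx b"
proof -
  obtain P b where h: "h = E P / cx b" "b \<noteq> 0" using assms by (rule Kxy_E)
  obtain Q R where QR: "P = relation * Q + R" "degree R < n" by (rule reduce_mod_relation)
  have "E P = E R"
    using QR eval_relation[of cx y] y_power by (simp add: E.add E.mult cx.ring_map_axioms)
  also have "\<dots> = (\<Sum>j<n. cx (coeff R j) * y ^ j)"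
    by (rule cx.eval_hom_eq_sum) (use QR(2) in \<open>simp add: coeff_eq_0\<close>)
  finally show thesis using that[of b "coeff R"] h by simp
qed

lemma basis_unique:
  assumes "(\<Sum>j<n. cx (a j) * y ^ j) = (\<Sum>j<n. cx (b j) * y ^ j)" "j < n"
  shows "a j = b j"
proof -
  define R where "R = (\<Sum>j<n. monom (a j - b j) j)"
  have c: "coeff R i = (if i < n then a i - b i else 0)" for i
    by (simp add: R_def coeff_sum if_distrib cong: if_cong)
  have "E R = 0"
    using assms(1) by (simp add: R_def E.sum cx.eval_hom_monom cx.diff left_diff_distrib sum_subtractf)
  moreover have "degree R < n" using n_pos by (cases n) (auto simp: c less_Suc_eq_le intro!: degree_le)
  ultimately have "R = 0" using eval_eq_0_imp_degree_ge[of R] by fastforce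
  then show ?thesis using c[of j] assms(2) by simp
qed

end

lemma cst_of_nat: "cst (of_nat k) = of_nat k"
  by (induction k) (simp_all add: cst.add)

section \<open>Roots of unity and the Galois action\<close>

lemma card_roots_of_unity_le:
  assumes "k > 0" shows "card {u::'a::idom. u ^ k = c} \<le> k" "finite {u::'a::idom. u ^ k = c}"
proof -
  define p where "p = monom (1::'a) k - [:c:]"
  have "coeff p k = 1" using assms by (auto simp: p_def coeff_pCons split: nat.splits)
  then have p0: "p \<noteq> 0" by auto
  have eq: "{u. u ^ k = c} = {u. poly p u = 0}"
    by (simp add: p_def poly_monom)
  have "degree p \<le> k"
    unfolding p_def by (rule degree_diff_le) (simp_all add: degree_monom_le)
  with card_poly_roots_bound[OF p0] show "card {u::'a. u ^ k = c} \<le> k"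
    by (simp add: eq)
  show "finite {u::'a. u ^ k = c}" using poly_roots_finite[OF p0] by (simp add: eq)
qed

text \<open>
  If \<open>n\<close> does not divide \<open>k\<close>, some root of unity \<open>w\<close> has \<open>w ^ k \<noteq> 1\<close>, as \<open>u ^ (k mod n) = 1\<close> has fewer
  than \<open>n\<close> solutions; multiplication by \<open>w\<close> permutes the summands and multiplies the sum by \<open>w ^ k\<close>.
\<close>

lemma sum_roots_of_unity_power:
  assumes n: "n > 0" and card: "card {u::'k::field. u ^ n = 1} = n"
  shows "(\<Sum>u | u ^ n = 1. u ^ k) = (if n dvd k then of_nat n else (0::'k))"
proof (cases "n dvd k")
  case True
  then obtain m where m: "k = n * m" by blast
  have "(\<Sum>u::'k | u ^ n = 1. u ^ k) = (\<Sum>u::'k | u ^ n = 1. 1)"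
    by (rule sum.cong) (auto simp: m power_mult)
  then show ?thesis using True card by simp
next
  case False
  define r where "r = k mod n"
  have r: "0 < r" "r < n" using False n by (auto simp: r_def mod_greater_zero_iff_not_dvd)
  have red: "u ^ k = u ^ r" if "u ^ n = 1" for u :: 'k
  proof -
    have "u ^ (n * (k div n) + r) = u ^ r" using that by (simp add: power_add power_mult)
    then show ?thesis by (simp add: r_def)
  qed
  have "\<not> {u::'k. u ^ n = 1} \<subseteq> {u. u ^ r = 1}"
    using card_mono[of "{u::'k. u ^ r = 1}" "{u. u ^ n = 1}"] card_roots_of_unity_le[OF r(1), of "1::'k"] card r
    by fastforce
  then obtain w :: 'k where w: "w ^ n = 1" "w ^ r \<noteq> 1" by blast
  have w0: "w \<noteq> 0" using w n by (auto simp: power_0_left)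
  have "(\<Sum>u | u ^ n = 1. u ^ k) = (\<Sum>u | u ^ n = 1. (w * u) ^ k)"
    by (rule sum.reindex_bij_witness[of _ "\<lambda>u. w * u" "\<lambda>u. u / w"])
       (use w w0 in \<open>auto simp: power_mult_distrib power_divide\<close>)
  also have "\<dots> = w ^ k * (\<Sum>u | u ^ n = 1. u ^ k)"
    by (simp add: power_mult_distrib sum_distrib_left)
  finally have "(1 - w ^ k) * (\<Sum>u | u ^ n = 1. u ^ k) = 0"
    by (simp add: algebra_simps)
  with w red[of w] False show ?thesis by simp
qed

locale kummer_galois = kummer f n y
  for f :: "'k::field poly" and n :: nat and y :: "'k cover" +
  assumes card_mu: "card {u::'k. u ^ n = 1} = n"
    and n_nonzero: "of_nat n \<noteq> (0::'k)"
begin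

definition mu_n :: "'k set" where "mu_n = {u. u ^ n = 1}"

lemma finite_mu_n [simp]: "finite mu_n"
  using card_roots_of_unity_le(2)[OF n_pos] by (simp add: mu_n_def)

lemma card_mu_n: "card mu_n = n"
  using card_mu by (simp add: mu_n_def)

lemma mu_n_nonzero: "u \<in> mu_n \<Longrightarrow> u \<noteq> 0"
  using n_pos by (auto simp: mu_n_def power_0_left)

lemma one_mu_n [simp]: "1 \<in> mu_n" by (simp add: mu_n_def)

lemma mult_mu_n: "u \<in> mu_n \<Longrightarrow> w \<in> mu_n \<Longrightarrow> u * w \<in> mu_n"
  by (simp add: mu_n_def power_mult_distrib)

lemma inverse_mu_n: "u \<in> mu_n \<Longrightarrow> inverse u \<in> mu_n"
  by (simp add: mu_n_def power_inverse)

definition sigma :: "'k \<Rightarrow> 'k cover \<Rightarrow> 'k cover" where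
  "sigma u = lift cx (cst u * y)"

lemma sigma_pre: "u \<in> mu_n \<Longrightarrow> (cst u * y) ^ n = cx f"
  by (simp add: power_mult_distrib y_power mu_n_def flip: cst.power)

context
  fixes u assumes u: "u \<in> mu_n"
begin

lemma sigma_cx [simp]: "sigma u (cx p) = cx p"
  unfolding sigma_def by (rule lift_cx) (use sigma_pre[OF u] in \<open>auto simp: cx.ring_map_axioms\<close>)

lemma sigma_cst [simp]: "sigma u (cst c) = cst c"
  by (simp add: cst_eq_cx)

lemma sigma_y [simp]: "sigma u y = cst u * y"
  unfolding sigma_def by (rule lift_y) (use sigma_pre[OF u] in \<open>auto simp: cx.ring_map_axioms\<close>)

lemma sigma_add: "g \<in> Kxy \<Longrightarrow> h \<in> Kxy \<Longrightarrow> sigma u (g + h) = sigma u g + sigma u h"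
  unfolding sigma_def by (rule lift_add) (use sigma_pre[OF u] in \<open>auto simp: cx.ring_map_axioms\<close>)

lemma sigma_mult: "g \<in> Kxy \<Longrightarrow> h \<in> Kxy \<Longrightarrow> sigma u (g * h) = sigma u g * sigma u h"
  unfolding sigma_def by (rule lift_mult) (use sigma_pre[OF u] in \<open>auto simp: cx.ring_map_axioms\<close>)

lemma sigma_prod: "(\<And>i. i \<in> A \<Longrightarrow> g i \<in> Kxy) \<Longrightarrow> sigma u (\<Prod>i\<in>A. g i) = (\<Prod>i\<in>A. sigma u (g i))"
  using sigma_cst[of 1] by (induction A rule: infinite_finite_induct) (auto simp: sigma_mult)

lemma sigma_normal_form:
  assumes "b \<noteq> 0"
  shows "sigma u ((\<Sum>j<n. cx (a j) * y ^ j) / cx b) = (\<Sum>j<n. cx (smult (u ^ j) (a j)) * y ^ j) / cx b"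
proof -
  have "sigma u ((\<Sum>j<n. cx (a j) * y ^ j) / cx b) = (\<Sum>j<n. cx (a j) * (cst u * y) ^ j) / cx b"
    unfolding sigma_def by (rule lift_normal_form) (use sigma_pre[OF u] assms in \<open>auto simp: cx.ring_map_axioms\<close>)
  also have "(\<Sum>j<n. cx (a j) * (cst u * y) ^ j) = (\<Sum>j<n. cx (smult (u ^ j) (a j)) * y ^ j)"
  proof (rule sum.cong[OF refl])
    fix j
    have "cx (smult (u ^ j) (a j)) = cx [:u ^ j:] * cx (a j)" by (simp flip: cx.mult)
    then show "cx (a j) * (cst u * y) ^ j = cx (smult (u ^ j) (a j)) * y ^ j"
      by (simp add: power_mult_distrib mult_ac flip: cst_eq_cx cst.power)
  qed
  finally show ?thesis .
qed

lemma sigma_Kxy [simp]: assumes "h \<in> Kxy" shows "sigma u h \<in> Kxy"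
proof -
  obtain a b where b: "b \<noteq> 0" and h: "h = (\<Sum>j<n. cx (a j) * y ^ j) / cx b"
    using Kxy_normal_form[OF assms] by blast
  have "sigma u h = E (\<Sum>j<n. monom (smult (u ^ j) (a j)) j) / cx b"
    using sigma_normal_form[OF b] by (simp add: h E.sum cx.eval_hom_monom)
  then show ?thesis using Kxy_I[OF b] by simp
qed

end

lemma sigma_comp:
  assumes "u \<in> mu_n" "w \<in> mu_n" "h \<in> Kxy"
  shows "sigma w (sigma u h) = sigma (w * u) h"
proof -
  obtain a b where b: "b \<noteq> 0" and h: "h = (\<Sum>j<n. cx (a j) * y ^ j) / cx b"
    using Kxy_normal_form[OF assms(3)] by blast
  show ?thesis
    using assms by (simp add: h sigma_normal_form b mult_mu_n power_mult_distrib)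
qed

lemma sigma_1 [simp]: assumes "h \<in> Kxy" shows "sigma 1 h = h"
proof -
  obtain a b where b: "b \<noteq> 0" and h: "h = (\<Sum>j<n. cx (a j) * y ^ j) / cx b"
    using Kxy_normal_form[OF assms(1)] by blast
  show ?thesis
    using assms by (simp add: h sigma_normal_form b)
qed

text \<open>
  The Galois group acts on \<open>a j * y ^ j\<close> through the character \<open>u ^ j\<close>, so orthogonality of characters
  isolates the summand with index \<open>i\<close>.  The exponent \<open>n - i\<close> stands for \<open>- i\<close>.
\<close>

lemma isotypic_projection:
  assumes "b \<noteq> 0" "i < n"
  shows "(\<Sum>u\<in>mu_n. cst (u ^ (n - i)) * sigma u ((\<Sum>j<n. cx (a j) * y ^ j) / cx b))
           = cst (of_nat n) * cx (a i) * y ^ i / cx b"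
proof -
  have "(\<Sum>u\<in>mu_n. cst (u ^ (n - i)) * sigma u ((\<Sum>j<n. cx (a j) * y ^ j) / cx b))
    = (\<Sum>u\<in>mu_n. \<Sum>j<n. cst (u ^ (n - i + j)) * (cx (a j) * y ^ j / cx b))"
  proof (rule sum.cong[OF refl])
    fix u assume u: "u \<in> mu_n"
    have "cst (u ^ (n - i)) * cx (smult (u ^ j) (a j)) = cst (u ^ (n - i + j)) * cx (a j)" for j
      by (simp add: cst_eq_cx power_add mult.commute[of "u ^ j"] flip: cx.mult)
    then show "cst (u ^ (n - i)) * sigma u ((\<Sum>j<n. cx (a j) * y ^ j) / cx b)
       = (\<Sum>j<n. cst (u ^ (n - i + j)) * (cx (a j) * y ^ j / cx b))"
      by (subst sigma_normal_form[OF u assms(1)])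
         (simp add: sum_distrib_left sum_divide_distrib flip: mult.assoc)
  qed
  also have "\<dots> = (\<Sum>j<n. cst (\<Sum>u\<in>mu_n. u ^ (n - i + j)) * (cx (a j) * y ^ j / cx b))"
    by (subst sum.swap) (simp only: cst.sum sum_distrib_right)
  also have "\<dots> = (\<Sum>j<n. if j = i then cst (of_nat n) * (cx (a j) * y ^ j / cx b) else 0)"
  proof (rule sum.cong[OF refl])
    fix j assume "j \<in> {..<n}"
    then have "n dvd n - i + j \<longleftrightarrow> j = i"
    proof -
      have "n - i + j < 2 * n" "0 < n - i + j" using \<open>j \<in> {..<n}\<close> assms(2) by auto
      have "n dvd n - i + j \<longleftrightarrow> n - i + j = n"
      proof
        assume "n dvd n - i + j"
        then obtain k where k: "n - i + j = n * k" by blast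
        with \<open>n - i + j < 2 * n\<close> have "n * k < n * 2" by (simp add: mult.commute)
        then have "k < 2" by simp
        moreover have "k \<noteq> 0" using k \<open>0 < n - i + j\<close> by auto
        ultimately have "k = 1" by simp
        with k show "n - i + j = n" by simp
      qed simp
      then show ?thesis using assms(2) by auto
    qed
    then show "cst (\<Sum>u\<in>mu_n. u ^ (n - i + j)) * (cx (a j) * y ^ j / cx b)
      = (if j = i then cst (of_nat n) * (cx (a j) * y ^ j / cx b) else 0)"
      using sum_roots_of_unity_power[OF n_pos card_mu, of "n - i + j"] by (simp add: mu_n_def)
  qed
  also have "\<dots> = cst (of_nat n) * cx (a i) * y ^ i / cx b"
    using assms(2) by (simp add: mult.assoc)
  finally show ?thesis .
qed

lemma sigma_fixed:
  assumes "h \<in> Kxy" "\<And>u. u \<in> mu_n \<Longrightarrow> sigma u h = h"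
  obtains a b where "b \<noteq> 0" "h = cx a / cx b"
proof -
  obtain a b where b: "b \<noteq> 0" and h: "h = (\<Sum>j<n. cx (a j) * y ^ j) / cx b"
    using Kxy_normal_form[OF assms(1)] by blast
  have "(\<Sum>u\<in>mu_n. cst (u ^ (n - 0)) * sigma u h) = (\<Sum>u\<in>mu_n. h)"
    by (rule sum.cong) (auto simp: assms(2) mu_n_def)
  also have "\<dots> = cst (of_nat n) * h"
    by (simp add: card_mu_n cst_of_nat)
  finally have "cst (of_nat n) * h = cst (of_nat n) * (cx (a 0) / cx b)"
    using isotypic_projection[OF b n_pos, of a] by (simp add: h)
  moreover have "cst (of_nat n) \<noteq> (0 :: 'k cover)" using n_nonzero by simp
  ultimately have "h = cx (a 0) / cx b" using mult_left_cancel by blast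
  with b that show thesis by blast
qed

lemma sigma_eq_0_iff: assumes "u \<in> mu_n" "h \<in> Kxy" shows "sigma u h = 0 \<longleftrightarrow> h = 0"
proof
  assume "sigma u h = 0"
  then have "sigma (inverse u * u) h = 0"
    using sigma_comp[OF assms(1) inverse_mu_n[OF assms(1)] assms(2)] sigma_cst[OF inverse_mu_n[OF assms(1)], of 0] by simp
  then show "h = 0" using assms mu_n_nonzero[OF assms(1)] by simp
next
  assume "h = 0" then show "sigma u h = 0" using sigma_cst[OF assms(1), of 0] by simp
qed

text \<open>
  The product of the conjugates of \<open>h\<close> is fixed by the Galois group, hence lies in \<open>K(x)\<close>; it is \<open>h\<close>
  times an element of the same ring.
\<close>

lemma Kxy_inverse [simp]:
  assumes "h \<in> Kxy" shows "inverse h \<in> Kxy"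
proof (cases "h = 0")
  case False
  define N where "N = (\<Prod>u\<in>mu_n. sigma u h)"
  have Nc: "N \<in> Kxy" using assms by (simp add: N_def)
  have "sigma w N = N" if w: "w \<in> mu_n" for w
  proof -
    have "sigma w N = (\<Prod>u\<in>mu_n. sigma (w * u) h)"
      using assms w by (simp add: N_def sigma_prod sigma_comp)
    also have "\<dots> = N"
      unfolding N_def
      by (rule prod.reindex_bij_witness[of _ "\<lambda>u. inverse w * u" "\<lambda>u. w * u"])
         (use w mu_n_nonzero[OF w] in \<open>auto simp: mult_mu_n inverse_mu_n simp flip: mult.assoc\<close>)
    finally show ?thesis .
  qed
  then obtain a b where b: "b \<noteq> 0" and N: "N = cx a / cx b"
    using sigma_fixed[OF Nc] by blast
  have nz: "sigma u h \<noteq> 0" if "u \<in> mu_n" for u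
    using sigma_eq_0_iff[OF that assms] False by simp
  then have "N \<noteq> 0" by (simp add: N_def)
  with N b have a: "a \<noteq> 0" by auto
  have "N = h * (\<Prod>u\<in>mu_n - {1}. sigma u h)"
    unfolding N_def using assms by (subst prod.remove[of _ 1]) auto
  then have "inverse h = (\<Prod>u\<in>mu_n - {1}. sigma u h) * inverse N"
    using False \<open>N \<noteq> 0\<close> by (simp add: field_simps)
  also have "inverse N = E [:b:] / cx a" by (simp add: N)
  also have "(\<Prod>u\<in>mu_n - {1}. sigma u h) * (E [:b:] / cx a) \<in> Kxy"
    using assms by (intro Kxy_mult Kxy_prod Kxy_I a) auto
  finally show ?thesis .
qed simp

lemma Kxy_divide [simp]: "g \<in> Kxy \<Longrightarrow> h \<in> Kxy \<Longrightarrow> g / h \<in> Kxy"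
  by (simp add: divide_inverse)

lemma is_subfield_Kxy: "is_subfield Kxy"
  by (simp add: is_subfield_def)

lemma curve_field_eq: "curve_field y = Kxy"
proof -
  have "Kxy \<subseteq> t" if t: "is_subfield t" "range cst \<union> {xcoord, y} \<subseteq> t" for t
  proof -
    have mult: "a * b \<in> t" and inv: "inverse a \<in> t" and sub: "a - b \<in> t" if "a \<in> t" "b \<in> t" for a b
      using t(1) that by (auto simp: is_subfield_def)
    have z: "0 \<in> t" using t(1) by (auto simp: is_subfield_def)
    have add: "a + b \<in> t" if "a \<in> t" "b \<in> t" for a b
      using sub[OF that(1) sub[OF z that(2)]] by simp
    have ct: "cst c \<in> t" and xt: "xcoord \<in> t" and yt: "y \<in> t" for c using t(2) by auto
    have cxt: "cx p \<in> t" for p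
    proof -
      have "eval_hom cst xcoord p \<in> t"
        by (induction p) (auto simp: eval_hom_def[of _ _ 0] cst.eval_hom_pCons intro!: add mult ct xt z)
      then show ?thesis by (simp add: eval_cst_xcoord)
    qed
    have "E P \<in> t" for P
      by (induction P) (auto simp: eval_hom_def[of _ _ 0] cx.eval_hom_pCons intro!: add mult cxt yt z)
    then show ?thesis by (auto simp: Kxy_def divide_inverse intro!: mult inv cxt)
  qed
  moreover have "xcoord \<in> Kxy" by (simp add: xcoord_eq_cx)
  ultimately show ?thesis
    unfolding curve_field_def by (intro antisym hull_minimal) (auto simp: is_subfield_Kxy hull_def)
qed

lemma lift_nonzero:
  fixes \<phi> :: "'k poly \<Rightarrow> 'b::field"
  assumes "ring_map \<phi>" "\<And>p. \<phi> p = 0 \<Longrightarrow> p = 0" "Y ^ n = \<phi> f" "h \<in> Kxy" "h \<noteq> 0"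
  shows "lift \<phi> Y h \<noteq> 0"
proof -
  interpret ring_map \<phi> by fact
  have "lift \<phi> Y h * lift \<phi> Y (inverse h) = lift \<phi> Y (h * inverse h)"
    by (rule lift_mult[symmetric]) (use assms in auto)
  also have "h * inverse h = cx 1" using assms(5) by simp
  also have "lift \<phi> Y (cx 1) = \<phi> 1" by (rule lift_cx) (use assms in auto)
  finally show ?thesis by auto
qed

end

section \<open>Places and weak approximation\<close>

locale const_field =
  fixes F :: "'k::field cover set"
  assumes subfield: "is_subfield F" and cst_mem: "cst c \<in> F"
begin

lemma F_0 [simp]: "0 \<in> F" and F_1 [simp]: "1 \<in> F"
  and F_diff [simp]: "a \<in> F \<Longrightarrow> b \<in> F \<Longrightarrow> a - b \<in> F"
  and F_mult [simp]: "a \<in> F \<Longrightarrow> b \<in> F \<Longrightarrow> a * b \<in> F"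
  and F_inverse [simp]: "a \<in> F \<Longrightarrow> inverse a \<in> F"
  using subfield by (auto simp: is_subfield_def)

lemma F_uminus [simp]: "a \<in> F \<Longrightarrow> - a \<in> F"
  using F_diff[OF F_0] by simp

lemma F_add [simp]: "a \<in> F \<Longrightarrow> b \<in> F \<Longrightarrow> a + b \<in> F"
  using F_diff[of a "- b"] by simp

lemma F_divide [simp]: "a \<in> F \<Longrightarrow> b \<in> F \<Longrightarrow> a / b \<in> F"
  by (simp add: divide_inverse)

lemma F_power [simp]: "a \<in> F \<Longrightarrow> a ^ k \<in> F"
  by (induction k) auto

lemma F_cst [simp]: "cst c \<in> F" by (rule cst_mem)

text \<open>
  Membership here replaces inequalities between valuations, which would need an exception for the
  dummy value of a valuation at \<open>0\<close>.
\<close>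

definition at_least :: "'k place \<Rightarrow> int \<Rightarrow> 'k cover set" where
  "at_least v m = {a \<in> F. a = 0 \<or> v a \<ge> m}"

context
  fixes v assumes v: "v \<in> places F"
begin

lemma val_outside: "a \<notin> F \<Longrightarrow> v a = 0" and val_0 [simp]: "v 0 = 0"
  using v by (auto simp: places_def)

lemma val_mult: "a \<in> F \<Longrightarrow> b \<in> F \<Longrightarrow> a \<noteq> 0 \<Longrightarrow> b \<noteq> 0 \<Longrightarrow> v (a * b) = v a + v b"
  using v unfolding places_def by blast

lemma val_add_ge: "a \<in> F \<Longrightarrow> b \<in> F \<Longrightarrow> a \<noteq> 0 \<Longrightarrow> b \<noteq> 0 \<Longrightarrow> a + b \<noteq> 0 \<Longrightarrow> v (a + b) \<ge> min (v a) (v b)"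
  using v unfolding places_def by blast

lemma val_cst [simp]: "v (cst c) = 0"
  using v val_0 by (cases "c = 0") (auto simp: places_def)

lemma val_surj: "\<exists>a\<in>F - {0}. v a = m"
proof -
  have "v ` (F - {0}) = UNIV" using v unfolding places_def by blast
  then show ?thesis by (metis UNIV_I imageE)
qed

lemma val_1 [simp]: "v 1 = 0"
  using val_cst[of 1] by (simp del: val_cst)

lemma val_inverse: "a \<in> F \<Longrightarrow> v (inverse a) = - v a"
  using val_mult[of a "inverse a"] by (cases "a = 0") auto

lemma val_divide: "a \<in> F \<Longrightarrow> b \<in> F \<Longrightarrow> a \<noteq> 0 \<Longrightarrow> b \<noteq> 0 \<Longrightarrow> v (a / b) = v a - v b"
  by (simp add: divide_inverse val_mult val_inverse)

lemma val_power: "a \<in> F \<Longrightarrow> a \<noteq> 0 \<Longrightarrow> v (a ^ k) = int k * v a"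
  by (induction k) (auto simp: val_mult algebra_simps)

lemma val_uminus [simp]: "v (- a) = v a"
proof (cases "a \<in> F \<and> a \<noteq> 0")
  case True
  then show ?thesis
    using val_mult[of "cst (-1)" a] by (simp add: cst.uminus) (metis val_cst cst.uminus cst.one add_0)
next
  case False
  then show ?thesis using val_outside[of a] val_outside[of "- a"] F_uminus[of "- a"]
    by (cases "- a \<in> F"; cases "a = 0") auto
qed

lemma at_least_0 [simp]: "0 \<in> at_least v m" by (simp add: at_least_def)

lemma at_least_add: "a \<in> at_least v m \<Longrightarrow> b \<in> at_least v m \<Longrightarrow> a + b \<in> at_least v m"
  using val_add_ge[of a b]
  by (cases "a = 0"; cases "b = 0"; cases "a + b = 0") (auto simp: at_least_def min_def split: if_splits)

lemma at_least_uminus: "a \<in> at_least v m \<Longrightarrow> - a \<in> at_least v m"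
  by (simp add: at_least_def)

lemma at_least_diff: "a \<in> at_least v m \<Longrightarrow> b \<in> at_least v m \<Longrightarrow> a - b \<in> at_least v m"
  using at_least_add[of a m "- b"] at_least_uminus[of b] by simp

lemma at_least_sum: "(\<And>i. i \<in> A \<Longrightarrow> g i \<in> at_least v m) \<Longrightarrow> (\<Sum>i\<in>A. g i) \<in> at_least v m"
  by (induction A rule: infinite_finite_induct) (auto intro: at_least_add)

lemma at_least_mult: "a \<in> at_least v m \<Longrightarrow> b \<in> at_least v k \<Longrightarrow> a * b \<in> at_least v (m + k)"
  by (cases "a = 0"; cases "b = 0") (auto simp: at_least_def val_mult)

lemma at_least_mono: "a \<in> at_least v m \<Longrightarrow> k \<le> m \<Longrightarrow> a \<in> at_least v k"
  by (auto simp: at_least_def)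

lemma at_least_cst [simp]: "cst c \<in> at_least v 0" by (simp add: at_least_def)

lemma at_least_scale: "a \<in> at_least v m \<Longrightarrow> cst c * a \<in> at_least v m"
  using at_least_mult[OF at_least_cst, of a m c] by simp

lemma val_add_eq:
  assumes "a \<in> F" "b \<in> F" "a \<noteq> 0" "b = 0 \<or> v a < v b"
  shows "v (a + b) = v a" "a + b \<noteq> 0"
proof -
  have "v (a + b) = v a \<and> a + b \<noteq> 0"
  proof (cases "b = 0")
    case False
    with assms have less: "v a < v b" by auto
    have nz: "a + b \<noteq> 0" using less val_uminus[of a] by (auto simp: add_eq_0_iff)
    have "v a \<ge> min (v (a + b)) (v b)"
      using val_add_ge[of "a + b" "- b"] assms nz False by simp
    moreover have "v (a + b) \<ge> min (v a) (v b)"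
      using val_add_ge[of a b] assms nz False by simp
    ultimately show ?thesis using less nz by auto
  qed (use assms in auto)
  then show "v (a + b) = v a" "a + b \<noteq> 0" by auto
qed

end

text \<open>
  A discrete valuation ring is a maximal subring of its field, and it determines the normalised
  valuation.
\<close>

lemma place_le_imp_eq:
  assumes v: "v \<in> places F" and w: "w \<in> places F"
    and le: "\<And>a. a \<in> F \<Longrightarrow> a \<noteq> 0 \<Longrightarrow> v a \<ge> 0 \<Longrightarrow> w a \<ge> 0"
  shows "v = w"
proof -
  obtain t where t: "t \<in> F" "t \<noteq> 0" "v t = 1" using val_surj[OF v, of 1] by auto
  have unit: "w a = 0" if "a \<in> F" "a \<noteq> 0" "v a = 0" for a
    using le[OF that(1,2)] le[of "inverse a"] that val_inverse[OF v, of a] val_inverse[OF w, of a] by auto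
  have pos: "w t \<ge> 0" using le t by auto
  have nat: "w a = v a * w t" if "a \<in> F" "a \<noteq> 0" "v a \<ge> 0" for a
  proof -
    define k where "k = nat (v a)"
    have "v (a / t ^ k) = 0"
      using that t by (simp add: val_divide[OF v] val_power[OF v] k_def)
    then have "w (a / t ^ k) = 0" using that t by (intro unit) auto
    then show ?thesis using that t by (simp add: val_divide[OF w] val_power[OF w] k_def)
  qed
  have all: "w a = v a * w t" if "a \<in> F" "a \<noteq> 0" for a
    using nat[of a] nat[of "inverse a"] that val_inverse[OF v, of a] val_inverse[OF w, of a]
    by (cases "v a \<ge> 0") auto
  obtain s where "s \<in> F" "s \<noteq> 0" "w s = 1" using val_surj[OF w, of 1] by auto
  with all[of s] have "w t dvd 1" by (metis dvd_triv_right)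
  with pos have "w t = 1" by simp
  show "v = w"
  proof
    fix a show "v a = w a"
      using all[of a] \<open>w t = 1\<close> val_outside[OF v, of a] val_outside[OF w, of a] val_0[OF v] val_0[OF w]
      by (cases "a \<in> F"; cases "a = 0") auto
  qed
qed

lemma separate_places:
  assumes v: "v \<in> places F" and w: "w \<in> places F" and ne: "v \<noteq> w"
  shows "\<exists>a\<in>F - {0}. v a > 0 \<and> w a < 0"
proof -
  obtain a where a: "a \<in> F" "a \<noteq> 0" "v a \<ge> 0" "w a < 0"
    using place_le_imp_eq[OF v w] ne by force
  obtain b where b: "b \<in> F" "b \<noteq> 0" "w b \<ge> 0" "v b < 0"
    using place_le_imp_eq[OF w v] ne by force
  show ?thesis using a b
    by (intro bexI[of _ "a / b"]) (auto simp: val_divide[OF v] val_divide[OF w])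
qed

text \<open>
  In the induction step let \<open>a\<close> be negative on \<open>S\<close> and \<open>b\<close> negative at the new place \<open>w\<close>.  Then \<open>a + b ^ k\<close>
  works for large \<open>k\<close>: where \<open>b\<close> is negative the power dominates, and elsewhere \<open>a\<close> does.
\<close>

lemma separate_from_finite:
  assumes "finite S" "S \<subseteq> places F" "v \<in> places F" "v \<notin> S"
  shows "\<exists>a\<in>F - {0}. v a > 0 \<and> (\<forall>w\<in>S. w a < 0)"
  using assms
proof (induction S)
  case empty
  then show ?case using val_surj[of v 1] by force
next
  case (insert w S)
  then have v: "v \<in> places F" and w: "w \<in> places F" by auto
  obtain a where a: "a \<in> F" "a \<noteq> 0" "v a > 0" "\<forall>w\<in>S. w a < 0" using insert by auto
  obtain b where b: "b \<in> F" "b \<noteq> 0" "v b > 0" "w b < 0"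
    using separate_places[OF v w] insert by auto
  \<comment> \<open>A negative \<open>s b\<close>, multiplied by \<open>k\<close>, falls below \<open>s a\<close>.\<close>
  define k where "k = Suc (\<Sum>s\<in>insert w S. nat \<bar>s a\<bar>)"
  have k: "int k > \<bar>s a\<bar>" if "s \<in> insert w S" for s
  proof -
    have "nat \<bar>s a\<bar> \<le> (\<Sum>s\<in>insert w S. nat \<bar>s a\<bar>)"
      by (rule member_le_sum) (use that insert in auto)
    then show ?thesis unfolding k_def by linarith
  qed
  have neg: "s (a + b ^ k) < 0 \<and> a + b ^ k \<noteq> 0" if s: "s \<in> insert w S" for s
  proof -
    have sp: "s \<in> places F" using s insert by auto
    show ?thesis
    proof (cases "s b < 0")
      case True
      have "s (b ^ k) < s a"
        using k[OF s] True mult_left_mono[of "s b" "-1" "int k"] b by (simp add: val_power[OF sp])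
      then have "s (b ^ k + a) = s (b ^ k)" "b ^ k + a \<noteq> 0"
        using val_add_eq[OF sp, of "b ^ k" a] a b by auto
      moreover have "k > 0" by (simp add: k_def)
      then have "s (b ^ k) < 0" using True b by (simp add: val_power[OF sp] mult_pos_neg)
      ultimately show ?thesis by (simp add: add.commute)
    next
      case False
      then have "s \<in> S" using s b by auto
      then have "s a < 0" using a by auto
      moreover have "s (b ^ k) \<ge> 0" using False b by (simp add: val_power[OF sp])
      ultimately show ?thesis
        using val_add_eq[OF sp, of a "b ^ k"] a b by auto
    qed
  qed
  have nz: "a + b ^ k \<noteq> 0" using neg by auto
  have "k > 0" by (simp add: k_def)
  then have "v (b ^ k) > 0" using b by (simp add: val_power[OF v])
  with a b val_add_ge[OF v, of a "b ^ k"] nz have "v (a + b ^ k) > 0" by auto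
  then show ?case using a b nz neg by (intro bexI[of _ "a + b ^ k"]) auto
qed

text \<open>
  If \<open>a\<close> is positive at \<open>v\<close> and negative at the other places, \<open>1 / (1 + a ^ k)\<close> is close to \<open>1\<close> at \<open>v\<close> and
  close to \<open>0\<close> at the others.
\<close>

lemma approx_unit:
  assumes S: "finite S" "S \<subseteq> places F" "v \<in> S"
  shows "\<exists>u\<in>F - {0}. v u = 0 \<and> (\<forall>w\<in>S - {v}. w u \<ge> int N)"
proof -
  have v: "v \<in> places F" using S by auto
  obtain a where a: "a \<in> F" "a \<noteq> 0" "v a > 0" "\<forall>w\<in>S - {v}. w a < 0"
    using separate_from_finite[of "S - {v}" v] S by auto
  have "v (a ^ Suc N) > 0" using a val_power[OF v, of a "Suc N"] by (simp del: power_Suc)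
  then have *: "1 + a ^ Suc N \<noteq> 0" "v (1 + a ^ Suc N) = 0"
    using val_add_eq[OF v, of 1 "a ^ Suc N"] a v by auto
  have "w (inverse (1 + a ^ Suc N)) \<ge> int N" if "w \<in> S - {v}" for w
  proof -
    have w: "w \<in> places F" using that S by auto
    have "w a < 0" using a(4) that by blast
    then have "w a \<le> -1" by simp
    then have "int (Suc N) * w a \<le> int (Suc N) * (-1)" by (intro mult_left_mono) auto
    then have le: "w (a ^ Suc N) \<le> - int (Suc N)" using a val_power[OF w, of a "Suc N"] by (simp del: power_Suc)
    then have "w (a ^ Suc N + 1) = w (a ^ Suc N)"
      using val_add_eq[OF w, of "a ^ Suc N" 1] a w by auto
    then show ?thesis using le a val_inverse[OF w, of "1 + a ^ Suc N"] by (simp add: add.commute)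
  qed
  with * a v show ?thesis
    by (intro bexI[of _ "inverse (1 + a ^ Suc N)"]) (auto simp: val_inverse)
qed

definition independent_mod :: "'k place \<Rightarrow> 'k cover set \<Rightarrow> bool" where
  "independent_mod v B \<longleftrightarrow> finite B \<and> B \<subseteq> valuation_ring F v \<and>
     (\<forall>u. (\<Sum>b\<in>B. cst (u b) * b) \<in> valuation_ideal F v \<longrightarrow> (\<forall>b\<in>B. u b = 0))"

lemma place_degree_altdef: "place_degree F v = (GREATEST m. \<exists>B. independent_mod v B \<and> card B = m)"
  unfolding place_degree_def independent_mod_def by (rule arg_cong[of _ _ Greatest]) (auto simp: fun_eq_iff)

lemma valuation_ring_eq: "valuation_ring F v = at_least v 0"
  and valuation_ideal_eq: "valuation_ideal F v = at_least v 1"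
  by (auto simp: valuation_ring_def valuation_ideal_def at_least_def)

lemma independent_mod_1: assumes v: "v \<in> places F" shows "independent_mod v {1}"
proof -
  have "c = 0" if "cst c \<in> at_least v 1" for c
    using that v by (auto simp: at_least_def)
  then show ?thesis
    using v by (auto simp: independent_mod_def valuation_ring_eq valuation_ideal_eq) (auto simp: at_least_def)
qed

end

section \<open>A function of x has few zeros\<close>

definition cspan :: "'k::field cover set \<Rightarrow> 'k cover set" where
  "cspan B = {\<Sum>b\<in>B. cst (c b) * b | c. True}"

definition is_csubspace :: "'k::field cover set \<Rightarrow> bool" where
  "is_csubspace W \<longleftrightarrow> 0 \<in> W \<and> (\<forall>a\<in>W. \<forall>b\<in>W. a + b \<in> W) \<and> (\<forall>c. \<forall>a\<in>W. cst c * a \<in> W)"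

lemma is_csubspaceD:
  assumes "is_csubspace W"
  shows "0 \<in> W" "a \<in> W \<Longrightarrow> b \<in> W \<Longrightarrow> a + b \<in> W" "a \<in> W \<Longrightarrow> cst c * a \<in> W"
    "a \<in> W \<Longrightarrow> - a \<in> W" "a \<in> W \<Longrightarrow> b \<in> W \<Longrightarrow> a - b \<in> W"
proof -
  show *: "0 \<in> W" "\<And>a b. a \<in> W \<Longrightarrow> b \<in> W \<Longrightarrow> a + b \<in> W" "\<And>a c. a \<in> W \<Longrightarrow> cst c * a \<in> W"
    using assms by (auto simp: is_csubspace_def)
  show m: "- a \<in> W" if "a \<in> W" for a using *(3)[OF that, of "-1"] by (simp add: cst.uminus)
  show "a \<in> W \<Longrightarrow> b \<in> W \<Longrightarrow> a - b \<in> W" using *(2)[OF _ m] by fastforce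
qed

lemma is_csubspace_cspan: "is_csubspace (cspan B)"
  unfolding is_csubspace_def cspan_def
proof (intro conjI ballI allI)
  show "0 \<in> {\<Sum>b\<in>B. cst (c b) * b |c. True}" by (auto intro!: exI[of _ "\<lambda>_. 0"])
next
  fix a b assume "a \<in> {\<Sum>b\<in>B. cst (c b) * b |c. True}" "b \<in> {\<Sum>b\<in>B. cst (c b) * b |c. True}"
  then obtain c d where "a = (\<Sum>b\<in>B. cst (c b) * b)" "b = (\<Sum>b\<in>B. cst (d b) * b)" by auto
  then show "a + b \<in> {\<Sum>b\<in>B. cst (c b) * b |c. True}"
    by (auto intro!: exI[of _ "\<lambda>b. c b + d b"] simp: cst.add algebra_simps sum.distrib)
next
  fix k a assume "a \<in> {\<Sum>b\<in>B. cst (c b) * b |c. True}"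
  then obtain c where "a = (\<Sum>b\<in>B. cst (c b) * b)" by auto
  then show "cst k * a \<in> {\<Sum>b\<in>B. cst (c b) * b |c. True}"
    by (auto intro!: exI[of _ "\<lambda>b. k * c b"] simp: cst.mult algebra_simps sum_distrib_left)
qed

lemma card_cspan:
  fixes B :: "'k::{field,finite} cover set"
  assumes "finite B" and ind: "\<And>u. (\<Sum>b\<in>B. cst (u b) * b) = 0 \<Longrightarrow> \<forall>b\<in>B. u b = 0"
  shows "card (cspan B) = CARD('k) ^ card B" "finite (cspan B)"
proof -
  have "cspan B = (\<lambda>c. \<Sum>b\<in>B. cst (c b) * b) ` (B \<rightarrow>\<^sub>E (UNIV :: 'k set))"
  proof (intro equalityI subsetI)
    fix a assume "a \<in> cspan B"
    then obtain c where "a = (\<Sum>b\<in>B. cst (c b) * b)" by (auto simp: cspan_def)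
    then have "a = (\<Sum>b\<in>B. cst (restrict c B b) * b)" by simp
    then show "a \<in> (\<lambda>c. \<Sum>b\<in>B. cst (c b) * b) ` (B \<rightarrow>\<^sub>E (UNIV :: 'k set))"
      by (intro image_eqI[of _ _ "restrict c B"]) auto
  qed (auto simp: cspan_def)
  moreover have "inj_on (\<lambda>c. \<Sum>b\<in>B. cst (c b) * b) (B \<rightarrow>\<^sub>E (UNIV :: 'k set))"
  proof (rule inj_onI)
    fix c d assume cd: "c \<in> B \<rightarrow>\<^sub>E (UNIV :: 'k set)" "d \<in> B \<rightarrow>\<^sub>E (UNIV :: 'k set)"
      and "(\<Sum>b\<in>B. cst (c b) * b) = (\<Sum>b\<in>B. cst (d b) * b)"
    then have "(\<Sum>b\<in>B. cst (c b - d b) * b) = 0"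
      by (simp add: cst.diff left_diff_distrib sum_subtractf)
    then have "\<forall>b\<in>B. c b = d b" using ind[of "\<lambda>b. c b - d b"] by auto
    with cd show "c = d" by (metis PiE_ext)
  qed
  ultimately show "card (cspan B) = CARD('k) ^ card B" "finite (cspan B)"
    using assms(1) by (simp_all add: card_image card_PiE finite_PiE)
qed

context const_field
begin

lemma cspan_subset: "is_csubspace W \<Longrightarrow> B \<subseteq> W \<Longrightarrow> cspan B \<subseteq> W"
proof -
  assume W: "is_csubspace W" and B: "B \<subseteq> W"
  have "(\<Sum>b\<in>B'. cst (c b) * b) \<in> W" if "B' \<subseteq> W" for c B'
    using that by (induction B' rule: infinite_finite_induct) (use is_csubspaceD[OF W] in auto)
  then show "cspan B \<subseteq> W" using B by (auto simp: cspan_def)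
qed

lemma is_csubspace_at_least: "v \<in> places F \<Longrightarrow> is_csubspace (at_least v m)"
  by (auto simp: is_csubspace_def intro: at_least_add at_least_scale)

end

lemma sum_decrement:
  fixes N g :: "'a \<Rightarrow> nat"
  assumes "finite S" "v \<in> S" "N v > 0"
  shows "(\<Sum>w\<in>S. N w * g w) = (\<Sum>w\<in>S. (N(v := N v - 1)) w * g w) + g v"
proof -
  have "(\<Sum>w\<in>S - {v}. N w * g w) = (\<Sum>w\<in>S - {v}. (N(v := N v - 1)) w * g w)"
    by (rule sum.cong) auto
  moreover have "N v * g v = (N v - 1) * g v + g v" using assms(3) by (cases "N v") auto
  ultimately show ?thesis using assms(1,2) by (simp add: sum.remove[of S v])
qed

locale finite_const_field = const_field F
  for F :: "'k::{field,finite} cover set"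
begin

definition separating :: "'k place set \<Rightarrow> ('k place \<Rightarrow> nat) \<Rightarrow> nat \<Rightarrow> 'k cover set \<Rightarrow> bool" where
  "separating S N T W \<longleftrightarrow> finite W \<and> W \<subseteq> F \<and> is_csubspace W \<and> card W = CARD('k) ^ T
    \<and> (\<forall>w\<in>W. \<forall>v\<in>S. w \<in> at_least v 0)
    \<and> (\<forall>w\<in>W. (\<forall>v\<in>S. w \<in> at_least v (int (N v))) \<longrightarrow> w = 0)"

lemma separatingD:
  assumes "separating S N T W"
  shows "finite W" "W \<subseteq> F" "is_csubspace W" "card W = CARD('k) ^ T"
    "\<And>w v. w \<in> W \<Longrightarrow> v \<in> S \<Longrightarrow> w \<in> at_least v 0"
    "\<And>w. w \<in> W \<Longrightarrow> (\<And>v. v \<in> S \<Longrightarrow> w \<in> at_least v (int (N v))) \<Longrightarrow> w = 0"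
  using assms unfolding separating_def by simp_all

text \<open>
  A space of representatives for the product of the local rings at the places of \<open>S\<close>, truncated at the
  orders \<open>N v\<close> (all of the product if \<open>m v\<close> is the residue degree).  One step raises \<open>N v\<close> by one: it adds
  multiples of a residue basis \<open>B\<close> at \<open>v\<close> by an element \<open>r\<close> of the right order at \<open>v\<close> that is very small at
  the other places.
\<close>

lemma separating_space:
  fixes N m :: "'k place \<Rightarrow> nat"
  assumes S: "finite S" "S \<subseteq> places F"
    and m: "\<And>v. v \<in> S \<Longrightarrow> \<exists>B. independent_mod v B \<and> card B = m v"
  shows "\<exists>W. separating S N (\<Sum>v\<in>S. N v * m v) W"
proof (induction "\<Sum>v\<in>S. N v" arbitrary: N)
  case 0
  then have "\<And>v. v \<in> S \<Longrightarrow> N v = 0" using S by auto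
  then show ?case by (intro exI[of _ "{0}"]) (auto simp: separating_def is_csubspace_def at_least_def)
next
  case (Suc k)
  obtain v where v: "v \<in> S" "N v > 0"
    using Suc.hyps(2) by (metis gr0I sum.neutral nat.distinct(1))
  have vp: "v \<in> places F" using v S by auto
  define M where "M = N(v := N v - 1)"
  have split: "(\<Sum>v\<in>S. N v * g v) = (\<Sum>v\<in>S. M v * g v) + g v" for g :: "'k place \<Rightarrow> nat"
    unfolding M_def by (rule sum_decrement) (use S v in auto)
  have "k = (\<Sum>v\<in>S. M v)" using split[of "\<lambda>_. 1"] Suc.hyps(2) by simp
  from Suc.hyps(1)[OF this] obtain W where sepW: "separating S M (\<Sum>v\<in>S. M v * m v) W" by blast
  note W = separatingD(1-4)[OF sepW] and W0 = separatingD(5)[OF sepW] and W1 = separatingD(6)[OF sepW]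
  obtain B where B: "independent_mod v B" "card B = m v" using m v by blast
  have Bf: "finite B" "B \<subseteq> at_least v 0" and
    Bi: "\<And>u. (\<Sum>b\<in>B. cst (u b) * b) \<in> at_least v 1 \<Longrightarrow> (\<forall>b\<in>B. u b = 0)"
    using B(1) by (auto simp: independent_mod_def valuation_ring_eq valuation_ideal_eq)
  have span0: "cspan B \<subseteq> at_least v 0"
    by (rule cspan_subset[OF is_csubspace_at_least[OF vp] Bf(2)])
  have spanF: "b \<in> F" if "b \<in> cspan B" for b using span0 that by (auto simp: at_least_def)
  have span1: "b = 0" if "b \<in> cspan B" "b \<in> at_least v 1" for b
    using that Bi by (fastforce simp: cspan_def)
  have ind: "\<forall>b\<in>B. u b = 0" if "(\<Sum>b\<in>B. cst (u b) * b) = 0" for u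
    using Bi[of u] that by (simp add: at_least_def)
  have cardB: "card (cspan B) = CARD('k) ^ m v" and finB: "finite (cspan B)"
    using card_cspan[OF Bf(1) ind] B(2) by auto
  note spanB = is_csubspaceD[OF is_csubspace_cspan[of B]]
  note spanW = is_csubspaceD[OF W(3)]
  obtain t where t: "t \<in> F" "t \<noteq> 0" "v t = int (M v)" using val_surj[OF vp] by blast
  \<comment> \<open>Large enough to outweigh \<open>t\<close> and every element of the span of \<open>B\<close> at the other places.\<close>
  define K where "K = (\<Sum>w\<in>S. nat \<bar>w t\<bar> + M w + (\<Sum>b\<in>cspan B. nat \<bar>w b\<bar>))"
  have K: "int K \<ge> int (M w) + \<bar>w t\<bar> + \<bar>w b\<bar>" if "w \<in> S" "b \<in> cspan B" for w b
  proof -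
    have "nat \<bar>w t\<bar> + M w + (\<Sum>b\<in>cspan B. nat \<bar>w b\<bar>) \<le> K"
      unfolding K_def by (rule member_le_sum) (use that S in auto)
    moreover have "nat \<bar>w b\<bar> \<le> (\<Sum>b\<in>cspan B. nat \<bar>w b\<bar>)"
      by (rule member_le_sum) (use that finB in auto)
    ultimately show ?thesis by linarith
  qed
  obtain u where u: "u \<in> F" "u \<noteq> 0" "v u = 0" "\<And>w. w \<in> S - {v} \<Longrightarrow> w u \<ge> int K"
    using approx_unit[OF S v(1), of K] by blast
  define r where "r = t * u"
  have r: "r \<in> F" "r \<noteq> 0" "v r = int (M v)" using t u by (auto simp: r_def val_mult[OF vp])
  have C1: "r * b \<in> at_least w (int (M w))" if b: "b \<in> cspan B" and w: "w \<in> S" for b w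
  proof (cases "b = 0 \<or> w = v")
    case True
    then show ?thesis
    proof
      assume "w = v"
      moreover have "r * b \<in> at_least v (int (M v) + 0)"
        by (rule at_least_mult[OF vp]) (use r b span0 in \<open>auto simp: at_least_def\<close>)
      ultimately show ?thesis by simp
    qed (use w S in \<open>auto simp: at_least_def\<close>)
  next
    case False
    have wp: "w \<in> places F" using w S by auto
    have "w (r * b) = w t + w u + w b"
      using t u r False spanF[OF b] by (simp add: r_def val_mult[OF wp])
    moreover have "w u \<ge> int K" using u(4) w False by auto
    ultimately have "w (r * b) \<ge> int (M w)" using K[OF w b] by linarith
    then show ?thesis using r spanF[OF b] by (simp add: at_least_def)
  qed
  have key: "w = 0 \<and> b = 0" if wb: "w \<in> W" "b \<in> cspan B"
    and small: "\<And>s. s \<in> S \<Longrightarrow> w + r * b \<in> at_least s (int (N s))" for w b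
  proof -
    have "w \<in> at_least s (int (M s))" if s: "s \<in> S" for s
    proof -
      have sp: "s \<in> places F" using s S by auto
      have "w + r * b \<in> at_least s (int (M s))"
        by (rule at_least_mono[OF sp small[OF s]]) (auto simp: M_def)
      from at_least_diff[OF sp this C1[OF wb(2) s]] show ?thesis by simp
    qed
    then have w: "w = 0" using W1[OF wb(1)] by blast
    have "r * b \<in> at_least v (int (N v))" using small[OF v(1)] w by simp
    then have "b \<in> at_least v 1"
      using r v(2) spanF[OF wb(2)] by (cases "b = 0") (auto simp: at_least_def val_mult[OF vp] M_def)
    with w span1[OF wb(2)] show ?thesis by simp
  qed
  define W' where "W' = (\<lambda>(w, b). w + r * b) ` (W \<times> cspan B)"
  have inj: "inj_on (\<lambda>(w, b). w + r * b) (W \<times> cspan B)"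
  proof (rule inj_onI, clarify)
    fix w b w' b'
    assume *: "w \<in> W" "b \<in> cspan B" "w' \<in> W" "b' \<in> cspan B" "w + r * b = w' + r * b'"
    have "(w - w') + r * (b - b') = 0" using *(5) by (simp add: algebra_simps)
    then have "w - w' = 0 \<and> b - b' = 0"
      using * by (intro key) (auto intro: spanB spanW simp: at_least_def)
    then show "w = w' \<and> b = b'" by simp
  qed
  have "card W' = card W * card (cspan B)"
    unfolding W'_def by (simp add: card_image[OF inj] card_cartesian_product)
  also have "\<dots> = CARD('k) ^ (\<Sum>v\<in>S. N v * m v)"
    by (simp add: W(4) cardB split power_add)
  finally have card: "card W' = CARD('k) ^ (\<Sum>v\<in>S. N v * m v)" .
  have sub: "is_csubspace W'"
    unfolding is_csubspace_def
  proof (intro conjI ballI allI)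
    show "0 \<in> W'" unfolding W'_def using spanB(1) spanW(1) by force
  next
    fix a b assume "a \<in> W'" "b \<in> W'"
    then obtain w1 b1 w2 b2 where *: "a = w1 + r * b1" "b = w2 + r * b2" "w1 \<in> W" "w2 \<in> W"
       "b1 \<in> cspan B" "b2 \<in> cspan B" unfolding W'_def by auto
    have "a + b = (w1 + w2) + r * (b1 + b2)" by (simp add: * algebra_simps)
    then show "a + b \<in> W'" unfolding W'_def using * spanB(2) spanW(2) by force
  next
    fix c a assume "a \<in> W'"
    then obtain w1 b1 where *: "a = w1 + r * b1" "w1 \<in> W" "b1 \<in> cspan B" unfolding W'_def by auto
    have "cst c * a = cst c * w1 + r * (cst c * b1)" by (simp add: * algebra_simps)
    then show "cst c * a \<in> W'" unfolding W'_def using * spanB(3) spanW(3) by force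
  qed
  show ?case unfolding separating_def
  proof (intro exI[of _ W'] conjI ballI impI)
    show "finite W'" using W finB by (simp add: W'_def)
    show "W' \<subseteq> F" using W(2) r spanF by (auto simp: W'_def)
    show "is_csubspace W'" by (rule sub)
    show "card W' = CARD('k) ^ (\<Sum>v\<in>S. N v * m v)" by (rule card)
  next
    fix w s assume "w \<in> W'" "s \<in> S"
    then obtain w1 b1 where *: "w = w1 + r * b1" "w1 \<in> W" "b1 \<in> cspan B" unfolding W'_def by auto
    have sp: "s \<in> places F" using \<open>s \<in> S\<close> S by auto
    show "w \<in> at_least s 0" unfolding *(1)
      by (rule at_least_add[OF sp W0[OF *(2) \<open>s \<in> S\<close>] at_least_mono[OF sp C1[OF *(3) \<open>s \<in> S\<close>]]]) simp
  next
    fix w assume "w \<in> W'" and small: "\<forall>v\<in>S. w \<in> at_least v (int (N v))"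
    then obtain w1 b1 where *: "w = w1 + r * b1" "w1 \<in> W" "b1 \<in> cspan B" unfolding W'_def by auto
    show "w = 0" using key[OF *(2,3)] small by (auto simp: *)
  qed
qed

text \<open>
  For a separating space \<open>W\<close> of orders \<open>v z\<close>, expansions \<open>\<Sum>i<k. w i * z ^ i\<close> with digits in \<open>W\<close> are
  unique: in a vanishing expansion the lowest digit is divisible by \<open>z\<close> and hence \<open>0\<close>.  So their number
  is \<open>card W ^ k\<close>, and comparing its growth with the assumed one as \<open>k\<close> tends to infinity bounds
  \<open>card W\<close>.  The residue degrees enter through arbitrary independent sets of size \<open>m v\<close>; this way the
  same statement shows that residue degrees are finite.
\<close>

lemma zero_multiplicity_bound:
  fixes m :: "'k place \<Rightarrow> nat"
  assumes S: "finite S" "S \<subseteq> places F"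
    and m: "\<And>v. v \<in> S \<Longrightarrow> \<exists>B. independent_mod v B \<and> card B = m v"
    and z: "z \<in> F" "z \<noteq> 0" "\<And>v. v \<in> S \<Longrightarrow> v z > 0"
    and growth: "\<And>W. finite W \<Longrightarrow> W \<subseteq> F \<Longrightarrow> \<exists>C. \<forall>k.
       card ((\<lambda>w. \<Sum>i<k. w i * z ^ i) ` ({..<k} \<rightarrow>\<^sub>E W)) \<le> CARD('k) ^ (C + k * e)"
  shows "(\<Sum>v\<in>S. nat (v z) * m v) \<le> e"
proof -
  define T where "T = (\<Sum>v\<in>S. nat (v z) * m v)"
  obtain W where sepW: "separating S (\<lambda>v. nat (v z)) T W"
    using separating_space[OF S m, of "\<lambda>v. nat (v z)"] unfolding T_def by blast
  note W = separatingD(1-4)[OF sepW] and W0 = separatingD(5)[OF sepW] and W1 = separatingD(6)[OF sepW]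
  note spanW = is_csubspaceD[OF W(3)]
  have ind: "\<forall>i<k. d i = 0" if "\<And>i. i < k \<Longrightarrow> d i \<in> W" "(\<Sum>i<k. d i * z ^ i) = 0" for k and d :: "nat \<Rightarrow> 'k cover"
    using that
  proof (induction k arbitrary: d)
    case (Suc k)
    define R where "R = (\<Sum>i<k. d (Suc i) * z ^ i)"
    have eq: "d 0 + z * R = 0"
      using Suc.prems(2) unfolding sum.lessThan_Suc_shift R_def by (simp add: sum_distrib_left mult_ac)
    have "d 0 \<in> at_least v (int (nat (v z)))" if v: "v \<in> S" for v
    proof -
      have vp: "v \<in> places F" using v S by auto
      have zp: "z ^ i \<in> at_least v 0" for i
        using z(1,2) z(3)[OF v] by (simp add: at_least_def val_power[OF vp])
      have "R \<in> at_least v (0 + 0)" unfolding R_def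
        by (intro at_least_sum[OF vp] at_least_mult[OF vp] W0 zp v Suc.prems(1)) auto
      moreover have "z \<in> at_least v (v z)" using z by (simp add: at_least_def)
      ultimately have "z * R \<in> at_least v (v z + (0 + 0))" using at_least_mult[OF vp] by blast
      then have "- (z * R) \<in> at_least v (v z)" using at_least_uminus[OF vp] by simp
      moreover have "- (z * R) = d 0" using eq by (metis add.commute minus_unique add_eq_0_iff)
      ultimately show ?thesis using z(3)[OF v] by simp
    qed
    then have d0: "d 0 = 0" using W1[OF Suc.prems(1)[of 0]] by blast
    with eq z(2) have "R = 0" by simp
    then have "\<forall>i<k. d (Suc i) = 0"
      unfolding R_def by (intro Suc.IH Suc.prems(1)) auto
    with d0 show ?case by (auto simp: less_Suc_eq_0_disj)
  qed simp
  have card: "card ((\<lambda>w. \<Sum>i<k. w i * z ^ i) ` ({..<k} \<rightarrow>\<^sub>E W)) = CARD('k) ^ (T * k)" for k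
  proof -
    have "inj_on (\<lambda>w. \<Sum>i<k. w i * z ^ i) ({..<k} \<rightarrow>\<^sub>E W)"
    proof (rule inj_onI)
      fix c d assume cd: "c \<in> {..<k} \<rightarrow>\<^sub>E W" "d \<in> {..<k} \<rightarrow>\<^sub>E W" "(\<Sum>i<k. c i * z ^ i) = (\<Sum>i<k. d i * z ^ i)"
      have "\<forall>i<k. c i - d i = 0"
      proof (rule ind)
        show "c i - d i \<in> W" if "i < k" for i using cd(1,2) that by (intro spanW(5)) auto
        show "(\<Sum>i<k. (c i - d i) * z ^ i) = 0"
          by (simp only: left_diff_distrib sum_subtractf cd(3)) simp
      qed
      then show "c = d" using cd by (intro PiE_ext) auto
    qed
    then show ?thesis by (simp add: card_image card_PiE W(4) power_mult)
  qed
  have q: "CARD('k) > 1" using card_mono[of UNIV "{0, 1 :: 'k}"] by simp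
  obtain C where C: "\<And>k. card ((\<lambda>w. \<Sum>i<k. w i * z ^ i) ` ({..<k} \<rightarrow>\<^sub>E W)) \<le> CARD('k) ^ (C + k * e)"
    using growth[OF W(1,2)] by blast
  have le: "T * k \<le> C + k * e" for k using C[of k] q by (simp add: card)
  show ?thesis
  proof (rule ccontr)
    assume "\<not> ?thesis"
    then have "T \<ge> e + 1" by (simp add: T_def)
    then have "(e + 1) * (C + 1) \<le> T * (C + 1)" by (rule mult_right_mono) simp
    with le[of "C + 1"] show False by (simp add: algebra_simps)
  qed
qed

end

definition polys_below :: "nat \<Rightarrow> 'a::zero poly set" where
  "polys_below c = {p. \<forall>i\<ge>c. coeff p i = 0}"

lemma polys_belowI: "degree p < c \<Longrightarrow> p \<in> polys_below c"
  by (simp add: polys_below_def coeff_eq_0)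

lemma polys_below_iff: "p \<in> polys_below c \<longleftrightarrow> p = 0 \<or> degree p < c"
proof
  show "p \<in> polys_below c \<Longrightarrow> p = 0 \<or> degree p < c"
    by (metis (mono_tags, lifting) leading_coeff_0_iff mem_Collect_eq not_le polys_below_def)
qed (auto simp: polys_below_def coeff_eq_0)

lemma card_polys_below:
  "card (polys_below c :: 'k::{field,finite} poly set) = CARD('k) ^ c"
  "finite (polys_below c :: 'k poly set)"
proof -
  define g where "g = (\<lambda>a. \<Sum>i<c. monom (a i :: 'k) i)"
  have coeff_g: "coeff (g a) k = (if k < c then a k else 0)" for a k
    by (simp add: g_def coeff_sum if_distrib cong: if_cong)
  have "polys_below c = g ` ({..<c} \<rightarrow>\<^sub>E UNIV)"
  proof (intro equalityI subsetI)
    fix p :: "'k poly" assume "p \<in> polys_below c"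
    then have "p = g (restrict (coeff p) {..<c})"
      by (auto simp: poly_eq_iff coeff_g polys_below_def)
    then show "p \<in> g ` ({..<c} \<rightarrow>\<^sub>E UNIV)"
      by (intro image_eqI[of _ g "restrict (coeff p) {..<c}"]) auto
  next
    fix p assume "p \<in> g ` ({..<c} \<rightarrow>\<^sub>E UNIV)"
    then obtain a where "p = g a" by blast
    then show "p \<in> polys_below c" by (simp add: polys_below_def coeff_g)
  qed
  moreover have "inj_on g ({..<c} \<rightarrow>\<^sub>E UNIV)"
  proof (rule inj_onI)
    fix a b :: "nat \<Rightarrow> 'k" assume ab: "a \<in> {..<c} \<rightarrow>\<^sub>E UNIV" "b \<in> {..<c} \<rightarrow>\<^sub>E UNIV" "g a = g b"
    have "a k = b k" if "k < c" for k using arg_cong[OF ab(3), of "\<lambda>p. coeff p k"] that by (simp add: coeff_g)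
    with ab show "a = b" by (intro PiE_ext) auto
  qed
  ultimately show "card (polys_below c :: 'k poly set) = CARD('k) ^ c" "finite (polys_below c :: 'k poly set)"
    by (simp_all add: card_image card_PiE finite_PiE)
qed

locale kummer_finite = kummer_galois f n y
  for f :: "'k::{field,finite} poly" and n :: nat and y :: "'k cover"
begin

sublocale finite_const_field Kxy
  by standard (simp_all add: is_subfield_Kxy)

text \<open>
  After multiplication by a common denominator \<open>b * r ^ k\<close>, the expansions have polynomial coordinates
  in the basis \<open>y ^ j\<close>, of degree at most \<open>C0 + k * D\<close>.
\<close>

lemma expansions_growth:
  fixes p r :: "'k poly"
  assumes r: "r \<noteq> 0" and p: "degree p \<le> D" "degree r \<le> D" and W: "finite W" "W \<subseteq> Kxy"
  shows "\<exists>C. \<forall>k. card ((\<lambda>w. \<Sum>i<k. w i * (cx p / cx r) ^ i) ` ({..<k} \<rightarrow>\<^sub>E W)) \<le> CARD('k) ^ (C + k * (n * D))"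
proof -
  have "\<forall>w\<in>W. \<exists>ab. snd ab \<noteq> 0 \<and> w = (\<Sum>j<n. cx (fst ab j) * y ^ j) / cx (snd ab)"
    using Kxy_normal_form W(2) by (metis fst_conv snd_conv subsetD)
  then obtain ab where ab: "\<And>w. w \<in> W \<Longrightarrow> snd (ab w) \<noteq> 0 \<and> w = (\<Sum>j<n. cx (fst (ab w) j) * y ^ j) / cx (snd (ab w))"
    by metis
  define b where "b = (\<Prod>w\<in>W. snd (ab w))"
  have b0: "b \<noteq> 0" using ab W(1) by (simp add: b_def)
  define A where "A w j = fst (ab w) j * (\<Prod>w'\<in>W - {w}. snd (ab w'))" for w j
  have A: "w = (\<Sum>j<n. cx (A w j) * y ^ j) / cx b" if w: "w \<in> W" for w
  proof -
    define s where "s = (\<Prod>w'\<in>W - {w}. snd (ab w'))"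
    have s0: "s \<noteq> 0" using ab W(1) by (simp add: s_def)
    have "b = snd (ab w) * s" using W(1) w by (simp add: b_def s_def prod.remove[of W w])
    moreover have "(\<Sum>j<n. cx (A w j) * y ^ j) = (\<Sum>j<n. cx (fst (ab w) j) * y ^ j) * cx s"
      unfolding A_def s_def[symmetric] by (simp add: cx.mult sum_distrib_left mult_ac)
    ultimately show ?thesis using ab[OF w] s0 by (simp add: cx.mult)
  qed
  define C0 where "C0 = (\<Sum>w\<in>W. \<Sum>j<n. degree (A w j))"
  have C0: "degree (A w j) \<le> C0" if "w \<in> W" "j < n" for w j
  proof -
    have "degree (A w j) \<le> (\<Sum>j<n. degree (A w j))"
      by (rule member_le_sum) (use that in auto)
    also have "\<dots> \<le> C0" unfolding C0_def
      by (rule member_le_sum[where f = "\<lambda>w. \<Sum>j<n. degree (A w j)"]) (use that W in auto)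
    finally show ?thesis .
  qed
  have gen: "(\<Sum>j<n. cx (Z j) * y ^ j) / cx b * (cx s / cx t) = (\<Sum>j<n. cx (Z j * s) * y ^ j) / cx (b * t)" for Z s t
    by (simp only: cx.mult times_divide_times_eq sum_distrib_right) (simp add: mult_ac)
  show ?thesis
  proof (intro exI[of _ "n * (C0 + 1)"] allI)
    fix k
    define Z where "Z = {..<n} \<rightarrow>\<^sub>E (polys_below (C0 + k * D + 1) :: 'k poly set)"
    have finZ: "finite Z" by (simp add: Z_def finite_PiE card_polys_below)
    have "(\<lambda>w. \<Sum>i<k. w i * (cx p / cx r) ^ i) ` ({..<k} \<rightarrow>\<^sub>E W)
       \<subseteq> (\<lambda>a. (\<Sum>j<n. cx (a j) * y ^ j) / cx (b * r ^ k)) ` Z"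
    proof (rule image_subsetI)
      fix w assume w: "w \<in> {..<k} \<rightarrow>\<^sub>E W"
      define a where "a j = (\<Sum>i<k. A (w i) j * (p ^ i * r ^ (k - i)))" for j
      have "a j \<in> polys_below (C0 + k * D + 1)" if j: "j < n" for j
      proof (rule polys_belowI)
        have "degree (A (w i) j * (p ^ i * r ^ (k - i))) \<le> C0 + k * D" if i: "i < k" for i
        proof -
          have "degree (p ^ i) \<le> D * i" using degree_power_le[of p i] p(1) mult_right_mono[of "degree p" D i] by linarith
          moreover have "degree (r ^ (k - i)) \<le> D * (k - i)"
            using degree_power_le[of r "k - i"] p(2) mult_right_mono[of "degree r" D "k - i"] by linarith
          moreover have "D * i + D * (k - i) = k * D" using i by (simp flip: add_mult_distrib2)
          moreover have "w i \<in> W" using w i by auto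
          ultimately show ?thesis
            using degree_mult_le[of "A (w i) j" "p ^ i * r ^ (k - i)"] degree_mult_le[of "p ^ i" "r ^ (k - i)"] C0[of "w i" j] j
            by linarith
        qed
        then have "degree (a j) \<le> C0 + k * D" unfolding a_def by (intro degree_sum_le) auto
        then show "degree (a j) < C0 + k * D + 1" by simp
      qed
      then have "restrict a {..<n} \<in> Z" by (simp add: Z_def)
      moreover have "(\<Sum>i<k. w i * (cx p / cx r) ^ i) = (\<Sum>j<n. cx (restrict a {..<n} j) * y ^ j) / cx (b * r ^ k)"
      proof -
        have "w i * (cx p / cx r) ^ i = (\<Sum>j<n. cx (A (w i) j * (p ^ i * r ^ (k - i))) * y ^ j) / cx (b * r ^ k)"
          if i: "i < k" for i
        proof -
          have "w i \<in> W" using w i by auto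
          then have wi: "w i = (\<Sum>j<n. cx (A (w i) j) * y ^ j) / cx b" by (rule A)
          have "(cx p / cx r) ^ i = cx (p ^ i * r ^ (k - i)) / cx (r ^ k)"
            using r i by (simp add: cx.power cx.mult power_divide frac_eq_eq flip: power_add)
          then have "w i * (cx p / cx r) ^ i
             = (\<Sum>j<n. cx (A (w i) j) * y ^ j) / cx b * (cx (p ^ i * r ^ (k - i)) / cx (r ^ k))"
            using wi by argo
          then show ?thesis unfolding gen .
        qed
        then have "(\<Sum>i<k. w i * (cx p / cx r) ^ i)
          = (\<Sum>i<k. (\<Sum>j<n. cx (A (w i) j * (p ^ i * r ^ (k - i))) * y ^ j)) / cx (b * r ^ k)"
          by (simp add: sum_divide_distrib)
        also have "(\<Sum>i<k. (\<Sum>j<n. cx (A (w i) j * (p ^ i * r ^ (k - i))) * y ^ j)) = (\<Sum>j<n. cx (a j) * y ^ j)"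
          by (subst sum.swap) (simp only: a_def cx.sum sum_distrib_right)
        finally show ?thesis by simp
      qed
      ultimately show "(\<Sum>i<k. w i * (cx p / cx r) ^ i) \<in> (\<lambda>a. (\<Sum>j<n. cx (a j) * y ^ j) / cx (b * r ^ k)) ` Z"
        by (intro image_eqI[of _ _ "restrict a {..<n}"])
    qed
    then have "card ((\<lambda>w. \<Sum>i<k. w i * (cx p / cx r) ^ i) ` ({..<k} \<rightarrow>\<^sub>E W)) \<le> card Z"
      using card_mono[OF finite_imageI[OF finZ]] card_image_le[OF finZ] le_trans by blast
    also have "card Z = CARD('k) ^ (n * (C0 + 1) + k * (n * D))"
    proof -
      have "card Z = (CARD('k) ^ (C0 + k * D + 1)) ^ n"
        unfolding Z_def by (simp only: card_PiE[OF finite_lessThan] card_polys_below prod_constant card_lessThan)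
      also have "\<dots> = CARD('k) ^ ((C0 + k * D + 1) * n)" by (simp only: power_mult)
      also have "(C0 + k * D + 1) * n = n * (C0 + 1) + k * (n * D)" by (simp add: algebra_simps)
      finally show ?thesis .
    qed
    finally show "card ((\<lambda>w. \<Sum>i<k. w i * (cx p / cx r) ^ i) ` ({..<k} \<rightarrow>\<^sub>E W))
        \<le> CARD('k) ^ (n * (C0 + 1) + k * (n * D))" .
  qed
qed

lemma zeros_bound_independent:
  fixes m :: "'k place \<Rightarrow> nat"
  assumes "finite S" "S \<subseteq> places Kxy"
    and "\<And>v. v \<in> S \<Longrightarrow> \<exists>B. independent_mod v B \<and> card B = m v"
    and "p \<noteq> 0" "r \<noteq> 0" "\<And>v. v \<in> S \<Longrightarrow> v (cx p / cx r) > 0"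
    and "degree p \<le> D" "degree r \<le> D"
  shows "(\<Sum>v\<in>S. nat (v (cx p / cx r)) * m v) \<le> n * D"
  by (rule zero_multiplicity_bound) (use assms expansions_growth in auto)

lemma cx_at_least:
  assumes v: "v \<in> places Kxy" and x: "v xcoord \<ge> 0"
  shows "cx p \<in> at_least v 0"
proof -
  have "xcoord \<in> at_least v 0" using x by (simp add: at_least_def xcoord_eq_cx)
  have "eval_hom cst xcoord p \<in> at_least v 0"
  proof (induction p)
    case (pCons a p)
    have "xcoord * eval_hom cst xcoord p \<in> at_least v (0 + 0)"
      by (rule at_least_mult[OF v]) fact+
    then show ?case using v by (simp add: cst.eval_hom_pCons at_least_add)
  qed (simp add: eval_hom_def v)
  then show ?thesis by (simp add: eval_cst_xcoord)
qed

lemma y_at_least: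
  assumes v: "v \<in> places Kxy" and x: "v xcoord \<ge> 0"
  shows "y \<in> at_least v 0"
proof -
  have "v (y ^ n) \<ge> 0"
    using cx_at_least[OF v x, of f] f_nonzero by (simp add: y_power at_least_def)
  then show ?thesis
    using n_pos y_nonzero by (simp add: val_power[OF v] at_least_def zero_le_mult_iff)
qed

text \<open>
  A place trivial on \<open>K[x]\<close> would be nonnegative at \<open>y\<close>, hence on all of \<open>K(x, y)\<close>.
\<close>

lemma exists_vanishing_poly:
  assumes v: "v \<in> places Kxy" and x: "v xcoord \<ge> 0"
  shows "\<exists>p. p \<noteq> 0 \<and> v (cx p) > 0"
proof (rule ccontr)
  assume *: "\<not> ?thesis"
  obtain h where h: "h \<in> Kxy" "h \<noteq> 0" "v h = -1" using val_surj[OF v] by blast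
  obtain a b where b: "b \<noteq> 0" and hab: "h = (\<Sum>j<n. cx (a j) * y ^ j) / cx b"
    using Kxy_normal_form[OF h(1)] by blast
  have "(\<Sum>j<n. cx (a j) * y ^ j) \<in> at_least v 0"
  proof (rule at_least_sum[OF v])
    fix j
    have "y ^ j \<in> at_least v 0"
      using y_at_least[OF v x] y_nonzero by (auto simp: at_least_def val_power[OF v])
    then show "cx (a j) * y ^ j \<in> at_least v 0"
      using at_least_mult[OF v cx_at_least[OF v x]] by fastforce
  qed
  moreover have "v (cx b) = 0"
    using * b cx_at_least[OF v x, of b] by (force simp: at_least_def)
  moreover have "(\<Sum>j<n. cx (a j) * y ^ j) = h * cx b" using hab b by simp
  ultimately show False using h b by (auto simp: at_least_def val_mult[OF v])
qed

text \<open>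
  Every place is a zero of some nonconstant function of \<open>x\<close>; the bound on its zeros bounds the residue
  degree, so that the maximum in the definition of the degree of a place is attained.
\<close>

lemma independent_mod_bounded:
  assumes v: "v \<in> places Kxy"
  shows "\<exists>N. \<forall>B. independent_mod v B \<longrightarrow> card B \<le> N"
proof -
  obtain p r :: "'k poly" where pr: "p \<noteq> 0" "r \<noteq> 0" "v (cx p / cx r) > 0"
  proof (cases "v xcoord \<ge> 0")
    case True
    then obtain p where "p \<noteq> 0" "v (cx p) > 0" using exists_vanishing_poly[OF v] by blast
    then show thesis by (intro that[of p 1]) auto
  next
    case False
    then have "v (cx 1 / cx [:0, 1:]) > 0"
      by (simp add: val_divide[OF v] v flip: xcoord_eq_cx) (simp add: xcoord_eq_cx val_inverse[OF v] flip: inverse_eq_divide)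
    then show thesis by (intro that[of 1 "[:0, 1:]"]) auto
  qed
  have "card B \<le> n * max (degree p) (degree r)" if "independent_mod v B" for B
  proof -
    have "(\<Sum>w\<in>{v}. nat (w (cx p / cx r)) * card B) \<le> n * max (degree p) (degree r)"
      by (rule zeros_bound_independent) (use that pr v in auto)
    moreover have "nat (v (cx p / cx r)) \<ge> 1" using pr by simp
    then have "card B \<le> nat (v (cx p / cx r)) * card B" by (metis mult_1 mult_le_mono1)
    moreover have "(\<Sum>w\<in>{v}. nat (w (cx p / cx r)) * card B) = nat (v (cx p / cx r)) * card B" by simp
    ultimately show ?thesis by linarith
  qed
  then show ?thesis by blast
qed

lemma place_degree_props:
  assumes v: "v \<in> places Kxy"
  shows "\<exists>B. independent_mod v B \<and> card B = place_degree Kxy v"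
    and "independent_mod v B \<Longrightarrow> card B \<le> place_degree Kxy v"
    and "place_degree Kxy v \<ge> 1"
proof -
  obtain N where N: "\<And>B. independent_mod v B \<Longrightarrow> card B \<le> N"
    using independent_mod_bounded[OF v] by blast
  show "\<exists>B. independent_mod v B \<and> card B = place_degree Kxy v"
    unfolding place_degree_altdef
    by (rule GreatestI_nat[of "\<lambda>m. \<exists>B. independent_mod v B \<and> card B = m" 1 N])
       (use N independent_mod_1[OF v] in \<open>auto intro!: exI[of _ "{1}"]\<close>)
  show le: "card B \<le> place_degree Kxy v" if "independent_mod v B" for B
    unfolding place_degree_altdef
    by (rule Greatest_le_nat[of _ _ N]) (use N that in auto)
  show "place_degree Kxy v \<ge> 1" using le[OF independent_mod_1[OF v]] by simp
qed

lemma zeros_bound: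
  assumes "finite S" "S \<subseteq> places Kxy"
    and "p \<noteq> 0" "r \<noteq> 0" "\<And>v. v \<in> S \<Longrightarrow> v (cx p / cx r) > 0"
    and "degree p \<le> D" "degree r \<le> D"
  shows "(\<Sum>v\<in>S. nat (v (cx p / cx r)) * place_degree Kxy v) \<le> n * D"
  by (rule zeros_bound_independent) (use assms place_degree_props(1) in auto)

lemma card_zeros_le:
  assumes "p \<noteq> 0" "r \<noteq> 0" "degree p \<le> D" "degree r \<le> D"
  shows "finite {v \<in> places Kxy. v (cx p / cx r) > 0}" "card {v \<in> places Kxy. v (cx p / cx r) > 0} \<le> n * D"
proof -
  have le: "card S \<le> n * D" if S: "finite S" "S \<subseteq> {v \<in> places Kxy. v (cx p / cx r) > 0}" for S
  proof -
    have "card S = (\<Sum>v\<in>S. 1)" by simp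
    also have "\<dots> \<le> (\<Sum>v\<in>S. nat (v (cx p / cx r)) * place_degree Kxy v)"
    proof (rule sum_mono)
      fix v assume "v \<in> S"
      then have "nat (v (cx p / cx r)) \<ge> 1" "place_degree Kxy v \<ge> 1"
        using S place_degree_props(3) by auto
      then show "1 \<le> nat (v (cx p / cx r)) * place_degree Kxy v"
        using mult_le_mono[of 1 _ 1] by fastforce
    qed
    also have "\<dots> \<le> n * D" by (rule zeros_bound) (use S assms in auto)
    finally show ?thesis .
  qed
  show fin: "finite {v \<in> places Kxy. v (cx p / cx r) > 0}"
  proof (rule ccontr)
    assume "infinite {v \<in> places Kxy. v (cx p / cx r) > 0}"
    then obtain S where "finite S" "card S = n * D + 1" "S \<subseteq> {v \<in> places Kxy. v (cx p / cx r) > 0}"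
      using infinite_arbitrarily_large by blast
    with le[of S] show False by simp
  qed
  show "card {v \<in> places Kxy. v (cx p / cx r) > 0} \<le> n * D" by (rule le[OF fin]) simp
qed

end

section \<open>Existence of places\<close>

lemma fps_power_nth_cong:
  fixes a b :: "'a::comm_ring_1 fps"
  assumes "\<And>i. i \<le> k \<Longrightarrow> fps_nth a i = fps_nth b i" "i \<le> k"
  shows "fps_nth (a ^ m) i = fps_nth (b ^ m) i"
  using assms(2)
proof (induction m arbitrary: i)
  case (Suc m)
  show ?case unfolding power_Suc fps_mult_nth
    by (rule sum.cong) (use Suc assms(1) in auto)
qed simp

text \<open>
  The coefficients of the root are found one at a time: adding \<open>d * t ^ (k + 1)\<close> to \<open>h\<close> changes \<open>h ^ n\<close> first at that
  coefficient, by \<open>n * c ^ (n - 1) * d\<close>.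
\<close>

lemma fps_nth_root_exists:
  fixes g :: "'a::field fps"
  assumes n: "of_nat n \<noteq> (0::'a)" and c: "c ^ n = fps_nth g 0" "c \<noteq> 0"
  shows "\<exists>h. h ^ n = g"
proof -
  \<comment> \<open>\<open>P\<close>: correct up to degree \<open>k\<close>; \<open>Q\<close>: the next approximation keeps these coefficients.\<close>
  define P where "P k h \<longleftrightarrow> fps_nth h 0 = c \<and> (\<forall>i\<le>k. fps_nth (h ^ n) i = fps_nth g i)" for k and h :: "'a fps"
  define Q where "Q k h h' \<longleftrightarrow> (\<forall>i\<le>k. fps_nth h' i = fps_nth h i)" for k :: nat and h h' :: "'a fps"
  have "\<exists>f. \<forall>k. P k (f k) \<and> Q k (f k) (f (Suc k))"
  proof (rule dependent_nat_choice)
    show "\<exists>h. P 0 h"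
      by (rule exI[of _ "fps_const c"]) (simp add: P_def c)
  next
    fix h k assume h: "P k h"
    define d where "d = (fps_nth g (Suc k) - fps_nth (h ^ n) (Suc k)) / (of_nat n * c ^ (n - 1))"
    define h' where "h' = h + fps_const d * fps_X ^ Suc k"
    have h'i: "fps_nth h' i = fps_nth h i" if "i \<le> k" for i
      using that by (simp add: h'_def del: power_Suc)
    define S where "S = (\<Sum>p<n. h ^ (n - Suc p) * h' ^ p)"
    have S0: "fps_nth S 0 = of_nat n * c ^ (n - 1)"
    proof -
      have "fps_nth S 0 = (\<Sum>p<n. c ^ (n - Suc p) * c ^ p)"
        unfolding S_def using h h'i[of 0] by (simp add: fps_sum_nth P_def fps_power_zeroth)
      also have "\<dots> = (\<Sum>p<n. c ^ (n - 1))"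
        by (rule sum.cong) (auto simp flip: power_add)
      finally show ?thesis by simp
    qed
    have "h' ^ n - h ^ n = (h' - h) * S"
      unfolding S_def by (rule power_diff_sumr2)
    also have "h' - h = fps_const d * fps_X ^ Suc k" by (simp add: h'_def)
    finally have "h' ^ n = h ^ n + fps_const d * (fps_X ^ Suc k * S)" by (simp add: algebra_simps)
    then have "fps_nth (h' ^ n) i = fps_nth (h ^ n) i + d * (if i < Suc k then 0 else fps_nth S (i - Suc k))" for i
      by (simp add: fps_X_power_mult_nth del: power_Suc)
    note * = this
    have "fps_nth (h' ^ n) (Suc k) = fps_nth g (Suc k)"
      using n c by (simp add: * S0 d_def)
    moreover have "fps_nth (h' ^ n) i = fps_nth g i" if "i \<le> k" for i
      using h that by (simp add: * P_def)
    ultimately have "P (Suc k) h'"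
      using h h'i[of 0] by (auto simp: P_def le_Suc_eq)
    moreover have "Q k h h'" by (simp add: Q_def h'i)
    ultimately show "\<exists>h'. P (Suc k) h' \<and> Q k h h'" by blast
  qed
  then obtain f where f: "\<And>k. P k (f k)" "\<And>k. Q k (f k) (f (Suc k))" by blast
  have stable: "fps_nth (f k) i = fps_nth (f i) i" if "i \<le> k" for i k
    using that
  proof (induction k rule: dec_induct)
    case (step k)
    have "fps_nth (f (Suc k)) i = fps_nth (f k) i" using f(2)[of k] step.hyps unfolding Q_def by blast
    then show ?case using step.IH by simp
  qed simp
  define h where "h = Abs_fps (\<lambda>i. fps_nth (f i) i)"
  have "fps_nth (h ^ n) k = fps_nth g k" for k
  proof -
    have "fps_nth (h ^ n) k = fps_nth (f k ^ n) k"
    proof (rule fps_power_nth_cong[of k])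
      fix i assume "i \<le> k"
      from stable[OF this] show "fps_nth h i = fps_nth (f k) i"
        by (simp only: h_def fps_nth_Abs_fps)
    qed simp
    also have "\<dots> = fps_nth g k" using f(1)[of k] by (simp add: P_def)
    finally show ?thesis .
  qed
  then show ?thesis by (auto simp: fps_eq_iff)
qed

lemma fls_nth_root_exists:
  fixes g :: "'a::alg_closed_field fls"
  assumes "of_nat n \<noteq> (0::'a)" "g \<noteq> 0" "int n dvd fls_subdegree g"
  shows "\<exists>Y. Y ^ n = g"
proof -
  have n0: "n > 0" using assms(1) by (cases n) auto
  define b where "b = fls_base_factor_to_fps g"
  have b0: "fps_nth b 0 \<noteq> 0" using assms(2) by (simp add: b_def)
  obtain c where c: "c ^ n = fps_nth b 0" using nth_root_exists[OF n0] by blast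
  with b0 n0 have "c \<noteq> 0" by (auto simp: power_0_left)
  then obtain h where h: "h ^ n = b" using fps_nth_root_exists[OF assms(1) c] by blast
  obtain m where m: "fls_subdegree g = int n * m" using assms(3) by blast
  have "(fls_X_intpow m * fps_to_fls h) ^ n = fls_X_intpow (int n * m) * fps_to_fls b"
    by (simp only: power_mult_distrib fls_X_intpow_power h flip: fps_to_fls_power)
  also have "\<dots> = g"
    unfolding fls_X_intpow_times_conv_shift b_def m[symmetric]
    by (rule fls_conv_base_factor_to_fps_shift_subdegree[symmetric])
  finally show ?thesis by blast
qed

text \<open>
  The values of a nontrivial valuation form a subgroup of the integers; dividing by its generator, the
  least positive value, normalises the valuation.
\<close>

lemma (in const_field) place_of_valuation:
  assumes mult: "\<And>a b. a \<in> F \<Longrightarrow> b \<in> F \<Longrightarrow> a \<noteq> 0 \<Longrightarrow> b \<noteq> 0 \<Longrightarrow> w (a * b) = w a + w b"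
    and add: "\<And>a b. a \<in> F \<Longrightarrow> b \<in> F \<Longrightarrow> a \<noteq> 0 \<Longrightarrow> b \<noteq> 0 \<Longrightarrow> a + b \<noteq> 0 \<Longrightarrow> w (a + b) \<ge> min (w a) (w b)"
    and cst: "\<And>c. c \<noteq> 0 \<Longrightarrow> w (cst c) = 0"
    and nontriv: "a0 \<in> F" "a0 \<noteq> 0" "w a0 \<noteq> (0::int)"
  shows "\<exists>v\<in>places F. \<exists>d>0. \<forall>a\<in>F - {0}. w a = d * v a"
proof -
  have w1: "w 1 = 0" using cst[of 1] by simp
  have winv: "w (inverse a) = - w a" if "a \<in> F" "a \<noteq> 0" for a
    using mult[of a "inverse a"] that w1 by simp
  have wpow: "w (a ^ k) = int k * w a" if "a \<in> F" "a \<noteq> 0" for a k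
    using that by (induction k) (auto simp: w1 mult algebra_simps)
  define P where "P k \<longleftrightarrow> k > 0 \<and> (\<exists>a\<in>F - {0}. w a = int k)" for k :: nat
  have "\<exists>k. P k"
  proof (cases "w a0 > 0")
    case True
    then show ?thesis using nontriv by (auto simp: P_def intro!: exI[of _ "nat (w a0)"] bexI[of _ a0])
  next
    case False
    then show ?thesis using nontriv winv[of a0]
      by (auto simp: P_def intro!: exI[of _ "nat (- w a0)"] bexI[of _ "inverse a0"])
  qed
  then obtain k where Pk: "P k" and least: "\<And>j. P j \<Longrightarrow> k \<le> j"
    using LeastI_ex[of P] Least_le[of P] by blast
  define d where "d = int k"
  obtain t where t: "t \<in> F" "t \<noteq> 0" "w t = d" and d: "d > 0" using Pk by (auto simp: P_def d_def)
  have powi: "\<exists>s\<in>F - {0}. w s = d * m" for m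
  proof (cases "m \<ge> 0")
    case True
    then show ?thesis using t wpow[of t "nat m"] by (intro bexI[of _ "t ^ nat m"]) auto
  next
    case False
    then show ?thesis using t wpow[of t "nat (- m)"] winv[of "t ^ nat (- m)"]
      by (intro bexI[of _ "inverse (t ^ nat (- m))"]) auto
  qed
  have dvd: "d dvd w a" if a: "a \<in> F" "a \<noteq> 0" for a
  proof (rule ccontr)
    assume "\<not> d dvd w a"
    then have r: "w a mod d > 0" using d by (metis dvd_eq_mod_eq_0 le_less pos_mod_sign)
    obtain s where s: "s \<in> F - {0}" "w s = d * (- (w a div d))" using powi by blast
    have "w (a * s) = w a mod d" using mult[of a s] a s by (simp add: minus_div_mult_eq_mod [symmetric])
    then have "P (nat (w a mod d))" using a s r by (auto simp: P_def intro!: bexI[of _ "a * s"])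
    from least[OF this] r pos_mod_bound[OF d, of "w a"] show False by (simp add: d_def)
  qed
  define v where "v a = (if a \<in> F - {0} then w a div d else 0)" for a
  have wv: "w a = d * v a" if "a \<in> F - {0}" for a
    using dvd[of a] that by (simp add: v_def)
  have "v \<in> places F"
    unfolding places_def
  proof (intro CollectI conjI)
    show "\<forall>a. a \<notin> F \<or> a = 0 \<longrightarrow> v a = 0" by (simp add: v_def)
    show "v ` (F - {0}) = UNIV"
    proof (intro equalityI subsetI)
      fix m :: int
      obtain s where s: "s \<in> F - {0}" "w s = d * m" using powi by blast
      then have "v s = m" using d wv[OF s(1)] by simp
      then show "m \<in> v ` (F - {0})" using s by blast
    qed simp
    show "\<forall>a\<in>F - {0}. \<forall>b\<in>F - {0}. v (a * b) = v a + v b \<and> (a + b \<noteq> 0 \<longrightarrow> min (v a) (v b) \<le> v (a + b))"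
    proof (intro ballI conjI impI)
      fix a b assume ab: "a \<in> F - {0}" "b \<in> F - {0}"
      have "d * v (a * b) = d * (v a + v b)"
        using wv[OF ab(1)] wv[OF ab(2)] wv[of "a * b"] mult[of a b] ab by (simp add: distrib_left)
      then show "v (a * b) = v a + v b" using d by simp
      assume nz: "a + b \<noteq> 0"
      have "min (d * v a) (d * v b) \<le> d * v (a + b)"
        using wv[OF ab(1)] wv[OF ab(2)] wv[of "a + b"] add[of a b] ab nz by simp
      then show "min (v a) (v b) \<le> v (a + b)"
        using d by (auto simp: min_def mult_le_cancel_left split: if_splits)
    qed
    show "\<forall>c. c \<noteq> 0 \<longrightarrow> v (cst c) = 0"
      using cst by (simp add: v_def)
  qed
  then show ?thesis using wv d by blast
qed

lemma ring_map_comp: "ring_map f \<Longrightarrow> ring_map g \<Longrightarrow> ring_map (\<lambda>x. g (f x))"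
  by (simp add: ring_map_def)

lemma ring_map_map_poly: "ring_map f \<Longrightarrow> ring_map (map_poly f)"
  by (standard) (simp_all add: ring_map.map_poly_plus ring_map.map_poly_times map_poly_1 ring_map.one)

lemma ring_map_to_ac: "ring_map to_ac"
  by standard simp_all

lemma ring_map_fls_const: "ring_map (fls_const :: 'a::field \<Rightarrow> 'a fls)"
  by standard (simp_all add: fls_plus_const fls_const_mult_const)

text \<open>
  Over an algebraically closed field only constants are algebraic.
\<close>

lemma eval_alg_closed_nonzero:
  fixes \<phi> :: "'a::alg_closed_field \<Rightarrow> 'b::idom"
  assumes "ring_map \<phi>" "\<And>c. \<phi> c = 0 \<Longrightarrow> c = 0" "\<And>c. T \<noteq> \<phi> c" "P \<noteq> 0"
  shows "eval_hom \<phi> T P \<noteq> 0"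
  using assms(4)
proof (induction "degree P" arbitrary: P rule: less_induct)
  case less
  interpret ring_map \<phi> by fact
  interpret E: ring_map "eval_hom \<phi> T" by (rule ring_map_eval_hom)
  show ?case
  proof (cases "degree P = 0")
    case True
    then obtain c where "P = [:c:]" using degree_eq_zeroE by blast
    then show ?thesis using less assms(2) by auto
  next
    case False
    then obtain r where "poly P r = 0" using alg_closed_imp_poly_has_root by blast
    then obtain Q where Q: "P = [:-r, 1:] * Q" by (metis dvdE poly_eq_0_iff_dvd)
    then have "Q \<noteq> 0" using less by auto
    then have "degree P = Suc (degree Q)" unfolding Q by (subst degree_mult_eq) auto
    then have "eval_hom \<phi> T Q \<noteq> 0" using less \<open>Q \<noteq> 0\<close> by simp
    moreover have "eval_hom \<phi> T [:-r, 1:] = T - \<phi> r"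
      using eval_hom_pCons[of T "-r" "[:1:]"] by (simp only: eval_hom_const one uminus) simp
    ultimately show ?thesis using assms(3)[of r] by (simp add: Q E.mult del: mult_pCons_left)
  qed
qed

context kummer_galois
begin

sublocale const_field Kxy
  by standard (simp_all add: is_subfield_Kxy)

text \<open>
  The order of Laurent series is a valuation on \<open>K(x, y)\<close> once \<open>f\<close> has an \<open>n\<close>-th root among the series.
\<close>

lemma place_from_series:
  fixes \<phi> :: "'k poly \<Rightarrow> 'k alg_closure fls"
  assumes \<phi>: "ring_map \<phi>" "\<And>p. \<phi> p = 0 \<Longrightarrow> p = 0"
    and dvd: "int n dvd fls_subdegree (\<phi> f)"
    and const: "\<And>c. c \<noteq> 0 \<Longrightarrow> fls_subdegree (\<phi> [:c:]) = 0"
    and nontriv: "p0 \<noteq> 0" "fls_subdegree (\<phi> p0) \<noteq> 0"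
  shows "\<exists>v\<in>places Kxy. \<exists>d>0. \<forall>p. p \<noteq> 0 \<longrightarrow> fls_subdegree (\<phi> p) = d * v (cx p)"
proof -
  interpret ring_map \<phi> by fact
  have "of_nat n \<noteq> (0 :: 'k alg_closure)" using n_nonzero by (simp flip: to_ac_of_nat)
  moreover have "\<phi> f \<noteq> 0" using \<phi>(2) f_nonzero by blast
  ultimately obtain Y where Y: "Y ^ n = \<phi> f" using fls_nth_root_exists dvd by blast
  note lift_rules = lift_mult[OF \<phi> Y] lift_add[OF \<phi> Y] lift_nonzero[OF \<phi> Y] lift_cx[OF \<phi> Y]
  have "\<exists>v\<in>places Kxy. \<exists>d>0. \<forall>a\<in>Kxy - {0}. fls_subdegree (lift \<phi> Y a) = d * v a"
  proof (rule place_of_valuation[where ?a0.0 = "cx p0"])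
    fix a b assume ab: "a \<in> Kxy" "b \<in> Kxy" "a \<noteq> 0" "b \<noteq> 0"
    then show "fls_subdegree (lift \<phi> Y (a * b)) = fls_subdegree (lift \<phi> Y a) + fls_subdegree (lift \<phi> Y b)"
      by (simp add: lift_rules)
    assume "a + b \<noteq> 0"
    then have "lift \<phi> Y a + lift \<phi> Y b \<noteq> 0"
      using lift_rules(3)[of "a + b"] ab by (simp add: lift_rules(2))
    then show "min (fls_subdegree (lift \<phi> Y a)) (fls_subdegree (lift \<phi> Y b)) \<le> fls_subdegree (lift \<phi> Y (a + b))"
      using ab by (simp add: lift_rules(2) fls_plus_subdegree)
  qed (use const nontriv in \<open>auto simp: cst_eq_cx lift_rules(4)\<close>)
  then obtain v d where v: "v \<in> places Kxy" "d > 0"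
    "\<And>a. a \<in> Kxy - {0} \<Longrightarrow> fls_subdegree (lift \<phi> Y a) = d * v a" by blast
  have "fls_subdegree (\<phi> p) = d * v (cx p)" if "p \<noteq> 0" for p
    using v(3)[of "cx p"] that lift_rules(4)[of p] by simp
  with v(1,2) show ?thesis by blast
qed

text \<open>
  Substituting \<open>\<alpha> + t ^ n\<close> for \<open>x\<close> multiplies all orders of vanishing at \<open>\<alpha>\<close> by \<open>n\<close>, which makes the order
  of \<open>f\<close> divisible by \<open>n\<close> whether or not \<open>\<alpha>\<close> is a zero of \<open>f\<close>.
\<close>

lemma exists_place_over:
  fixes \<alpha> :: "'k alg_closure"
  shows "\<exists>v\<in>places Kxy. \<forall>p. p \<noteq> 0 \<longrightarrow> v (cx p) \<ge> 0 \<and> (v (cx p) > 0 \<longleftrightarrow> poly (map_poly to_ac p) \<alpha> = 0)"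
proof -
  define T where "T = fps_const \<alpha> + fps_X ^ n"
  define ev where "ev = eval_hom fps_const T"
  have fc: "ring_map (fps_const :: 'k alg_closure \<Rightarrow> _)" by standard simp_all
  interpret fc: ring_map "fps_const :: 'k alg_closure \<Rightarrow> _" by (rule fc)
  interpret ev: ring_map ev unfolding ev_def by (rule fc.ring_map_eval_hom)
  interpret ac: ring_map "map_poly to_ac :: 'k poly \<Rightarrow> 'k alg_closure poly"
    by (rule ring_map_map_poly[OF ring_map_to_ac])
  have ev0: "fps_nth (ev P) 0 = poly P \<alpha>" for P
    using n_pos by (induction P) (simp_all add: ev_def fc.eval_hom_pCons T_def, simp add: eval_hom_def)
  have evnz: "ev P \<noteq> 0" if "P \<noteq> 0" for P unfolding ev_def
  proof (rule eval_alg_closed_nonzero[OF fc _ _ that])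
    fix c show "T \<noteq> fps_const c"
    proof
      assume "T = fps_const c"
      then have "fps_nth T n = fps_nth (fps_const c) n" by simp
      then show False using n_pos by (simp add: T_def)
    qed
  qed simp
  define \<phi> where "\<phi> p = fps_to_fls (ev (map_poly to_ac p))" for p :: "'k poly"
  have \<phi>: "ring_map \<phi>"
    by standard (simp_all add: \<phi>_def ac.add ac.mult ev.add ev.mult fls_times_fps_to_fls)
  have sub: "fls_subdegree (\<phi> p) = int (subdegree (ev (map_poly to_ac p)))" for p
    by (simp add: \<phi>_def fls_subdegree_fls_to_fps)
  have ac0: "map_poly to_ac p \<noteq> 0" if "p \<noteq> 0" for p :: "'k poly"
    using that by (simp add: map_poly_eq_0_iff)
  have pos: "subdegree (ev P) > 0 \<longleftrightarrow> poly P \<alpha> = 0" if "P \<noteq> 0" for P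
    using evnz[OF that] ev0[of P] by (metis gr0I subdegree_eq_0 subdegree_eq_0_iff neq0_conv)
  obtain q where q: "q \<noteq> 0" "poly (map_poly to_ac q) \<alpha> = 0" using alg_closure_algebraic[of \<alpha>] by blast
  have dvd: "int n dvd fls_subdegree (\<phi> f)"
  proof -
    define P where "P = map_poly to_ac f"
    have P0: "P \<noteq> 0" using ac0[OF f_nonzero] by (simp add: P_def)
    obtain g where g: "P = [:-\<alpha>, 1:] ^ order \<alpha> P * g" "\<not> [:-\<alpha>, 1:] dvd g"
      using order_decomp[OF P0] by blast
    have "poly g \<alpha> \<noteq> 0" using g(2) poly_eq_0_iff_dvd by blast
    then have ug: "subdegree (ev g) = 0" "ev g \<noteq> 0" using ev0[of g] by auto
    have "ev [:-\<alpha>, 1:] = fps_X ^ n"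
      unfolding ev_def using fc.eval_hom_pCons[of T "-\<alpha>" "[:1:]"]
      by (simp only: fc.eval_hom_const fc.one fc.uminus) (simp add: T_def)
    then have "ev P = (fps_X ^ n) ^ order \<alpha> P * ev g" by (subst g(1)) (simp only: ev.mult ev.power)
    then have "subdegree (ev P) = n * order \<alpha> P" using ug by (simp flip: power_mult)
    then show ?thesis by (simp add: sub P_def)
  qed
  have "\<exists>v\<in>places Kxy. \<exists>d>0. \<forall>p. p \<noteq> 0 \<longrightarrow> fls_subdegree (\<phi> p) = d * v (cx p)"
  proof (rule place_from_series[OF \<phi> _ dvd])
    show "\<phi> p = 0 \<Longrightarrow> p = 0" for p using evnz ac0 by (auto simp: \<phi>_def)
    show "c \<noteq> 0 \<Longrightarrow> fls_subdegree (\<phi> [:c:]) = 0" for c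
      using pos[of "[:to_ac c:]"] by (simp add: sub map_poly_pCons)
    show "q \<noteq> 0" by fact
    show "fls_subdegree (\<phi> q) \<noteq> 0" using pos[OF ac0[OF q(1)]] q(2) by (simp add: sub)
  qed
  then obtain v d where v: "v \<in> places Kxy" "d > 0" "\<And>p. p \<noteq> 0 \<Longrightarrow> fls_subdegree (\<phi> p) = d * v (cx p)" by blast
  have "v (cx p) \<ge> 0 \<and> (v (cx p) > 0 \<longleftrightarrow> poly (map_poly to_ac p) \<alpha> = 0)" if p: "p \<noteq> 0" for p
  proof -
    have eq: "d * v (cx p) = int (subdegree (ev (map_poly to_ac p)))" using v(3)[OF p] sub by simp
    then have "v (cx p) \<ge> 0" using v(2) by (metis of_nat_0_le_iff zero_le_mult_iff not_le)
    moreover have "v (cx p) > 0 \<longleftrightarrow> subdegree (ev (map_poly to_ac p)) > 0"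
      using eq v(2) by (metis of_nat_0_less_iff zero_less_mult_iff not_less_iff_gr_or_eq)
    ultimately show ?thesis using pos[OF ac0[OF p]] by simp
  qed
  with v(1) show ?thesis by blast
qed

text \<open>
  Substituting \<open>1 / t\<close> for \<open>x\<close> gives a polynomial the order minus its degree, so the order of \<open>f\<close> is divisible
  by \<open>n\<close>.
\<close>

lemma exists_infinite_place:
  assumes n_dvd: "n dvd degree f"
  shows "\<exists>v\<in>places Kxy. v xcoord < 0"
proof -
  define \<phi>0 where "\<phi>0 = (\<lambda>c::'k. fls_const (to_ac c))"
  have r0: "ring_map \<phi>0" unfolding \<phi>0_def by (rule ring_map_comp[OF ring_map_to_ac ring_map_fls_const])
  interpret r0: ring_map \<phi>0 by (rule r0)
  define \<phi> where "\<phi> = eval_hom \<phi>0 fls_X_inv"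
  have deg: "\<phi> p \<noteq> 0 \<and> fls_subdegree (\<phi> p) = - int (degree p)" if "p \<noteq> 0" for p
    using that
  proof (induction p)
    case (pCons a p)
    show ?case
    proof (cases "p = 0")
      case True
      with pCons show ?thesis by (simp add: \<phi>_def) (simp add: \<phi>0_def)
    next
      case False
      with pCons have IH: "\<phi> p \<noteq> 0" "fls_subdegree (\<phi> p) = - int (degree p)" by auto
      have sd: "fls_subdegree (fls_X_inv * \<phi> p) = - int (degree p) - 1"
        using IH by (subst fls_subdegree_mult) auto
      have "fls_subdegree (\<phi>0 a + fls_X_inv * \<phi> p) = - int (degree p) - 1"
        by (subst fls_subdegree_add_eq2) (use IH sd in \<open>auto simp: \<phi>0_def\<close>)
      moreover from this have "\<phi>0 a + fls_X_inv * \<phi> p \<noteq> 0" by auto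
      ultimately show ?thesis using False by (simp add: \<phi>_def r0.eval_hom_pCons)
    qed
  qed simp
  have "\<exists>v\<in>places Kxy. \<exists>d>0. \<forall>p. p \<noteq> 0 \<longrightarrow> fls_subdegree (\<phi> p) = d * v (cx p)"
  proof (rule place_from_series)
    show "ring_map \<phi>" unfolding \<phi>_def by (rule r0.ring_map_eval_hom)
    show "\<phi> p = 0 \<Longrightarrow> p = 0" for p using deg by blast
    show "int n dvd fls_subdegree (\<phi> f)" using deg[OF f_nonzero] n_dvd by simp
    show "c \<noteq> 0 \<Longrightarrow> fls_subdegree (\<phi> [:c:]) = 0" for c using deg[of "[:c:]"] by simp
    show "[:0, 1::'k:] \<noteq> 0" by simp
    then show "fls_subdegree (\<phi> [:0, 1:]) \<noteq> 0" using deg[of "[:0,1:]"] by simp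
  qed
  then obtain v d where v: "v \<in> places Kxy" "d > 0" "\<And>p. p \<noteq> 0 \<Longrightarrow> fls_subdegree (\<phi> p) = d * v (cx p)" by blast
  have "d * v xcoord = -1" using v(3)[of "[:0,1:]"] deg[of "[:0,1:]"] by (simp add: xcoord_eq_cx)
  then have "d * v xcoord < 0" by simp
  then have "v xcoord < 0" using v(2) by (simp add: mult_less_0_iff)
  with v(1) show ?thesis by blast
qed

end

section \<open>The places over a point of the line\<close>

lemma xcoord_minus_cst: "xcoord - cst a = cx [:-a, 1:]"
  by (simp add: xcoord_eq_cx cst_eq_cx flip: cx.diff)

context kummer_galois
begin

lemma xcoord_Kxy [simp]: "xcoord \<in> Kxy"
  by (simp add: xcoord_eq_cx)

definition conj_place :: "'k \<Rightarrow> 'k place \<Rightarrow> 'k place" where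
  "conj_place u v h = (if h \<in> Kxy then v (sigma u h) else 0)"

lemma sigma_surj: assumes "u \<in> mu_n" "h \<in> Kxy" shows "\<exists>g\<in>Kxy. sigma u g = h"
  using sigma_comp[OF inverse_mu_n[OF assms(1)] assms] mu_n_nonzero[OF assms(1)] assms
  by (intro bexI[of _ "sigma (inverse u) h"]) (auto simp: inverse_mu_n)

lemma conj_place:
  assumes v: "v \<in> places Kxy" and u: "u \<in> mu_n"
  shows "conj_place u v \<in> places Kxy"
  unfolding places_def
proof (intro CollectI conjI)
  show "\<forall>a. a \<notin> Kxy \<or> a = 0 \<longrightarrow> conj_place u v a = 0"
    using v u sigma_eq_0_iff[OF u, of 0] by (auto simp: conj_place_def val_0[OF v])
  show "conj_place u v ` (Kxy - {0}) = UNIV"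
  proof (intro equalityI subsetI)
    fix m
    obtain h where h: "h \<in> Kxy" "h \<noteq> 0" "v h = m" using val_surj[OF v] by blast
    obtain g where "g \<in> Kxy" "sigma u g = h" using sigma_surj[OF u h(1)] by blast
    then show "m \<in> conj_place u v ` (Kxy - {0})"
      using h sigma_eq_0_iff[OF u, of g] by (intro image_eqI[of _ _ g]) (auto simp: conj_place_def)
  qed simp
  show "\<forall>a\<in>Kxy - {0}. \<forall>b\<in>Kxy - {0}. conj_place u v (a * b) = conj_place u v a + conj_place u v b \<and>
        (a + b \<noteq> 0 \<longrightarrow> min (conj_place u v a) (conj_place u v b) \<le> conj_place u v (a + b))"
  proof (intro ballI conjI impI)
    fix a b assume ab: "a \<in> Kxy - {0}" "b \<in> Kxy - {0}"
    then have nz: "sigma u a \<noteq> 0" "sigma u b \<noteq> 0" using sigma_eq_0_iff[OF u] by auto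
    show "conj_place u v (a * b) = conj_place u v a + conj_place u v b"
      using ab nz u by (simp add: conj_place_def sigma_mult val_mult[OF v])
    assume "a + b \<noteq> 0"
    then have "sigma u a + sigma u b \<noteq> 0"
      using sigma_eq_0_iff[OF u, of "a + b"] ab u by (simp add: sigma_add)
    then show "min (conj_place u v a) (conj_place u v b) \<le> conj_place u v (a + b)"
      using ab nz u val_add_ge[OF v, of "sigma u a" "sigma u b"] by (simp add: conj_place_def sigma_add)
  qed
  show "\<forall>c. c \<noteq> 0 \<longrightarrow> conj_place u v (cst c) = 0"
    using u v by (simp add: conj_place_def)
qed

text \<open>
  Conjugate places agree on \<open>K(x)\<close>, so they lie over the same point of the line.
\<close>

lemma conj_place_rational:
  assumes u: "u \<in> mu_n" and r: "r \<noteq> 0" shows "conj_place u v (cx p / cx r) = v (cx p / cx r)"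
proof -
  have "sigma u (cx p / cx r * cx r) = sigma u (cx p / cx r) * cx r"
    using u by (simp add: sigma_mult del: nonzero_mult_div_cancel_right times_divide_eq_left)
  then have "sigma u (cx p / cx r) = cx p / cx r"
    using r u by (simp add: field_simps)
  then show ?thesis by (simp add: conj_place_def)
qed

lemma prod_mu_n:
  fixes s :: "'k cover"
  shows "s ^ n - cst (b ^ n) = (\<Prod>u\<in>mu_n. s - cst (u * b))"
proof (cases "b = 0")
  case True
  then show ?thesis using n_pos by (simp add: card_mu_n)
next
  case False
  define P where "P = (\<Prod>u\<in>mu_n. [:-u, 1:]) - (monom 1 n - 1)"
  have "degree (\<Prod>u\<in>mu_n. [:-u, 1:]) = n"
    by (subst degree_prod_eq_sum_degree) (auto simp: card_mu_n)
  moreover have "lead_coeff (\<Prod>u\<in>mu_n. [:-u, 1:]) = 1"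
    by (simp add: lead_coeff_prod)
  ultimately have "coeff P n = 0" using n_pos by (simp add: P_def)
  moreover have "degree P \<le> n"
    unfolding P_def
    by (intro degree_diff_le) (simp_all add: \<open>degree (\<Prod>u\<in>mu_n. [:-u, 1:]) = n\<close> degree_monom_le)
  ultimately have deg: "P = 0 \<or> degree P < n" by (metis le_neq_implies_less leading_coeff_0_iff)
  have roots: "mu_n \<subseteq> {u. poly P u = 0}"
  proof
    fix u assume u: "u \<in> mu_n"
    then have "(\<Prod>w\<in>mu_n. u - w) = 0" by (intro prod_zero) auto
    moreover have "u ^ n = 1" using u by (simp add: mu_n_def)
    ultimately show "u \<in> {u. poly P u = 0}" by (simp add: P_def poly_prod poly_monom)
  qed
  have "P = 0"
  proof (rule ccontr)
    assume P: "P \<noteq> 0"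
    then have "card mu_n \<le> degree P"
      using card_mono[OF poly_roots_finite[OF P] roots] card_poly_roots_bound[OF P] by linarith
    with deg P show False by (simp add: card_mu_n)
  qed
  then have *: "(\<Prod>u\<in>mu_n. [:-u, 1:]) = monom 1 n - (1 :: 'k poly)" by (simp add: P_def)
  have "(s / cst b) ^ n - 1 = (\<Prod>u\<in>mu_n. s / cst b - cst u)"
  proof -
    interpret S: ring_map "eval_hom cst (s / cst b)" by (rule cst.ring_map_eval_hom)
    have "eval_hom cst (s / cst b) [:-u, 1:] = s / cst b - cst u" for u
      using cst.eval_hom_pCons[of "s / cst b" "-u" "[:1:]"]
      by (simp only: cst.eval_hom_const cst.one cst.uminus) simp
    then show ?thesis
      using arg_cong[OF *, of "eval_hom cst (s / cst b)"]
      by (simp add: S.prod S.diff cst.eval_hom_monom)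
  qed
  also have "\<dots> = (\<Prod>u\<in>mu_n. (s - cst (u * b)) / cst b)"
    by (rule prod.cong) (use False in \<open>auto simp: cst.mult field_simps\<close>)
  also have "\<dots> = (\<Prod>u\<in>mu_n. s - cst (u * b)) / cst b ^ n"
    by (simp add: prod_dividef card_mu_n)
  finally have "((s / cst b) ^ n - 1) * cst b ^ n = (\<Prod>u\<in>mu_n. s - cst (u * b))"
    using False by simp
  then show ?thesis using False by (simp add: algebra_simps power_divide cst.power)
qed

definition residue_is :: "'k place \<Rightarrow> 'k cover \<Rightarrow> 'k \<Rightarrow> bool" where
  "residue_is v s b \<longleftrightarrow> s - cst b \<in> at_least v 1"

lemma residue_unique:
  assumes v: "v \<in> places Kxy" and "residue_is v s b" "residue_is v s b'"
  shows "b = b'"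
proof -
  have "(s - cst b') - (s - cst b) \<in> at_least v 1"
    using at_least_diff[OF v] assms(2,3) unfolding residue_is_def by blast
  then have "cst (b - b') \<in> at_least v 1" by (simp add: cst.diff)
  then show ?thesis using v by (simp add: at_least_def)
qed

text \<open>
  \<open>s ^ n - b ^ n\<close> is the product of the differences \<open>s - u b\<close>, so one of these vanishes at the place.
\<close>

lemma residue_root:
  assumes v: "v \<in> places Kxy" and s: "s \<in> Kxy" and res: "residue_is v (s ^ n) (b ^ n)"
  shows "\<exists>u\<in>mu_n. residue_is v s (u * b)"
proof (rule ccontr)
  assume neg: "\<not> ?thesis"
  have "s ^ n - cst (b ^ n) \<in> at_least v 0"
    using at_least_mono[OF v] res unfolding residue_is_def by (metis zero_le_one)
  from at_least_add[OF v this at_least_cst[OF v]] have sn: "s ^ n \<in> at_least v 0"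
    by (metis diff_add_cancel)
  have s0: "s \<in> at_least v 0"
  proof (cases "s = 0")
    case False
    then have "int n * v s \<ge> 0" using sn s by (simp add: at_least_def val_power[OF v])
    then show ?thesis using n_pos s by (simp add: at_least_def zero_le_mult_iff)
  qed (simp add: v)
  have f0: "s - cst (u * b) \<noteq> 0 \<and> v (s - cst (u * b)) = 0" if "u \<in> mu_n" for u
  proof -
    have "s - cst (u * b) \<in> at_least v 0" by (rule at_least_diff[OF v s0 at_least_cst[OF v]])
    moreover have "s - cst (u * b) \<notin> at_least v 1" using neg that by (auto simp: residue_is_def)
    ultimately show ?thesis using s by (auto simp: at_least_def)
  qed
  have "(\<Prod>u\<in>A. s - cst (u * b)) \<noteq> 0 \<and> v (\<Prod>u\<in>A. s - cst (u * b)) = 0" if "A \<subseteq> mu_n" for A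
    using finite_subset[OF that finite_mu_n] that
  proof (induction A rule: finite_induct)
    case (insert u A)
    then show ?case using f0[of u] s by (simp add: val_mult[OF v])
  qed (simp add: v)
  from this[OF subset_refl] res show False
    by (simp add: residue_is_def at_least_def flip: prod_mu_n)
qed

lemma residue_conj:
  assumes v: "v \<in> places Kxy" and u: "u \<in> mu_n" and s: "s \<in> Kxy" "sigma u s = cst u * s"
    and "residue_is v s b"
  shows "residue_is (conj_place u v) s (u * b)"
proof -
  have "sigma u (s - cst (u * b)) = sigma u (s + cst (- (u * b)))" by (simp add: cst.uminus)
  also have "\<dots> = cst u * s + cst (- (u * b))"
    by (simp only: sigma_add[OF u s(1) cst_Kxy] s(2) sigma_cst[OF u])
  also have "\<dots> = cst u * (s - cst b)"
    by (simp add: cst.uminus cst.mult algebra_simps)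
  finally have "sigma u (s - cst (u * b)) = cst u * (s - cst b)" .
  moreover have "cst u * (s - cst b) \<in> at_least v 1"
    using assms by (intro at_least_scale) (auto simp: residue_is_def)
  moreover have "s - cst (u * b) \<in> Kxy" using s by simp
  ultimately show ?thesis
    using sigma_eq_0_iff[OF u, of "s - cst (u * b)"]
    by (auto simp: residue_is_def at_least_def conj_place_def)
qed

end

lemma sum_le_card_imp_eq_1:
  fixes g :: "'a \<Rightarrow> nat"
  assumes "finite P" "(\<Sum>v\<in>P. g v) \<le> card P" "\<And>v. v \<in> P \<Longrightarrow> g v \<ge> 1" "v \<in> P"
  shows "g v = 1"
proof (rule ccontr)
  assume "g v \<noteq> 1"
  then have "g v > 1" using assms(3)[OF assms(4)] by simp
  then have "(\<Sum>v\<in>P. 1) < (\<Sum>v\<in>P. g v)" using assms by (intro sum_strict_mono_ex1) auto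
  with assms(2) show False by simp
qed

context kummer_finite
begin

definition zeros :: "'k cover \<Rightarrow> 'k place set" where
  "zeros z = {v \<in> places Kxy. v z > 0}"

text \<open>
  The function \<open>z\<close> of \<open>x\<close> is a local parameter of the line, and \<open>s\<close> is a function such as \<open>y\<close> on which the
  Galois group acts by multiplication with roots of unity and which takes a nonzero value at the zeros
  of \<open>z\<close>.  Conjugation carries one zero of \<open>z\<close> to zeros with all \<open>n\<close> possible values of \<open>s\<close>, whereas \<open>z\<close> has
  at most \<open>n\<close> zeros with multiplicity and degree.  So there is exactly one zero for each value, and it
  is simple and rational.
\<close>

lemma unramified_fibre:
  assumes pr: "p \<noteq> 0" "r \<noteq> 0" "degree p \<le> 1" "degree r \<le> 1" and z: "z = cx p / cx r"
    and s: "s \<in> Kxy" "\<And>u. u \<in> mu_n \<Longrightarrow> sigma u s = cst u * s"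
    and res: "\<And>v. v \<in> zeros z \<Longrightarrow> residue_is v (s ^ n) (b ^ n)" and b: "b \<noteq> 0"
    and ne: "zeros z \<noteq> {}"
  shows "card (zeros z) = n" and "v \<in> zeros z \<Longrightarrow> v z = 1" and "v \<in> zeros z \<Longrightarrow> place_degree Kxy v = 1"
    and "b' ^ n = b ^ n \<Longrightarrow> \<exists>!v. v \<in> zeros z \<and> residue_is v s b'"
    and "v \<in> zeros z \<Longrightarrow> \<exists>b'. b' ^ n = b ^ n \<and> residue_is v s b'"
proof -
  have fin: "finite (zeros z)" and le: "card (zeros z) \<le> n"
    using card_zeros_le[OF pr(1,2,3,4)] unfolding zeros_def z by simp_all
  have vp: "v \<in> places Kxy" "v z > 0" if "v \<in> zeros z" for v using that by (auto simp: zeros_def)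
  show ex_res: "\<exists>b'. b' ^ n = b ^ n \<and> residue_is v s b'" if "v \<in> zeros z" for v
  proof -
    note v = that
    obtain u where "u \<in> mu_n" "residue_is v s (u * b)"
      using residue_root[OF vp(1)[OF v] s(1) res[OF v]] by blast
    then show ?thesis by (intro exI[of _ "u * b"]) (simp add: mu_n_def power_mult_distrib)
  qed
  have ex: "\<exists>v. v \<in> zeros z \<and> residue_is v s b'" if b': "b' ^ n = b ^ n" for b'
  proof -
    obtain v where v: "v \<in> zeros z" using ne by blast
    obtain b0 where b0: "b0 ^ n = b ^ n" "residue_is v s b0" using ex_res[OF v] by blast
    have "b0 \<noteq> 0" using b0 b n_pos by (metis power_eq_0_iff)
    define u where "u = b' / b0"
    have u: "u \<in> mu_n" using b0 b' b by (simp add: u_def mu_n_def power_divide)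
    have "conj_place u v \<in> zeros z"
      using conj_place[OF vp(1)[OF v] u] conj_place_rational[OF u pr(2), of v p] vp(2)[OF v]
      by (simp add: zeros_def z)
    moreover have "residue_is (conj_place u v) s b'"
      using residue_conj[OF vp(1)[OF v] u s(1) s(2)[OF u] b0(2)] \<open>b0 \<noteq> 0\<close> by (simp add: u_def)
    ultimately show ?thesis by blast
  qed
  define B where "B = {b'. b' ^ n = b ^ n}"
  have "\<forall>b'\<in>B. \<exists>v. v \<in> zeros z \<and> residue_is v s b'" using ex by (simp add: B_def)
  from bchoice[OF this] obtain g where g: "\<And>b'. b' \<in> B \<Longrightarrow> g b' \<in> zeros z \<and> residue_is (g b') s b'"
    by blast
  have inj: "inj_on g B"
  proof (rule inj_onI)
    fix b1 b2 assume *: "b1 \<in> B" "b2 \<in> B" "g b1 = g b2"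
    then show "b1 = b2"
      using residue_unique[OF vp(1), of "g b1" s b1 b2] g[OF *(1)] g[OF *(2)] by simp
  qed
  have "B = (\<lambda>u. u * b) ` mu_n"
  proof (intro equalityI subsetI)
    fix b' assume "b' \<in> B"
    then show "b' \<in> (\<lambda>u. u * b) ` mu_n"
      using b by (intro image_eqI[of _ _ "b' / b"]) (auto simp: B_def mu_n_def power_divide)
  qed (auto simp: B_def mu_n_def power_mult_distrib)
  then have "card B = n"
    using b by (simp add: card_image inj_on_def card_mu_n)
  moreover have "card B \<le> card (zeros z)"
    by (rule card_inj_on_le[OF inj _ fin]) (use g in auto)
  ultimately show card: "card (zeros z) = n" using le by simp
  have surj: "g ` B = zeros z"
    by (rule card_subset_eq[OF fin]) (use g card inj \<open>card B = n\<close> in \<open>auto simp: card_image\<close>)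
  show "\<exists>!v. v \<in> zeros z \<and> residue_is v s b'" if b': "b' ^ n = b ^ n" for b'
  proof (rule ex_ex1I[OF ex[OF b']])
    fix v w assume "v \<in> zeros z \<and> residue_is v s b'" "w \<in> zeros z \<and> residue_is w s b'"
    moreover from this obtain b1 b2 where *: "b1 \<in> B" "v = g b1" "b2 \<in> B" "w = g b2"
      using surj by blast
    ultimately have "b1 = b'" "b2 = b'"
      using residue_unique[OF vp(1)] g[OF *(1)] g[OF *(3)] by blast+
    with * show "v = w" by simp
  qed
  have sum: "(\<Sum>v\<in>zeros z. nat (v z) * place_degree Kxy v) \<le> card (zeros z)"
  proof -
    have "(\<Sum>v\<in>zeros z. nat (v (cx p / cx r)) * place_degree Kxy v) \<le> n * 1"
    proof (rule zeros_bound[OF fin _ pr(1,2) _ pr(3,4)])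
      show "zeros z \<subseteq> places Kxy" using vp(1) by blast
      show "v (cx p / cx r) > 0" if "v \<in> zeros z" for v using vp(2)[OF that] unfolding z .
    qed
    then show ?thesis unfolding card z[symmetric] by simp
  qed
  have ge: "nat (v z) * place_degree Kxy v \<ge> 1" if "v \<in> zeros z" for v
    using vp[OF that] place_degree_props(3)[OF vp(1)[OF that]] by (simp add: Suc_le_eq)
  have one: "nat (v z) * place_degree Kxy v = 1" if "v \<in> zeros z" for v
    by (rule sum_le_card_imp_eq_1[OF fin sum ge that])
  show "v z = 1" "place_degree Kxy v = 1" if "v \<in> zeros z" for v
  proof -
    have "nat (v z) = 1" "place_degree Kxy v = 1" using one[OF that] by simp_all
    then show "v z = 1" "place_degree Kxy v = 1" by linarith+
  qed
qed

lemma lies_over_iff: "lies_over v a \<longleftrightarrow> v (cx [:-a, 1:]) > 0"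
  by (simp add: lies_over_def xcoord_minus_cst)

context
  fixes v a assumes v: "v \<in> places Kxy" and over: "lies_over v a"
begin

lemma lies_over_x: "v xcoord \<ge> 0"
proof -
  have "cx [:-a, 1:] + cst a \<in> at_least v 0"
    using over v by (intro at_least_add) (auto simp: lies_over_iff at_least_def)
  moreover have "cx [:-a, 1:] + cst a = xcoord" by (simp flip: xcoord_minus_cst)
  ultimately show ?thesis using val_0[OF v] by (auto simp: at_least_def)
qed

lemma lies_over_residue: "residue_is v (cx p) (poly p a)"
proof -
  have "[:-a, 1:] dvd p - [:poly p a:]" by (simp flip: poly_eq_0_iff_dvd)
  then obtain q where "p - [:poly p a:] = [:-a, 1:] * q" by blast
  then have "cx p - cst (poly p a) = cx [:-a, 1:] * cx q"
    by (simp only: cst_eq_cx flip: cx.diff cx.mult)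
  moreover have "cx [:-a, 1:] * cx q \<in> at_least v (1 + 0)"
    by (intro at_least_mult[OF v] cx_at_least[OF v lies_over_x])
       (use over in \<open>auto simp: lies_over_iff at_least_def\<close>)
  ultimately show ?thesis by (simp add: residue_is_def)
qed

lemma lies_over_val_eq_0: "poly p a \<noteq> 0 \<Longrightarrow> v (cx p) = 0"
  using val_add_eq(1)[OF v, of "cst (poly p a)" "cx p - cst (poly p a)"] lies_over_residue[of p] v
  by (auto simp: residue_is_def at_least_def)

end

lemma lies_over_unique:
  "v \<in> places Kxy \<Longrightarrow> lies_over v a \<Longrightarrow> lies_over v a' \<Longrightarrow> a = a'"
  using lies_over_residue[of v a "[:0,1:]"] lies_over_residue[of v a' "[:0,1:]"] residue_unique by auto

lemma zeros_eq_lies_over: "zeros (cx [:-a, 1:] / cx 1) = {v \<in> places Kxy. lies_over v a}"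
  by (auto simp: zeros_def lies_over_iff)

lemma exists_lies_over: "\<exists>v\<in>places Kxy. lies_over v a"
proof -
  obtain v where v: "v \<in> places Kxy"
    "\<And>p. p \<noteq> 0 \<Longrightarrow> v (cx p) \<ge> 0 \<and> (v (cx p) > 0 \<longleftrightarrow> poly (map_poly to_ac p) (to_ac a) = 0)"
    using exists_place_over[of "to_ac a"] by blast
  have "poly (map_poly to_ac [:-a, 1:]) (to_ac a) = 0" by (simp add: map_poly_pCons)
  with v(2)[of "[:-a, 1:]"] v(1) show ?thesis by (auto simp: lies_over_iff)
qed

lemma fibre_unramified:
  assumes fa: "poly f a = b ^ n" "b \<noteq> 0"
  defines "P \<equiv> {v \<in> places Kxy. lies_over v a}"
  shows "card P = n" "\<And>v. v \<in> P \<Longrightarrow> place_degree Kxy v = 1"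
    and "\<And>b'. b' ^ n = poly f a \<Longrightarrow> \<exists>!v. v \<in> P \<and> residue_is v y b'"
    and "\<And>v. v \<in> P \<Longrightarrow> \<exists>b'. b' ^ n = poly f a \<and> residue_is v y b'"
proof -
  have res: "residue_is v (y ^ n) (b ^ n)" if "v \<in> P" for v
    using lies_over_residue[of v a f] that by (simp add: y_power fa P_def)
  have ne: "P \<noteq> {}" using exists_lies_over by (auto simp: P_def)
  note facts = unramified_fibre[of "[:-a, 1:]" 1 "cx [:-a, 1:] / cx 1" y b, unfolded zeros_eq_lies_over, folded P_def,
    OF _ _ _ _ refl y_Kxy sigma_y res fa(2) ne]
  show "card P = n" by (rule facts(1)) simp_all
  show "\<And>v. v \<in> P \<Longrightarrow> place_degree Kxy v = 1" by (rule facts(3)) simp_all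
  show "\<And>b'. b' ^ n = poly f a \<Longrightarrow> \<exists>!v. v \<in> P \<and> residue_is v y b'" by (rule facts(4)) (simp_all add: fa)
  show "\<And>v. v \<in> P \<Longrightarrow> \<exists>b'. b' ^ n = poly f a \<and> residue_is v y b'" using facts(5) by (simp add: fa)
qed

text \<open>
  At a simple zero \<open>a\<close> of \<open>f\<close> the order of \<open>x - a\<close> is \<open>n\<close> times the order of \<open>y\<close>, which uses up the whole
  bound \<open>n\<close> on the zeros of \<open>x - a\<close> with a single place.
\<close>

lemma fibre_ramified:
  assumes ord: "order a f = 1"
  defines "P \<equiv> {v \<in> places Kxy. lies_over v a}"
  shows "card P = 1" "\<And>v. v \<in> P \<Longrightarrow> place_degree Kxy v = 1" "\<And>v. v \<in> P \<Longrightarrow> v y = 1"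
    "\<And>v. v \<in> P \<Longrightarrow> v (cx [:-a, 1:]) = int n * v y"
proof -
  show ny: "v (cx [:-a, 1:]) = int n * v y" if "v \<in> P" for v
  proof -
    have v: "v \<in> places Kxy" "lies_over v a" using that by (auto simp: P_def)
    obtain q where q: "f = [:-a, 1:] ^ order a f * q" "\<not> [:-a, 1:] dvd q"
      using order_decomp[OF f_nonzero] by blast
    have fq: "f = [:-a, 1:] * q" using q(1) ord by simp
    then have q0: "q \<noteq> 0" using f_nonzero by auto
    have "v (cx q) = 0"
      by (rule lies_over_val_eq_0[OF v]) (use q(2) poly_eq_0_iff_dvd in blast)
    moreover have "v (cx f) = v (cx [:-a, 1:]) + v (cx q)"
      unfolding fq cx.mult by (rule val_mult[OF v(1)]) (use q0 in auto)
    moreover have "v (cx f) = int n * v y"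
      using val_power[OF v(1) y_Kxy y_nonzero, of n] by (simp add: y_power)
    ultimately show ?thesis by simp
  qed
  have pos: "v (cx [:-a, 1:]) > 0" "v y > 0" if "v \<in> P" for v
  proof -
    show "v (cx [:-a, 1:]) > 0" using that by (auto simp: P_def lies_over_iff)
    then show "v y > 0" using ny[OF that] by (simp add: zero_less_mult_iff)
  qed
  have fin: "finite P"
    using card_zeros_le(1)[of "[:-a, 1:]" 1 1] zeros_eq_lies_over[of a] by (simp add: P_def zeros_def)
  have "(\<Sum>v\<in>P. nat (v (cx [:-a, 1:] / cx 1)) * place_degree Kxy v) \<le> n * 1"
    by (rule zeros_bound[OF fin]) (use pos in \<open>auto simp: P_def\<close>)
  then have "n * (\<Sum>v\<in>P. nat (v y) * place_degree Kxy v) \<le> n * 1"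
    by (simp add: ny nat_mult_distrib sum_distrib_left mult.assoc cong: sum.cong)
  then have le: "(\<Sum>v\<in>P. nat (v y) * place_degree Kxy v) \<le> 1" using n_pos by simp
  have ge: "nat (v y) * place_degree Kxy v \<ge> 1" if "v \<in> P" for v
    using pos(2)[OF that] place_degree_props(3)[of v] that by (simp add: Suc_le_eq P_def)
  have "card P \<le> (\<Sum>v\<in>P. nat (v y) * place_degree Kxy v)"
    using sum_mono[of P "\<lambda>_. 1" "\<lambda>v. nat (v y) * place_degree Kxy v"] ge by simp
  moreover have "P \<noteq> {}" using exists_lies_over by (auto simp: P_def)
  then have "card P \<ge> 1" using fin by (simp add: Suc_le_eq card_gt_0_iff)
  ultimately show card: "card P = 1" using le by simp
  have one: "nat (v y) * place_degree Kxy v = 1" if "v \<in> P" for v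
    by (rule sum_le_card_imp_eq_1[OF fin _ ge that]) (use le card in auto)
  show "\<And>v. v \<in> P \<Longrightarrow> place_degree Kxy v = 1" "\<And>v. v \<in> P \<Longrightarrow> v y = 1"
    using one pos(2) by force+
qed

lemma val_cx_infinite:
  assumes v: "v \<in> places Kxy" and x: "v xcoord < 0" and p: "p \<noteq> 0"
  shows "v (cx p) = int (degree p) * v xcoord"
  using p
proof (induction p)
  case (pCons a p)
  show ?case
  proof (cases "p = 0")
    case True
    then show ?thesis using v by (simp flip: cst_eq_cx)
  next
    case False
    then have IH: "v (cx p) = int (degree p) * v xcoord" using pCons by simp
    have eq: "cx (pCons a p) = xcoord * cx p + cst a"
      by (simp add: xcoord_eq_cx cst_eq_cx flip: cx.mult cx.add)
    have x0: "xcoord \<noteq> (0 :: 'k cover)" by (simp add: xcoord_eq_cx)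
    have vx: "v (xcoord * cx p) = int (Suc (degree p)) * v xcoord"
      using False x0 by (simp add: val_mult[OF v] IH algebra_simps)
    then have "v (xcoord * cx p) < 0" using x by (simp only: zero_less_mult_iff mult_less_0_iff) simp
    then show ?thesis unfolding eq
      using False x0 v by (subst val_add_eq(1)[OF v]) (auto simp: vx[simplified])
  qed
qed simp

lemma zeros_eq_inf_places: "zeros (cx 1 / cx [:0, 1:]) = inf_places Kxy"
  by (auto simp: zeros_def inf_places_def xcoord_eq_cx val_inverse simp flip: inverse_eq_divide)

text \<open>
  The function \<open>y / x ^ e\<close> has a finite value at infinity, an \<open>n\<close>-th root of the leading coefficient, and
  \<open>1 / x\<close> is the local parameter of the line.
\<close>

lemma fibre_infinite:
  assumes deg: "degree f = n * e" and lc: "lead_coeff f = b ^ n"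
  shows "card (inf_places Kxy) = n" "\<And>v. v \<in> inf_places Kxy \<Longrightarrow> place_degree Kxy v = 1"
    "\<And>v. v \<in> inf_places Kxy \<Longrightarrow> v xcoord = -1" "\<And>v. v \<in> inf_places Kxy \<Longrightarrow> v y = - int e"
proof -
  have x0: "xcoord \<noteq> (0 :: 'k cover)" by (simp add: xcoord_eq_cx)
  \<comment> \<open>Finite and nonzero at infinity, as \<open>degree f = n * e\<close>.\<close>
  define s where "s = y / xcoord ^ e"
  have s: "s \<in> Kxy" by (simp add: s_def)
  have sx: "s * xcoord ^ e = y" using x0 by (simp add: s_def)
  have sig: "sigma u s = cst u * s" if u: "u \<in> mu_n" for u
  proof -
    have e: "xcoord ^ e = cx ([:0, 1:] ^ e)" by (simp add: xcoord_eq_cx cx.power)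
    have "sigma u (xcoord ^ e) = xcoord ^ e" unfolding e by (rule sigma_cx[OF u])
    then have "sigma u (s * xcoord ^ e) = sigma u s * xcoord ^ e"
      using u s by (simp add: sigma_mult)
    then have "sigma u s * xcoord ^ e = cst u * (s * xcoord ^ e)" using u by (simp add: sx)
    then show ?thesis using x0 by simp
  qed
  have res: "residue_is v (s ^ n) (b ^ n)" if "v \<in> inf_places Kxy" for v
  proof -
    have v: "v \<in> places Kxy" "v xcoord < 0" using that by (auto simp: inf_places_def)
    define g where "g = f - monom (b ^ n) (n * e)"
    have "s ^ n - cst (b ^ n) = cx g / xcoord ^ (n * e)"
    proof -
      have "xcoord ^ (n * e) = cx (monom 1 (n * e))"
        by (simp add: xcoord_eq_cx monom_altdef flip: cx.power)
      moreover have "monom (b ^ n) (n * e) = [:b ^ n:] * monom 1 (n * e)"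
        by (simp add: smult_monom)
      ultimately have "cst (b ^ n) * xcoord ^ (n * e) = cx (monom (b ^ n) (n * e))"
        by (metis cst_eq_cx cx.mult)
      then have *: "cst (b ^ n) = cx (monom (b ^ n) (n * e)) / xcoord ^ (n * e)"
        using x0 by (simp add: field_simps)
      have "s ^ n = cx f / xcoord ^ (n * e)"
        by (simp add: s_def power_divide y_power power_mult mult.commute[of n])
      then show ?thesis by (subst *) (simp add: g_def cx.diff diff_divide_distrib)
    qed
    moreover have "cx g / xcoord ^ (n * e) \<in> at_least v 1"
    proof (cases "g = 0")
      case False
      have "coeff g (n * e) = 0" using deg lc by (simp add: g_def)
      moreover have "degree g \<le> n * e" unfolding g_def
        by (rule degree_diff_le) (simp_all add: deg degree_monom_le)
      ultimately have "degree g < n * e" using False by (metis le_neq_implies_less leading_coeff_0_iff)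
      then have "int (degree g) * v xcoord > int (n * e) * v xcoord"
        using v(2) by (intro mult_strict_right_mono_neg) (simp_all del: of_nat_mult)
      then show ?thesis
        using False x0 by (simp add: at_least_def val_divide[OF v(1)] val_power[OF v(1)] val_cx_infinite[OF v])
    qed (simp add: v)
    ultimately show ?thesis by (simp add: residue_is_def)
  qed
  have b0: "b \<noteq> 0" using lc f_nonzero n_pos by (auto simp: power_0_left)
  have ne: "inf_places Kxy \<noteq> {}" using exists_infinite_place deg by (auto simp: inf_places_def)
  note facts = unramified_fibre[of 1 "[:0, 1:]" "cx 1 / cx [:0, 1:]" s b, unfolded zeros_eq_inf_places,
    OF _ _ _ _ refl s sig res b0 ne]
  show "card (inf_places Kxy) = n" by (rule facts(1)) simp_all
  show "\<And>v. v \<in> inf_places Kxy \<Longrightarrow> place_degree Kxy v = 1" by (rule facts(3)) simp_all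
  show vx: "v xcoord = -1" if "v \<in> inf_places Kxy" for v
  proof -
    have v: "v \<in> places Kxy" using that by (simp add: inf_places_def)
    have "v (cx 1 / cx [:0, 1:]) = 1" by (rule facts(2)) (use that in simp_all)
    then show ?thesis using v by (simp add: val_inverse xcoord_eq_cx flip: inverse_eq_divide)
  qed
  show "v y = - int e" if "v \<in> inf_places Kxy" for v
  proof -
    have v: "v \<in> places Kxy" using that by (simp add: inf_places_def)
    have "int n * v y = v (cx f)"
      using val_power[OF v y_Kxy y_nonzero, of n] by (simp add: y_power)
    also have "\<dots> = - (int n * int e)"
      using val_cx_infinite[OF v _ f_nonzero] vx[OF that] deg by simp
    finally have "int n * v y = int n * (- int e)" by simp
    moreover have "int n \<noteq> 0" using n_pos by simp
    ultimately show ?thesis by (metis mult_left_cancel)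
  qed
qed

text \<open>
  If \<open>x\<close> had no value in \<open>K\<close>, the residues of \<open>1\<close> and \<open>x\<close> would be independent.
\<close>

lemma rational_place_cases:
  assumes "v \<in> rational_places Kxy"
  shows "v \<in> inf_places Kxy \<or> (\<exists>a. lies_over v a)"
proof (rule ccontr)
  assume neg: "\<not> ?thesis"
  have v: "v \<in> places Kxy" and deg: "place_degree Kxy v = 1"
    using assms by (auto simp: rational_places_def)
  have x: "v xcoord \<ge> 0" using neg v by (auto simp: inf_places_def)
  have x1: "xcoord \<noteq> (1 :: 'k cover)"
    using cx_eq_iff[of "[:0,1:]" 1] by (simp add: xcoord_eq_cx del: cx_eq_iff) (simp add: one_pCons)
  have x_nconst: "xcoord \<noteq> cst c" for c by (simp add: xcoord_eq_cx cst_eq_cx)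
  have "independent_mod v {1, xcoord}"
    unfolding independent_mod_def valuation_ring_eq valuation_ideal_eq
  proof (intro conjI allI impI)
    show "{1, xcoord} \<subseteq> at_least v 0" using v x by (simp add: at_least_def)
    fix u assume "(\<Sum>b\<in>{1, xcoord}. cst (u b) * b) \<in> at_least v 1"
    then have *: "cst (u 1) + cst (u xcoord) * xcoord \<in> at_least v 1" using x1 by simp
    have ux: "u xcoord = 0"
    proof (rule ccontr)
      assume nz: "u xcoord \<noteq> 0"
      define a where "a = - (u 1 / u xcoord)"
      have "cst (inverse (u xcoord)) * (cst (u 1) + cst (u xcoord) * xcoord) \<in> at_least v 1"
        by (rule at_least_scale[OF v *])
      moreover have "cst (inverse (u xcoord)) * (cst (u 1) + cst (u xcoord) * xcoord)
         = cst (inverse (u xcoord) * u 1) + cst (inverse (u xcoord) * u xcoord) * xcoord"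
        by (simp add: cst.mult algebra_simps)
      moreover have "\<dots> = xcoord - cst a" using nz by (simp add: a_def cst.uminus field_simps)
      ultimately have "lies_over v a" using x_nconst[of a] by (simp add: at_least_def lies_over_def)
      with neg show False by blast
    qed
    then have "u 1 = 0" using * v by (simp add: at_least_def)
    with ux show "\<forall>b\<in>{1, xcoord}. u b = 0" by simp
  qed simp
  from place_degree_props(2)[OF v this] show False using deg x1 by simp
qed

end

section \<open>Functions with poles only at infinity\<close>

lemma card_subspace_eq_power_dim:
  fixes scale :: "'k::{field,finite} \<Rightarrow> 'b::ab_group_add \<Rightarrow> 'b"
  assumes "vector_space scale" and sub: "module.subspace scale S" and fin: "finite S"
  shows "card S = CARD('k) ^ vector_space.dim scale S"
proof -
  interpret vector_space scale by fact
  obtain B where B: "B \<subseteq> S" "independent B" "S \<subseteq> span B" "card B = dim S"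
    using basis_exists by blast
  have finB: "finite B" using B(1) fin finite_subset by blast
  have "span B = S" using B span_minimal[OF B(1) sub] by blast
  define g where "g u = (\<Sum>v\<in>B. scale (u v) v)" for u
  have "S = g ` (B \<rightarrow>\<^sub>E (UNIV :: 'k set))"
  proof (intro equalityI subsetI)
    fix a assume "a \<in> S"
    then obtain u where "a = g u" using span_finite[OF finB] \<open>span B = S\<close> by (auto simp: g_def)
    then have "a = g (restrict u B)" by (simp add: g_def)
    then show "a \<in> g ` (B \<rightarrow>\<^sub>E (UNIV :: 'k set))" by (intro image_eqI[of _ _ "restrict u B"]) auto
  next
    fix a assume "a \<in> g ` (B \<rightarrow>\<^sub>E (UNIV :: 'k set))"
    then show "a \<in> S" using span_finite[OF finB] \<open>span B = S\<close> by (auto simp: g_def)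
  qed
  moreover have "inj_on g (B \<rightarrow>\<^sub>E (UNIV :: 'k set))"
  proof (rule inj_onI)
    fix u w assume uw: "u \<in> B \<rightarrow>\<^sub>E (UNIV :: 'k set)" "w \<in> B \<rightarrow>\<^sub>E (UNIV :: 'k set)" "g u = g w"
    have "(\<Sum>v\<in>B. scale (u v - w v) v) = 0"
      using uw(3) by (simp add: g_def scale_left_diff_distrib sum_subtractf)
    then have "u v = w v" if "v \<in> B" for v
      using independentD[OF B(2) finB subset_refl, of "\<lambda>v. u v - w v" v] that by simp
    then show "u = w" using uw by (intro PiE_ext) auto
  qed
  ultimately have "card S = CARD('k) ^ card B" using finB by (simp add: card_image card_PiE)
  then show ?thesis by (simp only: B(4))
qed

lemma vector_space_cover: "vector_space (\<lambda>c h. cst c * (h :: 'k::field cover))"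
  by standard (simp_all add: cst.add cst.mult algebra_simps)

lemma dim_eq_of_card:
  fixes W :: "'k::{field,finite} cover set"
  assumes "is_csubspace W" "finite W" "card W = CARD('k) ^ d"
  shows "vector_space.dim (\<lambda>c h. cst c * h) W = d"
proof -
  interpret vector_space "\<lambda>c h. cst c * (h :: 'k cover)" by (rule vector_space_cover)
  have "subspace W" using assms(1) by (auto simp: is_csubspace_def subspace_def)
  then have "CARD('k) ^ d = CARD('k) ^ dim W"
    using card_subspace_eq_power_dim[OF vector_space_cover _ assms(2)] assms(3) by simp
  moreover have "CARD('k) > 1" using card_mono[of UNIV "{0, 1 :: 'k}"] by simp
  ultimately show ?thesis by simp
qed

lemma order_eq_1_of_splits:
  fixes p :: "'a::field poly"
  assumes p: "p \<noteq> 0" and splits: "p = smult (lead_coeff p) (\<Prod>a | poly p a = 0. [:- a, 1:])"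
    and root: "poly p a = 0"
  shows "order a p = 1"
proof -
  define R where "R = {a. poly p a = 0}"
  have fin: "finite R" unfolding R_def by (rule poly_roots_finite[OF p])
  define g where "g = smult (lead_coeff p) (\<Prod>a\<in>R - {a}. [:- a, 1:])"
  have "(\<Prod>a\<in>R. [:- a, 1:]) = [:-a, 1:] * (\<Prod>a\<in>R - {a}. [:- a, 1:])"
    by (rule prod.remove[OF fin]) (use root in \<open>simp add: R_def\<close>)
  then have pg: "p = [:-a, 1:] * g" using splits by (simp add: g_def R_def)
  have "poly g a \<noteq> 0" using p fin by (simp add: g_def poly_prod)
  moreover have "order a [:-a, 1:] = 1" using order_power_n_n[of a 1] by simp
  ultimately show ?thesis
    using pg p by (metis order_mult order_0I add.right_neutral)
qed

locale split_kummer = kummer_finite f n y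
  for f :: "'k::{field,finite} poly" and n :: nat and y :: "'k cover" +
  fixes e :: nat
  assumes degree_f: "degree f = n * e"
    and f_splits: "f = smult (lead_coeff f) (\<Prod>a | poly f a = 0. [:- a, 1:])"
    and lead_coeff_power: "\<exists>b. b ^ n = lead_coeff f"
    and f_power: "\<exists>b. b ^ n = poly f a"
begin

lemma order_root_f: "poly f a = 0 \<Longrightarrow> order a f = 1"
  by (rule order_eq_1_of_splits[OF f_nonzero f_splits])

lemma root_in_field:
  fixes \<alpha> :: "'k alg_closure"
  assumes "poly (map_poly to_ac f) \<alpha> = 0"
  shows "\<exists>a. \<alpha> = to_ac a \<and> poly f a = 0"
proof -
  interpret ac: ring_map "to_ac :: 'k \<Rightarrow> _" by (rule ring_map_to_ac)
  interpret ev: ring_map "eval_hom to_ac \<alpha>" by (rule ac.ring_map_eval_hom)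
  have lin: "eval_hom to_ac \<alpha> [:-a, 1:] = \<alpha> - to_ac a" for a
    by (simp add: eval_hom_def map_poly_pCons)
  have "eval_hom to_ac \<alpha> f = to_ac (lead_coeff f) * (\<Prod>a | poly f a = 0. \<alpha> - to_ac a)"
    by (subst f_splits) (simp add: ac.eval_hom_smult ev.prod lin)
  then have "(\<Prod>a | poly f a = 0. \<alpha> - to_ac a) = 0"
    using assms f_nonzero by (simp add: eval_hom_def)
  then show ?thesis using poly_roots_finite[OF f_nonzero] by (auto simp: prod_zero_iff)
qed

definition normal_span :: "(nat \<Rightarrow> nat) \<Rightarrow> 'k cover set" where
  "normal_span c = {\<Sum>j<n. cx (a j) * y ^ j | a. \<forall>j<n. a j \<in> polys_below (c j)}"

lemma normal_span_eq_image:
  "normal_span c = (\<lambda>a. \<Sum>j<n. cx (a j) * y ^ j) ` (PiE {..<n} (\<lambda>j. polys_below (c j)))"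
proof (intro equalityI subsetI)
  fix h assume "h \<in> normal_span c"
  then obtain a where "h = (\<Sum>j<n. cx (a j) * y ^ j)" "\<forall>j<n. a j \<in> polys_below (c j)"
    by (auto simp: normal_span_def)
  then show "h \<in> (\<lambda>a. \<Sum>j<n. cx (a j) * y ^ j) ` (PiE {..<n} (\<lambda>j. polys_below (c j)))"
    by (intro image_eqI[of _ _ "restrict a {..<n}"]) auto
qed (auto simp: normal_span_def PiE_def Pi_def)

lemma card_normal_span: "card (normal_span c) = CARD('k) ^ (\<Sum>j<n. c j)" "finite (normal_span c)"
proof -
  have "inj_on (\<lambda>a. \<Sum>j<n. cx (a j) * y ^ j) (PiE {..<n} (\<lambda>j. polys_below (c j) :: 'k poly set))"
  proof (rule inj_onI)
    fix a b :: "nat \<Rightarrow> 'k poly"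
    assume ab: "a \<in> (PiE {..<n} (\<lambda>j. polys_below (c j)))" "b \<in> (PiE {..<n} (\<lambda>j. polys_below (c j)))"
      and eq: "(\<Sum>j<n. cx (a j) * y ^ j) = (\<Sum>j<n. cx (b j) * y ^ j)"
    show "a = b" by (rule PiE_ext[OF ab]) (use basis_unique[OF eq] in auto)
  qed
  then show "card (normal_span c) = CARD('k) ^ (\<Sum>j<n. c j)"
    by (simp add: normal_span_eq_image card_image card_PiE card_polys_below power_sum)
  show "finite (normal_span c)"
    by (simp add: normal_span_eq_image finite_PiE card_polys_below)
qed

lemma polys_below_0 [simp]: "0 \<in> polys_below c"
  by (simp add: polys_below_def)

lemma polys_below_add: "p \<in> polys_below c \<Longrightarrow> q \<in> polys_below c \<Longrightarrow> p + q \<in> polys_below c"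
  for p q :: "'k poly"
  by (simp add: polys_below_def)

lemma polys_below_smult: "p \<in> polys_below c \<Longrightarrow> smult a p \<in> polys_below c"
  for p :: "'k poly"
  by (simp add: polys_below_def)

text \<open>
  A lower bound for the valuation of \<open>h\<close> at all conjugates of a place is inherited by every summand of
  \<open>h\<close>, since the summand is an average of conjugates of \<open>h\<close>.
\<close>

lemma monomial_at_least:
  assumes b: "b \<noteq> 0" and i: "i < n" and v: "v \<in> places Kxy"
    and all: "\<And>u. u \<in> mu_n \<Longrightarrow> (\<Sum>j<n. cx (a j) * y ^ j) / cx b \<in> at_least (conj_place u v) m"
  shows "cx (a i) * y ^ i / cx b \<in> at_least v m"
proof -
  define h where "h = (\<Sum>j<n. cx (a j) * y ^ j) / cx b"
  have h: "h \<in> Kxy" by (simp add: h_def)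
  have "sigma u h \<in> at_least v m" if u: "u \<in> mu_n" for u
    using all[OF u] h u sigma_eq_0_iff[OF u h] by (auto simp: at_least_def conj_place_def simp flip: h_def)
  then have "(\<Sum>u\<in>mu_n. cst (u ^ (n - i)) * sigma u h) \<in> at_least v m"
    by (intro at_least_sum[OF v] at_least_scale[OF v])
  also have "(\<Sum>u\<in>mu_n. cst (u ^ (n - i)) * sigma u h) = cst (of_nat n) * cx (a i) * y ^ i / cx b"
    unfolding h_def by (rule isotypic_projection[OF b i])
  finally have "cst (inverse (of_nat n)) * (cst (of_nat n) * cx (a i) * y ^ i / cx b) \<in> at_least v m"
    by (rule at_least_scale[OF v])
  moreover have "cst (inverse (of_nat n :: 'k)) * cst (of_nat n) = 1"
    using n_nonzero by (simp flip: cst.mult)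
  then have "cst (inverse (of_nat n)) * (cst (of_nat n) * T) = T" for T :: "'k cover"
    by (metis mult.assoc mult_1)
  ultimately show ?thesis by (metis times_divide_eq_right mult.assoc)
qed

lemma conj_place_x: "u \<in> mu_n \<Longrightarrow> conj_place u v xcoord = v xcoord"
  using conj_place_rational[of u 1 v "[:0,1:]"] by (simp add: xcoord_eq_cx)

text \<open>
  The integral closure of \<open>K[x]\<close> is \<open>K[x, y]\<close>.  Otherwise take a root \<open>\<alpha>\<close> of the denominator \<open>b\<close> and a
  place over \<open>\<alpha>\<close>.  A coefficient \<open>a i\<close> that does not vanish at \<open>\<alpha>\<close> would need \<open>v b \<le> i * v y\<close>; then
  \<open>v y > 0\<close>, so \<open>\<alpha>\<close> is a zero of \<open>f\<close>, where \<open>v y = 1\<close> but \<open>v b \<ge> n > i\<close>.  So all coefficients vanish at \<open>\<alpha>\<close>,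
  and the minimal polynomial of \<open>\<alpha>\<close> cancels.
\<close>

lemma integral_imp_polynomial:
  assumes h: "h \<in> Kxy" and int: "\<And>v. v \<in> places Kxy \<Longrightarrow> v xcoord \<ge> 0 \<Longrightarrow> h \<in> at_least v 0"
  shows "\<exists>a. h = (\<Sum>j<n. cx (a j) * y ^ j)"
proof -
  have "\<exists>a. h = (\<Sum>j<n. cx (a j) * y ^ j)" if "b \<noteq> 0" "h = (\<Sum>j<n. cx (a j) * y ^ j) / cx b" for a b
    using that
  proof (induction "degree b" arbitrary: a b rule: less_induct)
    case less
    note b = less.prems(1) and hab = less.prems(2)
    show ?case
    proof (cases "degree b = 0")
      case True
      then obtain c where c: "b = [:c:]" using degree_eq_zeroE by blast
      with b have c0: "c \<noteq> 0" by auto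
      have "cx (smult (inverse c) p) = cx p / cx b" for p
      proof -
        have "cx p = cx (smult (inverse c) p) * cx b" using c0 by (simp add: c flip: cx.mult)
        then show ?thesis using b by simp
      qed
      then have "h = (\<Sum>j<n. cx (smult (inverse c) (a j)) * y ^ j)"
        by (simp add: hab sum_divide_distrib)
      then show ?thesis by (intro exI[of _ "\<lambda>j. smult (inverse c) (a j)"])
    next
      case False
      have "degree (map_poly to_ac b) = degree b" by (rule degree_map_poly) simp
      then obtain \<alpha> :: "'k alg_closure" where \<alpha>: "poly (map_poly to_ac b) \<alpha> = 0"
        using alg_closed_imp_poly_has_root[of "map_poly to_ac b"] False by auto
      define root where "root p \<longleftrightarrow> poly (map_poly to_ac p) \<alpha> = 0" for p :: "'k poly"
      \<comment> \<open>The minimal polynomial of \<open>\<alpha>\<close> over \<open>K\<close>, up to a constant factor.\<close>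
      define p where "p = arg_min degree (\<lambda>p. p \<noteq> 0 \<and> root p)"
      have p: "p \<noteq> 0" "root p" and p_min: "\<And>q. q \<noteq> 0 \<Longrightarrow> root q \<Longrightarrow> degree p \<le> degree q"
        using arg_min_nat_lemma[of "\<lambda>p. p \<noteq> 0 \<and> root p" b degree] b \<alpha> by (auto simp: p_def root_def)
      interpret ac: ring_map "to_ac :: 'k \<Rightarrow> _" by (rule ring_map_to_ac)
      interpret ev: ring_map "eval_hom to_ac \<alpha>" by (rule ac.ring_map_eval_hom)
      have root_ev: "root q \<longleftrightarrow> eval_hom to_ac \<alpha> q = 0" for q by (simp add: root_def eval_hom_def)
      have p_dvd: "p dvd q" if "root q" for q
      proof -
        have "q = q div p * p + q mod p" by simp
        then have "eval_hom to_ac \<alpha> q = eval_hom to_ac \<alpha> (q div p) * eval_hom to_ac \<alpha> p + eval_hom to_ac \<alpha> (q mod p)"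
          by (metis ev.add ev.mult)
        then have "root (q mod p)" using that p by (simp add: root_ev)
        then have "q mod p = 0" using p_min[of "q mod p"] degree_mod_less[OF p(1), of q] by fastforce
        then show ?thesis by (simp add: dvd_eq_mod_eq_0)
      qed
      have pdeg: "degree p > 0"
      proof (rule ccontr)
        assume "\<not> degree p > 0"
        then obtain c where "p = [:c:]" using degree_eq_zeroE by blast
        then show False using p by (simp add: root_def map_poly_pCons)
      qed
      obtain v where v: "v \<in> places Kxy"
        and vp: "\<And>q. q \<noteq> 0 \<Longrightarrow> v (cx q) \<ge> 0 \<and> (v (cx q) > 0 \<longleftrightarrow> root q)"
        unfolding root_def using exists_place_over[of \<alpha>] by blast
      have x: "v xcoord \<ge> 0" using vp[of "[:0,1:]"] by (simp add: xcoord_eq_cx)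
      have root_a: "root (a i)" if i: "i < n" for i
      proof (rule ccontr)
        assume nr: "\<not> root (a i)"
        then have ai: "a i \<noteq> 0" "v (cx (a i)) = 0" using vp[of "a i"] by (force simp: root_def)+
        have "cx (a i) * y ^ i / cx b \<in> at_least v 0"
        proof (rule monomial_at_least[OF b i v])
          fix u assume u: "u \<in> mu_n"
          show "(\<Sum>j<n. cx (a j) * y ^ j) / cx b \<in> at_least (conj_place u v) 0"
            unfolding hab[symmetric] by (rule int[OF conj_place[OF v u]]) (simp add: conj_place_x[OF u] x)
        qed
        then have le: "v (cx b) \<le> int i * v y"
          using ai b y_nonzero by (simp add: at_least_def val_divide[OF v] val_mult[OF v] val_power[OF v])
        moreover have vb: "v (cx b) > 0" using vp[OF b] \<alpha> by (simp add: root_def)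
        ultimately have "v y > 0" by (smt (verit) mult_nonneg_nonpos of_nat_0_le_iff)
        then have "v (cx f) > 0" using n_pos by (simp add: val_power[OF v] y_nonzero flip: y_power)
        then have "root f" using vp[OF f_nonzero] by simp
        then obtain r where r: "\<alpha> = to_ac r" "poly f r = 0" using root_in_field[of \<alpha>] by (auto simp: root_def)
        have "root [:-r, 1:]" by (simp add: root_def r map_poly_pCons)
        then have over: "lies_over v r" using vp[of "[:-r, 1:]"] by (simp add: lies_over_iff)
        note ram = fibre_ramified(3,4)[OF order_root_f[OF r(2)], of v]
        have vy: "v y = 1" "v (cx [:-r, 1:]) = int n" using ram v over by simp_all
        have "[:-r, 1:] dvd b"
        proof -
          have "to_ac (poly b r) = eval_hom to_ac (to_ac r) b"
            by (induction b) (simp_all add: ac.eval_hom_pCons, simp add: eval_hom_def)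
          then have "poly b r = 0" using \<alpha> r(1) by (simp add: eval_hom_def)
          then show ?thesis by (simp add: poly_eq_0_iff_dvd)
        qed
        then obtain c where c: "b = [:-r, 1:] * c" by blast
        then have "c \<noteq> 0" using b by auto
        then have "v (cx b) = int n + v (cx c)"
          unfolding c cx.mult by (subst val_mult[OF v]) (simp_all add: vy)
        moreover have "v (cx c) \<ge> 0" using vp[OF \<open>c \<noteq> 0\<close>] by simp
        ultimately show False using le vy i by simp
      qed
      have "p dvd b" using p_dvd[of b] \<alpha> by (simp add: root_def)
      then obtain b' where b': "b = p * b'" by blast
      then have b'0: "b' \<noteq> 0" using b by auto
      have d: "degree b' < degree b" using pdeg b'0 p(1) by (simp add: b' degree_mult_eq)
      have hb: "h = (\<Sum>j<n. cx (a j div p) * y ^ j) / cx b'"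
      proof -
        have "(\<Sum>j<n. cx (a j) * y ^ j) = cx p * (\<Sum>j<n. cx (a j div p) * y ^ j)"
          unfolding sum_distrib_left
        proof (rule sum.cong[OF refl])
          fix j assume "j \<in> {..<n}"
          then have "a j = p * (a j div p)" using p_dvd[OF root_a[of j]] by simp
          then have "cx (a j) = cx p * cx (a j div p)" by (metis cx.mult)
          then show "cx (a j) * y ^ j = cx p * (cx (a j div p) * y ^ j)" by (simp add: mult_ac)
        qed
        then show ?thesis using p(1) by (simp add: hab b' cx.mult)
      qed
      show ?thesis by (rule less.hyps[OF d b'0 hb])
    qed
  qed
  then show ?thesis using Kxy_normal_form[OF h] by metis
qed

lemma inf_facts:
  shows "card (inf_places Kxy) = n" "\<And>v. v \<in> inf_places Kxy \<Longrightarrow> place_degree Kxy v = 1"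
    "\<And>v. v \<in> inf_places Kxy \<Longrightarrow> v xcoord = -1" "\<And>v. v \<in> inf_places Kxy \<Longrightarrow> v y = - int e"
  using fibre_infinite[OF degree_f] lead_coeff_power by metis+

lemma inf_places_place: "v \<in> inf_places Kxy \<Longrightarrow> v \<in> places Kxy"
  by (simp add: inf_places_def)

lemma monomial_at_infinity:
  assumes v: "v \<in> inf_places Kxy" and p: "p \<noteq> 0"
  shows "v (cx p * y ^ j) = - int (degree p) - int j * int e"
proof -
  have vp: "v \<in> places Kxy" "v xcoord < 0" using v by (auto simp: inf_places_def)
  show ?thesis
    using p y_nonzero inf_facts(3,4)[OF v]
    by (simp add: val_mult[OF vp(1)] val_power[OF vp(1)] val_cx_infinite[OF vp])
qed

text \<open>
  The number of exponents \<open>i\<close> for which \<open>x ^ i * y ^ j\<close> has poles of order at most \<open>m\<close> at infinity, where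
  \<open>x\<close> and \<open>y\<close> have poles of orders \<open>1\<close> and \<open>e\<close>.
\<close>

definition pole_bound :: "int \<Rightarrow> nat \<Rightarrow> nat" where
  "pole_bound m j = nat (m + 1 - int j * int e)"

lemma in_polys_below_pole_bound:
  "p \<in> polys_below (pole_bound m j) \<longleftrightarrow> p = 0 \<or> int (degree p) + int j * int e \<le> m"
  unfolding polys_below_iff pole_bound_def by linarith

lemma RR_space_D_inf: "RR_space Kxy (\<lambda>v. s * D_inf Kxy v) = normal_span (pole_bound s)"
proof (intro equalityI subsetI)
  fix h assume "h \<in> RR_space Kxy (\<lambda>v. s * D_inf Kxy v)"
  then have h: "h \<in> Kxy" and poles: "\<And>v. v \<in> places Kxy \<Longrightarrow> h \<in> at_least v (- s * D_inf Kxy v)"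
    by (force simp: RR_space_def at_least_def)+
  have "h \<in> at_least v 0" if v: "v \<in> places Kxy" "v xcoord \<ge> 0" for v
    using poles[OF v(1)] v by (simp add: D_inf_def reduced_divisor_def inf_places_def)
  then obtain a where a: "h = (\<Sum>j<n. cx (a j) * y ^ j)"
    using integral_imp_polynomial[OF h] by blast
  have "a i \<in> polys_below (pole_bound s i)" if i: "i < n" for i
  proof -
    obtain v where v: "v \<in> inf_places Kxy" using inf_facts(1) n_pos by fastforce
    have vp: "v \<in> places Kxy" by (rule inf_places_place[OF v])
    have "cx (a i) * y ^ i / cx 1 \<in> at_least v (- s)"
    proof (rule monomial_at_least[OF _ i vp])
      fix u assume u: "u \<in> mu_n"
      have "conj_place u v \<in> inf_places Kxy"
        using conj_place[OF vp u] conj_place_x[OF u, of v] v by (simp add: inf_places_def)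
      then have "h \<in> at_least (conj_place u v) (- s)"
        using poles[OF conj_place[OF vp u]] by (simp add: D_inf_def reduced_divisor_def)
      then show "(\<Sum>j<n. cx (a j) * y ^ j) / cx 1 \<in> at_least (conj_place u v) (- s)" by (simp add: a)
    qed simp
    then show ?thesis
      using monomial_at_infinity[OF v, of "a i" i] y_nonzero
      by (cases "a i = 0") (auto simp: at_least_def in_polys_below_pole_bound)
  qed
  then show "h \<in> normal_span (pole_bound s)" by (auto simp: normal_span_def a)
next
  fix h assume "h \<in> normal_span (pole_bound s)"
  then obtain a where a: "h = (\<Sum>j<n. cx (a j) * y ^ j)" "\<And>j. j < n \<Longrightarrow> a j \<in> polys_below (pole_bound s j)"
    by (auto simp: normal_span_def)
  have h: "h \<in> Kxy" by (simp add: a(1))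
  have "h \<in> at_least v (- s * D_inf Kxy v)" if v: "v \<in> places Kxy" for v
  proof (cases "v \<in> inf_places Kxy")
    case True
    have "h \<in> at_least v (- s)" unfolding a(1)
    proof (rule at_least_sum[OF v])
      fix j assume "j \<in> {..<n}"
      then show "cx (a j) * y ^ j \<in> at_least v (- s)"
        using a(2)[of j] monomial_at_infinity[OF True, of "a j" j]
        by (cases "a j = 0") (auto simp: at_least_def in_polys_below_pole_bound)
    qed
    then show ?thesis using True by (simp add: D_inf_def reduced_divisor_def)
  next
    case False
    then have x: "v xcoord \<ge> 0" using v by (auto simp: inf_places_def)
    have "h \<in> at_least v (0 + 0)" unfolding a(1)
    proof (intro at_least_sum[OF v] at_least_mult[OF v] cx_at_least[OF v x])
      fix j show "y ^ j \<in> at_least v 0"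
        using y_at_least[OF v x] y_nonzero by (auto simp: at_least_def val_power[OF v])
    qed
    then show ?thesis using False by (simp add: D_inf_def reduced_divisor_def)
  qed
  then show "h \<in> RR_space Kxy (\<lambda>v. s * D_inf Kxy v)"
    using h by (force simp: RR_space_def at_least_def)
qed

lemma sum_pole_bound:
  assumes "m \<ge> int ((n - 1) * e) - 1"
  shows "2 * int (\<Sum>j<n. pole_bound m j) = 2 * int n * (m + 1) - int e * int n * (int n - 1)"
proof -
  have "int (pole_bound m j) = m + 1 - int j * int e" if "j < n" for j
  proof -
    have "j * e \<le> (n - 1) * e" using that by (intro mult_right_mono) auto
    then have "int j * int e \<le> int ((n - 1) * e)" by (metis of_nat_le_iff of_nat_mult)
    then show ?thesis using assms by (simp add: pole_bound_def)
  qed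
  then have "int (\<Sum>j<n. pole_bound m j) = (\<Sum>j<n. m + 1 - int j * int e)" by simp
  also have "2 * \<dots> = 2 * int n * (m + 1) - int e * int n * (int n - 1)"
    by (induction n) (simp_all add: algebra_simps)
  finally show ?thesis .
qed

end

section \<open>The genus\<close>

context const_field
begin

lemma RR_space_iff: "h \<in> RR_space F G \<longleftrightarrow> h \<in> F \<and> (\<forall>v\<in>places F. h \<in> at_least v (- G v))"
  by (auto simp: RR_space_def at_least_def) (force+)?

lemma is_csubspace_RR_space: "is_csubspace (RR_space F G)"
  by (auto simp: is_csubspace_def RR_space_iff intro: at_least_add at_least_scale)

lemma RR_space_mono: "(\<And>v. v \<in> places F \<Longrightarrow> G v \<le> H v) \<Longrightarrow> RR_space F G \<subseteq> RR_space F H"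
  unfolding RR_space_def by (blast intro: order_trans add_left_mono dest: le_imp_neg_le)

end

context kummer_finite
begin

text \<open>
  An independent set of maximal size spans the residue field.
\<close>

lemma residue_in_span:
  assumes v: "v \<in> places Kxy" and B: "independent_mod v B" "card B = place_degree Kxy v"
    and w: "w \<in> at_least v 0"
  shows "\<exists>c. w - (\<Sum>b\<in>B. cst (c b) * b) \<in> at_least v 1"
proof (rule ccontr)
  assume neg: "\<not> ?thesis"
  have Bf: "finite B" "B \<subseteq> at_least v 0" and
    Bi: "\<And>u. (\<Sum>b\<in>B. cst (u b) * b) \<in> at_least v 1 \<Longrightarrow> (\<forall>b\<in>B. u b = 0)"
    using B(1) by (auto simp: independent_mod_def valuation_ring_eq valuation_ideal_eq)
  have wB: "w \<notin> B"
  proof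
    assume "w \<in> B"
    have "(\<Sum>b\<in>B. cst (if b = w then 1 else 0) * b) = (\<Sum>b\<in>B. if b = w then w else 0)"
      by (rule sum.cong) auto
    also have "\<dots> = w" using \<open>w \<in> B\<close> Bf(1) by simp
    finally have "w - (\<Sum>b\<in>B. cst (if b = w then 1 else 0) * b) \<in> at_least v 1" using v by simp
    then have "\<exists>c. w - (\<Sum>b\<in>B. cst (c b) * b) \<in> at_least v 1"
      by (rule exI[where x = "\<lambda>b. if b = w then 1 else 0"])
    with neg show False by contradiction
  qed
  have "independent_mod v (insert w B)"
    unfolding independent_mod_def valuation_ring_eq valuation_ideal_eq
  proof (intro conjI allI impI)
    show "finite (insert w B)" "insert w B \<subseteq> at_least v 0" using Bf w by auto
    fix u assume "(\<Sum>b\<in>insert w B. cst (u b) * b) \<in> at_least v 1"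
    then have *: "cst (u w) * w + (\<Sum>b\<in>B. cst (u b) * b) \<in> at_least v 1" using wB Bf by simp
    have uw: "u w = 0"
    proof (rule ccontr)
      assume nz: "u w \<noteq> 0"
      have "cst (inverse (u w)) * (cst (u w) * w + (\<Sum>b\<in>B. cst (u b) * b)) \<in> at_least v 1"
        by (rule at_least_scale[OF v *])
      moreover have "cst (inverse (u w)) * (cst (u w) * w + (\<Sum>b\<in>B. cst (u b) * b))
        = cst (inverse (u w) * u w) * w + (\<Sum>b\<in>B. cst (inverse (u w) * u b) * b)"
        by (simp add: distrib_left sum_distrib_left cst.mult mult.assoc)
      moreover have "\<dots> = w - (\<Sum>b\<in>B. cst (- (inverse (u w) * u b)) * b)"
        using nz by (simp add: cst.uminus sum_negf)
      ultimately show False using neg by auto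
    qed
    then have "(\<Sum>b\<in>B. cst (u b) * b) \<in> at_least v 1" using * by simp
    with uw Bi show "\<forall>b\<in>insert w B. u b = 0" by auto
  qed
  from place_degree_props(2)[OF v this] show False using B(2) wB Bf(1) by simp
qed

text \<open>
  Multiplication by an element of order \<open>G v\<close> at \<open>v\<close> maps the space to the residue field at \<open>v\<close>, with
  kernel \<open>L(G - v)\<close>.  An element \<open>h\<close> is recovered from its residue and its difference to a chosen element
  with that residue.
\<close>

lemma card_RR_space_step:
  assumes v: "v \<in> places Kxy" and fin: "finite (RR_space Kxy G)"
  shows "card (RR_space Kxy G) \<le> card (RR_space Kxy (G(v := G v - 1))) * CARD('k) ^ place_degree Kxy v"
proof -
  obtain B where B: "independent_mod v B" "card B = place_degree Kxy v"
    using place_degree_props(1)[OF v] by blast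
  have finB: "finite B" using B(1) by (simp add: independent_mod_def)
  obtain t where t: "t \<in> Kxy" "t \<noteq> 0" "v t = G v" using val_surj[OF v] by blast
  define L where "L = RR_space Kxy G"
  define L' where "L' = RR_space Kxy (G(v := G v - 1))"
  note Lsub = is_csubspaceD[OF is_csubspace_RR_space[of G]]
  have "\<forall>h\<in>L. \<exists>c. c \<in> B \<rightarrow>\<^sub>E (UNIV :: 'k set) \<and> t * h - (\<Sum>b\<in>B. cst (c b) * b) \<in> at_least v 1"
  proof
    fix h assume h: "h \<in> L"
    have "t \<in> at_least v (G v)" using t by (simp add: at_least_def)
    moreover have "h \<in> at_least v (- G v)" using h v by (simp add: L_def RR_space_iff)
    ultimately have "t * h \<in> at_least v 0" using at_least_mult[OF v] by fastforce
    then obtain c where "t * h - (\<Sum>b\<in>B. cst (c b) * b) \<in> at_least v 1"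
      using residue_in_span[OF v B] by blast
    then show "\<exists>c. c \<in> B \<rightarrow>\<^sub>E (UNIV :: 'k set) \<and> t * h - (\<Sum>b\<in>B. cst (c b) * b) \<in> at_least v 1"
      by (intro exI[of _ "restrict c B"]) auto
  qed
  from bchoice[OF this] obtain \<gamma> where *: "\<forall>h\<in>L. \<gamma> h \<in> B \<rightarrow>\<^sub>E (UNIV :: 'k set) \<and>
     t * h - (\<Sum>b\<in>B. cst (\<gamma> h b) * b) \<in> at_least v 1" by (rule exE)
  then have \<gamma>: "\<And>h. h \<in> L \<Longrightarrow> \<gamma> h \<in> B \<rightarrow>\<^sub>E (UNIV :: 'k set)"
     "\<And>h. h \<in> L \<Longrightarrow> t * h - (\<Sum>b\<in>B. cst (\<gamma> h b) * b) \<in> at_least v 1" by simp_all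
  define r where "r c = (SOME h. h \<in> L \<and> \<gamma> h = c)" for c
  have r: "r (\<gamma> h) \<in> L \<and> \<gamma> (r (\<gamma> h)) = \<gamma> h" if "h \<in> L" for h
    unfolding r_def by (rule someI[of _ h]) (use that in simp)
  have diff: "h - r (\<gamma> h) \<in> L'" if h: "h \<in> L" for h
  proof -
    define d where "d = h - r (\<gamma> h)"
    have dL: "d \<in> L" using Lsub(5) h r[OF h] by (simp add: d_def L_def)
    have "(t * h - (\<Sum>b\<in>B. cst (\<gamma> h b) * b)) - (t * r (\<gamma> h) - (\<Sum>b\<in>B. cst (\<gamma> (r (\<gamma> h)) b) * b)) \<in> at_least v 1"
      by (rule at_least_diff[OF v \<gamma>(2)[OF h] \<gamma>(2)]) (use r[OF h] in simp)
    then have td: "t * d \<in> at_least v 1" using r[OF h] by (simp add: d_def right_diff_distrib)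
    have "d \<in> Kxy" using dL by (simp add: L_def RR_space_iff)
    then have "d \<in> at_least v (1 - G v)"
      using td t by (cases "d = 0") (auto simp: at_least_def val_mult[OF v])
    then show ?thesis using dL unfolding d_def[symmetric] L_def L'_def RR_space_iff by auto
  qed
  have "card L \<le> card ((B \<rightarrow>\<^sub>E (UNIV :: 'k set)) \<times> L')"
  proof (rule card_inj_on_le[where f = "\<lambda>h. (\<gamma> h, h - r (\<gamma> h))"])
    show "inj_on (\<lambda>h. (\<gamma> h, h - r (\<gamma> h))) L" by (rule inj_onI) auto
    show "(\<lambda>h. (\<gamma> h, h - r (\<gamma> h))) ` L \<subseteq> (B \<rightarrow>\<^sub>E UNIV) \<times> L'" using \<gamma>(1) diff by auto
    have "L' \<subseteq> L" unfolding L_def L'_def by (rule RR_space_mono) auto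
    then have "finite L'" using fin finite_subset by (auto simp: L_def)
    then show "finite ((B \<rightarrow>\<^sub>E (UNIV :: 'k set)) \<times> L')" using finB by (simp add: finite_PiE)
  qed
  also have "\<dots> = card L' * CARD('k) ^ place_degree Kxy v"
    using finB by (simp add: card_cartesian_product card_PiE B(2))
  finally show ?thesis by (simp add: L_def L'_def)
qed

lemma card_RR_space_le:
  fixes N :: "'k place \<Rightarrow> nat"
  assumes T: "finite T" "T \<subseteq> places Kxy" and N: "\<And>v. v \<notin> T \<Longrightarrow> N v = 0"
    and fin: "finite (RR_space Kxy G)"
  shows "card (RR_space Kxy G) \<le> card (RR_space Kxy (\<lambda>v. G v - int (N v))) * CARD('k) ^ (\<Sum>v\<in>T. N v * place_degree Kxy v)"
  using N
proof (induction "\<Sum>v\<in>T. N v" arbitrary: N)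
  case 0
  then have "N v = 0" for v using T by (cases "v \<in> T") auto
  then show ?case by simp
next
  case (Suc k)
  obtain v where v: "v \<in> T" "N v > 0"
    using Suc.hyps(2) by (metis gr0I sum.neutral nat.distinct(1))
  have vp: "v \<in> places Kxy" using v T by auto
  define M where "M = N(v := N v - 1)"
  have split: "(\<Sum>v\<in>T. N v * g v) = (\<Sum>v\<in>T. M v * g v) + g v" for g :: "'k place \<Rightarrow> nat"
    unfolding M_def by (rule sum_decrement) (use T v in auto)
  define G' where "G' = (\<lambda>v. G v - int (M v))"
  have "k = (\<Sum>v\<in>T. M v)" using split[of "\<lambda>_. 1"] Suc.hyps(2) by simp
  then have IH: "card (RR_space Kxy G) \<le> card (RR_space Kxy G') * CARD('k) ^ (\<Sum>v\<in>T. M v * place_degree Kxy v)"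
    unfolding G'_def by (rule Suc.hyps(1)) (use Suc.prems v in \<open>auto simp: M_def\<close>)
  have "RR_space Kxy G' \<subseteq> RR_space Kxy G" by (rule RR_space_mono) (simp add: G'_def)
  then have "finite (RR_space Kxy G')" using fin finite_subset by blast
  from card_RR_space_step[OF vp this]
  have "card (RR_space Kxy G') \<le> card (RR_space Kxy (G'(v := G' v - 1))) * CARD('k) ^ place_degree Kxy v" .
  also have "G'(v := G' v - 1) = (\<lambda>v. G v - int (N v))"
  proof
    fix w show "(G'(v := G' v - 1)) w = G w - int (N w)"
      using v(2) by (cases "w = v") (simp_all add: G'_def M_def of_nat_diff)
  qed
  finally have "card (RR_space Kxy G) \<le> card (RR_space Kxy (\<lambda>v. G v - int (N v))) * CARD('k) ^ place_degree Kxy v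
     * CARD('k) ^ (\<Sum>v\<in>T. M v * place_degree Kxy v)"
    using IH mult_right_mono le_trans by blast
  also have "\<dots> = card (RR_space Kxy (\<lambda>v. G v - int (N v))) * CARD('k) ^ (\<Sum>v\<in>T. N v * place_degree Kxy v)"
    by (simp add: split power_add mult_ac)
  finally show ?case .
qed

lemma RR_dim_eq:
  assumes "finite (RR_space Kxy G)" "card (RR_space Kxy G) = CARD('k) ^ d"
  shows "RR_dim Kxy G = d"
  unfolding RR_dim_def by (rule dim_eq_of_card[OF is_csubspace_RR_space assms])

lemma card_RR_space_eq:
  assumes "finite (RR_space Kxy G)"
  shows "card (RR_space Kxy G) = CARD('k) ^ RR_dim Kxy G"
proof -
  interpret V: vector_space "\<lambda>c h. cst c * (h :: 'k cover)" by (rule vector_space_cover)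
  have "V.subspace (RR_space Kxy G)"
    using is_csubspace_RR_space[of G] by (auto simp: is_csubspace_def V.subspace_def)
  then show ?thesis unfolding RR_dim_def
    by (rule card_subspace_eq_power_dim[OF vector_space_cover _ assms])
qed

end

context split_kummer
begin

lemma card_RR_space_D_inf: "card (RR_space Kxy (\<lambda>v. s * D_inf Kxy v)) = CARD('k) ^ (\<Sum>j<n. pole_bound s j)"
   "finite (RR_space Kxy (\<lambda>v. s * D_inf Kxy v))"
  by (simp_all add: RR_space_D_inf card_normal_span)

lemma finite_inf_places [simp]: "finite (inf_places Kxy)"
  using inf_facts(1) n_pos card.infinite by fastforce

text \<open>
  The value of \<open>deg - dim + 1\<close> at the divisor \<open>n e D_inf\<close>; every larger multiple of \<open>D_inf\<close> gives the same
  value.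
\<close>

definition genus_value :: int where
  "genus_value = int n * int (n * e) - int (\<Sum>j<n. pole_bound (int (n * e)) j) + 1"

lemma genus_value_eq:
  assumes "m \<ge> int ((n - 1) * e)"
  shows "int n * m - int (\<Sum>j<n. pole_bound m j) + 1 = genus_value"
    and "2 * genus_value = (int n - 1) * (int (n * e) - 2)"
proof -
  have "(n - 1) * e \<le> n * e" by (rule mult_right_mono) auto
  then have "int (n * e) \<ge> int ((n - 1) * e) - 1" by linarith
  note 1 = sum_pole_bound[OF this]
  then show 2: "2 * genus_value = (int n - 1) * (int (n * e) - 2)"
    unfolding genus_value_def by (simp add: algebra_simps)
  have "m \<ge> int ((n - 1) * e) - 1" using assms by simp
  from sum_pole_bound[OF this]
  have "2 * (int n * m - int (\<Sum>j<n. pole_bound m j) + 1) = (int n - 1) * (int (n * e) - 2)"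
    by (simp add: algebra_simps)
  then have "2 * (int n * m - int (\<Sum>j<n. pole_bound m j) + 1) = 2 * genus_value" by (simp only: 2)
  then show "int n * m - int (\<Sum>j<n. pole_bound m j) + 1 = genus_value" by (simp only: mult_cancel_left) simp
qed

text \<open>
  Choose \<open>z\<close> and \<open>m\<close> such that \<open>D = m D_inf + div z - A\<close> is effective.  Multiplication by \<open>z\<close> identifies
  \<open>L(A)\<close> with \<open>L(m D_inf - D)\<close>, of codimension at most \<open>deg D\<close> in \<open>L(m D_inf)\<close>.  As \<open>z\<close> is a polynomial of
  \<open>x\<close>, its poles have total degree \<open>n * degree z\<close> and its zeros no more, so \<open>deg D \<le> n m - deg A\<close>.
\<close>

lemma Riemann_bound:
  assumes A: "A \<in> divisors Kxy"
  shows "div_degree Kxy A - int (RR_dim Kxy A) + 1 \<le> genus_value"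
proof -
  define S where "S = {v. A v \<noteq> 0}"
  have S: "finite S" "S \<subseteq> places Kxy" using A by (auto simp: divisors_def S_def)
  define S0 where "S0 = {v \<in> S. v xcoord \<ge> 0}"
  have finS0: "finite S0" using S by (simp add: S0_def)
  have "\<forall>v\<in>S0. \<exists>p. p \<noteq> 0 \<and> v (cx p) > 0"
    using exists_vanishing_poly S by (auto simp: S0_def)
  from bchoice[OF this] obtain p where p: "\<And>v. v \<in> S0 \<Longrightarrow> p v \<noteq> 0 \<and> v (cx (p v)) > 0" by blast
  define z where "z = (\<Prod>v\<in>S0. p v ^ nat \<bar>A v\<bar>)"
  have z0: "z \<noteq> 0" using p finS0 by (simp add: z_def)
  have nonneg: "v (cx q) \<ge> 0" if "v \<in> places Kxy" "v xcoord \<ge> 0" for v q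
    using cx_at_least[OF that, of q] val_0[OF that(1)] by (auto simp: at_least_def)
  have vz: "v (cx z) \<ge> \<bar>A v\<bar>" if v: "v \<in> S0" for v
  proof -
    have vp: "v \<in> places Kxy" "v xcoord \<ge> 0" using v S by (auto simp: S0_def)
    have "z = p v ^ nat \<bar>A v\<bar> * (\<Prod>v\<in>S0 - {v}. p v ^ nat \<bar>A v\<bar>)"
      unfolding z_def by (rule prod.remove[OF finS0 v])
    then obtain q where q: "z = p v ^ nat \<bar>A v\<bar> * q" by blast
    have "q \<noteq> 0" using q z0 by auto
    then have "v (cx z) = \<bar>A v\<bar> * v (cx (p v)) + v (cx q)"
      using p[OF v] by (simp add: q cx.mult cx.power val_mult[OF vp(1)] val_power[OF vp(1)])
    moreover have "\<bar>A v\<bar> * v (cx (p v)) \<ge> \<bar>A v\<bar> * 1" using p[OF v] by (intro mult_left_mono) auto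
    ultimately show ?thesis using nonneg[OF vp, of q] by linarith
  qed
  define m where "m = degree z + (\<Sum>v\<in>S. nat \<bar>A v\<bar>) + (n - 1) * e"
  have mA: "int m \<ge> int (degree z) + \<bar>A v\<bar>" for v
  proof (cases "v \<in> S")
    case True
    then have "nat \<bar>A v\<bar> \<le> (\<Sum>v\<in>S. nat \<bar>A v\<bar>)" using S by (intro member_le_sum) auto
    then show ?thesis unfolding m_def by linarith
  next
    case False
    then show ?thesis by (simp add: m_def S_def)
  qed
  define D where "D v = int m * D_inf Kxy v + v (cx z) - A v" for v
  define Z where "Z = {v \<in> places Kxy. v (cx z) > 0}"
  have finZ: "finite Z"
    using card_zeros_le(1)[of z 1 "degree z"] z0 by (simp add: Z_def)
  define T where "T = S \<union> inf_places Kxy \<union> Z"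
  have T: "finite T" "T \<subseteq> places Kxy"
    using S finZ finite_inf_places unfolding T_def by (auto simp: Z_def intro: inf_places_place)
  have Dinf: "D_inf Kxy v = (if v \<in> inf_places Kxy then 1 else 0)" for v
    by (simp add: D_inf_def reduced_divisor_def)
  have D0: "D v \<ge> 0" if v: "v \<in> places Kxy" for v
  proof (cases "v \<in> inf_places Kxy")
    case True
    then have "v (cx z) = - int (degree z)"
      using val_cx_infinite[OF v _ z0] inf_facts(3)[OF True] by (simp add: inf_places_def)
    then show ?thesis using mA[of v] True by (simp add: D_def Dinf)
  next
    case False
    then have x: "v xcoord \<ge> 0" using v by (auto simp: inf_places_def)
    show ?thesis
    proof (cases "v \<in> S")
      case True
      then show ?thesis using vz[of v] x False by (simp add: D_def Dinf S0_def)
    next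
      case outside: False
      then show ?thesis using nonneg[OF v x, of z] False by (simp add: D_def Dinf S_def)
    qed
  qed
  have Dout: "D v = 0" if "v \<in> places Kxy" "v \<notin> T" for v
  proof -
    have "v \<notin> inf_places Kxy" "v \<notin> S" "v \<notin> Z" using that by (auto simp: T_def)
    then have "v xcoord \<ge> 0" "A v = 0" "\<not> v (cx z) > 0" using that by (auto simp: inf_places_def S_def Z_def)
    then show ?thesis using nonneg[OF that(1), of z] \<open>v \<notin> inf_places Kxy\<close> by (simp add: D_def Dinf)
  qed
  define N where "N v = (if v \<in> T then nat (D v) else 0)" for v
  have ND: "int (N v) = D v" if "v \<in> places Kxy" for v
    using that D0 Dout by (simp add: N_def)
  define G where "G = (\<lambda>v. int m * D_inf Kxy v)"
  have le: "card (RR_space Kxy G) \<le> card (RR_space Kxy (\<lambda>v. G v - int (N v))) * CARD('k) ^ (\<Sum>v\<in>T. N v * place_degree Kxy v)"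
    by (rule card_RR_space_le[OF T]) (simp_all add: N_def G_def card_RR_space_D_inf)
  have bij: "bij_betw (\<lambda>h. cx z * h) (RR_space Kxy A) (RR_space Kxy (\<lambda>v. G v - int (N v)))"
  proof (rule bij_betwI[where g = "\<lambda>h. h / cx z"])
    have iff: "cx z * h \<in> RR_space Kxy (\<lambda>v. G v - int (N v)) \<longleftrightarrow> h \<in> RR_space Kxy A" if h: "h \<in> Kxy" for h
    proof (cases "h = 0")
      case False
      have "v (cx z * h) + (G v - int (N v)) = v h + A v" if v: "v \<in> places Kxy" for v
        using h False z0 by (simp add: val_mult[OF v] ND[OF v] G_def D_def)
      then show ?thesis using h False z0 by (simp add: RR_space_def)
    qed (simp add: RR_space_def)
    show "(\<lambda>h. cx z * h) \<in> RR_space Kxy A \<rightarrow> RR_space Kxy (\<lambda>v. G v - int (N v))"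
      using iff by (auto simp: RR_space_def[of _ A])
    show "(\<lambda>h. h / cx z) \<in> RR_space Kxy (\<lambda>v. G v - int (N v)) \<rightarrow> RR_space Kxy A"
    proof
      fix h assume h: "h \<in> RR_space Kxy (\<lambda>v. G v - int (N v))"
      then have "h \<in> Kxy" by (simp add: RR_space_def)
      then show "h / cx z \<in> RR_space Kxy A" using iff[of "h / cx z"] h z0 by simp
    qed
  qed (use z0 in auto)
  have "RR_space Kxy (\<lambda>v. G v - int (N v)) \<subseteq> RR_space Kxy G" by (rule RR_space_mono) simp
  then have "finite (RR_space Kxy (\<lambda>v. G v - int (N v)))"
    using card_RR_space_D_inf(2) finite_subset unfolding G_def by blast
  then have "finite (RR_space Kxy A)" using bij bij_betw_finite by blast
  then have "card (RR_space Kxy (\<lambda>v. G v - int (N v))) = CARD('k) ^ RR_dim Kxy A"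
    using bij_betw_same_card[OF bij] card_RR_space_eq by simp
  with le have "CARD('k) ^ (\<Sum>j<n. pole_bound (int m) j) \<le> CARD('k) ^ (RR_dim Kxy A + (\<Sum>v\<in>T. N v * place_degree Kxy v))"
    by (simp add: G_def card_RR_space_D_inf power_add)
  moreover have "CARD('k) > 1" using card_mono[of UNIV "{0, 1 :: 'k}"] by simp
  ultimately have dim_le: "(\<Sum>j<n. pole_bound (int m) j) \<le> RR_dim Kxy A + (\<Sum>v\<in>T. N v * place_degree Kxy v)"
    by simp
  have "int (\<Sum>v\<in>T. N v * place_degree Kxy v) = (\<Sum>v\<in>T. D v * int (place_degree Kxy v))"
    using T ND by (auto intro!: sum.cong)
  also have "\<dots> = (\<Sum>v\<in>T. int m * D_inf Kxy v * int (place_degree Kxy v))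
      + (\<Sum>v\<in>T. v (cx z) * int (place_degree Kxy v)) - (\<Sum>v\<in>T. A v * int (place_degree Kxy v))"
    by (simp add: D_def sum.distrib sum_subtractf algebra_simps)
  also have "(\<Sum>v\<in>T. int m * D_inf Kxy v * int (place_degree Kxy v)) = (\<Sum>v\<in>inf_places Kxy. int m)"
  proof (rule sum.mono_neutral_cong_right[OF T(1)])
    show "inf_places Kxy \<subseteq> T" by (auto simp: T_def)
  qed (auto simp: Dinf inf_facts(2))
  also have "\<dots> = int n * int m" by (simp add: inf_facts(1))
  also have "(\<Sum>v\<in>T. A v * int (place_degree Kxy v)) = div_degree Kxy A"
    unfolding div_degree_def by (rule sum.mono_neutral_right[OF T(1)]) (auto simp: T_def S_def)
  finally have degN: "int (\<Sum>v\<in>T. N v * place_degree Kxy v)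
     = int n * int m + (\<Sum>v\<in>T. v (cx z) * int (place_degree Kxy v)) - div_degree Kxy A" .
  have "(\<Sum>v\<in>T. v (cx z) * int (place_degree Kxy v)) \<le> 0"
  proof -
    have "(\<Sum>v\<in>T. v (cx z) * int (place_degree Kxy v))
       = (\<Sum>v\<in>inf_places Kxy. v (cx z) * int (place_degree Kxy v)) + (\<Sum>v\<in>T - inf_places Kxy. v (cx z) * int (place_degree Kxy v))"
      using T(1) by (subst sum.subset_diff[of "inf_places Kxy"]) (auto simp: T_def)
    also have "(\<Sum>v\<in>inf_places Kxy. v (cx z) * int (place_degree Kxy v)) = (\<Sum>v\<in>inf_places Kxy. - int (degree z))"
      by (rule sum.cong) (auto simp: inf_facts(2,3) inf_places_place val_cx_infinite z0)
    also have "\<dots> = - int (n * degree z)" by (simp add: inf_facts(1))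
    also have "(\<Sum>v\<in>T - inf_places Kxy. v (cx z) * int (place_degree Kxy v)) = (\<Sum>v\<in>Z - inf_places Kxy. v (cx z) * int (place_degree Kxy v))"
    proof (rule sum.mono_neutral_right)
      show "\<forall>v\<in>(T - inf_places Kxy) - (Z - inf_places Kxy). v (cx z) * int (place_degree Kxy v) = 0"
      proof
        fix v assume v: "v \<in> (T - inf_places Kxy) - (Z - inf_places Kxy)"
        then have "v \<in> places Kxy" "v xcoord \<ge> 0" "\<not> v (cx z) > 0" using T by (auto simp: inf_places_def Z_def)
        then have "v (cx z) = 0" using nonneg[of v z] by simp
        then show "v (cx z) * int (place_degree Kxy v) = 0" by simp
      qed
    qed (use T in \<open>auto simp: T_def\<close>)
    also have "\<dots> = int (\<Sum>v\<in>Z - inf_places Kxy. nat (v (cx z / cx 1)) * place_degree Kxy v)"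
      by (auto intro!: sum.cong simp: Z_def)
    also have "\<dots> \<le> int (n * degree z)"
    proof (subst of_nat_le_iff, rule zeros_bound)
      show "finite (Z - inf_places Kxy)" using finZ by simp
    qed (use z0 in \<open>auto simp: Z_def\<close>)
    finally show ?thesis by simp
  qed
  then have "int (\<Sum>v\<in>T. N v * place_degree Kxy v) \<le> int n * int m - div_degree Kxy A"
    using degN by simp
  moreover have "int (\<Sum>j<n. pole_bound (int m) j) \<le> int (RR_dim Kxy A) + int (\<Sum>v\<in>T. N v * place_degree Kxy v)"
    using dim_le by (simp only: of_nat_le_iff flip: of_nat_add)
  moreover have "int n * int m - int (\<Sum>j<n. pole_bound (int m) j) + 1 = genus_value"
    by (rule genus_value_eq(1)) (simp add: m_def)
  ultimately show ?thesis by linarith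
qed

lemma genus_eq: "genus Kxy = genus_value"
  unfolding genus_def
proof (rule Greatest_equality)
  define A where "A = (\<lambda>v. int (n * e) * D_inf Kxy v)"
  have supp: "A v = (if v \<in> inf_places Kxy then int (n * e) else 0)" for v
    by (simp add: A_def D_inf_def reduced_divisor_def)
  have "A \<in> divisors Kxy"
    unfolding divisors_def
    by (auto simp: supp inf_places_place split: if_splits intro: finite_subset[OF _ finite_inf_places])
  moreover have "div_degree Kxy A = int n * int (n * e)"
  proof -
    have "div_degree Kxy A = (\<Sum>v\<in>inf_places Kxy. A v * int (place_degree Kxy v))"
      unfolding div_degree_def by (rule sum.mono_neutral_left) (auto simp: supp)
    also have "\<dots> = (\<Sum>v\<in>inf_places Kxy. int (n * e))"
      by (rule sum.cong) (auto simp: supp inf_facts(2))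
    finally show ?thesis by (simp add: inf_facts(1))
  qed
  moreover have "RR_dim Kxy A = (\<Sum>j<n. pole_bound (int (n * e)) j)"
    unfolding A_def by (rule RR_dim_eq[OF card_RR_space_D_inf(2,1)])
  ultimately show "\<exists>A\<in>divisors Kxy. genus_value = div_degree Kxy A - int (RR_dim Kxy A) + 1"
    unfolding genus_value_def by metis
qed (use Riemann_bound in blast)

lemma genus_formula: "2 * genus Kxy = (int n - 1) * (int (n * e) - 2)"
  using genus_value_eq(2)[of "int (n * e)"] genus_eq by (simp add: mult_right_mono)

end

section \<open>Sums of polynomials over a finite field\<close>

lemma finite_field_power_card: "(x :: 'k::{field,finite}) \<noteq> 0 \<Longrightarrow> x ^ (CARD('k) - 1) = 1"
proof -
  assume x: "x \<noteq> 0"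
  have "(\<Prod>z\<in>UNIV - {0}. x * z) = (\<Prod>z\<in>UNIV - {0}. z)"
    by (rule prod.reindex_bij_witness[of _ "\<lambda>z. z / x" "\<lambda>z. x * z"]) (use x in auto)
  moreover have "(\<Prod>z\<in>UNIV - {0}. x * z) = x ^ (CARD('k) - 1) * (\<Prod>z\<in>UNIV - {0}. z)"
    by (simp add: prod.distrib)
  moreover have "(\<Prod>z\<in>UNIV - {0 :: 'k}. z) \<noteq> 0" by simp
  ultimately show ?thesis by simp
qed

lemma card_field_gt_1: "CARD('k::{field,finite}) > 1"
  using card_mono[of UNIV "{0, 1 :: 'k}"] by simp

text \<open>
  The translation by \<open>1\<close> permutes the field, so it does not change the sum of all elements.
\<close>

lemma of_nat_card_field: "of_nat CARD('k) = (0 :: 'k::{field,finite})"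
proof -
  have "(\<Sum>x\<in>UNIV. x + 1) = (\<Sum>x\<in>UNIV. x :: 'k)"
    by (rule sum.reindex_bij_witness[of _ "\<lambda>x. x - 1" "\<lambda>x. x + 1"]) auto
  then show ?thesis by (simp add: sum.distrib)
qed

lemma power_sum_field:
  assumes k: "k < CARD('k)"
  shows "(\<Sum>x\<in>UNIV. x ^ k) = (if k = CARD('k) - 1 then - 1 else (0 :: 'k::{field,finite}))"
proof (cases "k = 0")
  case True
  have "of_nat CARD('k) = (0 :: 'k)"
    by (rule of_nat_card_field)
  then show ?thesis using True card_field_gt_1[where 'k = 'k] by simp
next
  case False
  have eq: "{u :: 'k. u ^ (CARD('k) - 1) = 1} = UNIV - {0}"
    using finite_field_power_card card_field_gt_1[where 'k = 'k] by (auto simp: power_0_left)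
  have "(\<Sum>x\<in>UNIV. x ^ k) = (\<Sum>x\<in>UNIV - {0 :: 'k}. x ^ k)"
    using False by (intro sum.mono_neutral_right) auto
  also have "\<dots> = (if CARD('k) - 1 dvd k then of_nat (CARD('k) - 1) else 0)"
    unfolding eq[symmetric]
    by (rule sum_roots_of_unity_power) (use eq card_field_gt_1[where 'k = 'k] in \<open>auto simp: card_Diff_singleton\<close>)
  also have "CARD('k) - 1 dvd k \<longleftrightarrow> k = CARD('k) - 1"
    using k False by (auto dest: dvd_imp_le)
  also have "of_nat (CARD('k) - 1) = (- 1 :: 'k)"
    using card_field_gt_1[where 'k = 'k] of_nat_card_field[where 'k = 'k] by (simp add: of_nat_diff)
  finally show ?thesis by simp
qed

lemma poly_sum_field:
  fixes p :: "'k::{field,finite} poly"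
  assumes "p \<in> polys_below CARD('k)"
  shows "(\<Sum>x\<in>UNIV. poly p x) = - coeff p (CARD('k) - 1)"
proof -
  define q where "q = CARD('k)"
  have q: "q > 0" using card_field_gt_1[where 'k = 'k] by (simp add: q_def)
  have "p = (\<Sum>i<q. monom (coeff p i) i)"
    by (rule poly_as_sum_below) (use assms in \<open>simp add: polys_below_def q_def\<close>)
  then have "poly p x = (\<Sum>i<q. coeff p i * x ^ i)" for x
    by (metis (no_types, lifting) poly_monom poly_sum sum.cong)
  then have "(\<Sum>x\<in>UNIV. poly p x) = (\<Sum>i<q. coeff p i * (\<Sum>x\<in>UNIV. x ^ i))"
    by (simp add: sum.swap[of _ UNIV] sum_distrib_left)
  also have "\<dots> = (\<Sum>i<q. if i = q - 1 then - coeff p i else 0)"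
    by (rule sum.cong) (auto simp: power_sum_field q_def)
  also have "\<dots> = - coeff p (q - 1)" using q by simp
  finally show ?thesis by (simp add: q_def)
qed

section \<open>The codes and their hulls\<close>

context split_kummer
begin

definition nonroots :: "'k set" where "nonroots = {a. poly f a \<noteq> 0}"

lemma card_roots: "card {a. poly f a = 0} = n * e"
proof -
  have "degree f = degree (\<Prod>a | poly f a = 0. [:- a, 1:])"
    using f_splits f_nonzero by (metis degree_smult_eq leading_coeff_0_iff)
  also have "\<dots> = card {a. poly f a = 0}"
    by (subst degree_prod_eq_sum_degree) auto
  finally show ?thesis using degree_f by simp
qed

lemma card_nonroots: "card nonroots = CARD('k) - n * e" and degree_le_card: "n * e \<le> CARD('k)"
proof -
  have "nonroots = UNIV - {a. poly f a = 0}" by (auto simp: nonroots_def)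
  then show "card nonroots = CARD('k) - n * e" by (simp add: card_Diff_subset card_roots)
  show "n * e \<le> CARD('k)" using card_mono[of UNIV "{a. poly f a = 0}"] card_roots by simp
qed

abbreviation evals :: "'k place set" where "evals \<equiv> eval_places f Kxy"

lemma evals_eq: "evals = {v \<in> places Kxy. \<exists>a\<in>nonroots. lies_over v a}"
proof (intro equalityI subsetI)
  fix v assume "v \<in> evals"
  then show "v \<in> {v \<in> places Kxy. \<exists>a\<in>nonroots. lies_over v a}"
    by (auto simp: eval_places_def rational_places_def ram_places_def nonroots_def)
next
  fix v assume "v \<in> {v \<in> places Kxy. \<exists>a\<in>nonroots. lies_over v a}"
  then obtain a where v: "v \<in> places Kxy" "lies_over v a" "poly f a \<noteq> 0" by (auto simp: nonroots_def)
  obtain b where b: "poly f a = b ^ n" using f_power[of a] by metis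
  then have "b \<noteq> 0" using v n_pos by (auto simp: power_0_left)
  then have "place_degree Kxy v = 1" using fibre_unramified(2)[OF b] v by simp
  moreover have "v \<notin> ram_places f Kxy"
  proof
    assume "v \<in> ram_places f Kxy"
    then obtain a' where "poly f a' = 0" "lies_over v a'" by (auto simp: ram_places_def)
    with lies_over_unique[OF v(1,2)] v(3) show False by blast
  qed
  ultimately show "v \<in> evals" using v by (auto simp: eval_places_def rational_places_def)
qed

definition points :: "('k \<times> 'k) set" where "points = (SIGMA a:nonroots. {b. b ^ n = poly f a})"

text \<open>
  The values of \<open>x\<close> and \<open>y\<close> at a place; by \<open>bij_point\<close> the evaluation places are the affine points with
  \<open>y \<noteq> 0\<close>.
\<close>

definition point :: "'k place \<Rightarrow> 'k \<times> 'k" where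
  "point v = (THE (a, b). lies_over v a \<and> residue_is v y b)"

lemma point_eq:
  assumes v: "v \<in> places Kxy" "lies_over v a" "residue_is v y b"
  shows "point v = (a, b)"
  unfolding point_def
proof (rule the_equality)
  fix x assume "case x of (a, b) \<Rightarrow> lies_over v a \<and> residue_is v y b"
  then show "x = (a, b)" using lies_over_unique[OF v(1)] residue_unique[OF v(1)] v by (cases x) blast
qed (use v in simp)

lemma evals_point:
  assumes "v \<in> evals"
  shows "v \<in> places Kxy" "lies_over v (fst (point v))" "residue_is v y (snd (point v))" "point v \<in> points"
proof -
  obtain a where v: "v \<in> places Kxy" "lies_over v a" "poly f a \<noteq> 0"
    using assms by (auto simp: evals_eq nonroots_def)
  obtain b where b: "poly f a = b ^ n" using f_power[of a] by metis
  then have "b \<noteq> 0" using v n_pos by (auto simp: power_0_left)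
  then obtain b' where b': "b' ^ n = poly f a" "residue_is v y b'"
    using fibre_unramified(4)[OF b] v by blast
  have pt: "point v = (a, b')" by (rule point_eq[OF v(1,2) b'(2)])
  show "v \<in> places Kxy" "lies_over v (fst (point v))" "residue_is v y (snd (point v))" "point v \<in> points"
    using v b' by (simp_all add: pt points_def nonroots_def)
qed

lemma bij_point: "bij_betw point evals points"
proof (rule bij_betw_imageI)
  show "point ` evals = points"
  proof (intro equalityI subsetI)
    fix z assume "z \<in> points"
    then obtain a b where z: "z = (a, b)" "poly f a \<noteq> 0" "b ^ n = poly f a"
      by (auto simp: points_def nonroots_def)
    then have b: "poly f a = b ^ n" "b \<noteq> 0" using n_pos by (auto simp: power_0_left)
    obtain v where v: "v \<in> places Kxy" "lies_over v a" "residue_is v y b"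
      using fibre_unramified(3)[OF b z(3)] by blast
    then have "v \<in> evals" using z by (auto simp: evals_eq nonroots_def)
    then show "z \<in> point ` evals" using point_eq[OF v] z by (intro image_eqI[of _ _ v]) auto
  qed (use evals_point in auto)
  show "inj_on point evals"
  proof (rule inj_onI)
    fix v w assume vw: "v \<in> evals" "w \<in> evals" "point v = point w"
    obtain a b where ab: "point v = (a, b)" by fastforce
    have "(a, b) \<in> points" using evals_point(4)[OF vw(1)] ab by simp
    then have z: "poly f a \<noteq> 0" "b ^ n = poly f a" by (auto simp: points_def nonroots_def)
    then have b: "poly f a = b ^ n" "b \<noteq> 0" using n_pos by (auto simp: power_0_left)
    have "\<exists>!v. v \<in> {v \<in> places Kxy. lies_over v a} \<and> residue_is v y b"
      by (rule fibre_unramified(3)[OF b z(2)])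
    moreover have "v \<in> {v \<in> places Kxy. lies_over v a} \<and> residue_is v y b"
      "w \<in> {v \<in> places Kxy. lies_over v a} \<and> residue_is w y b"
      using evals_point(1-3)[OF vw(1)] evals_point(1-3)[OF vw(2)] vw(3)[symmetric] ab by auto
    ultimately show "v = w" by blast
  qed
qed

lemma nth_roots:
  assumes "a \<in> nonroots"
  shows "card {b. b ^ n = poly f a} = n"
    and "(\<Sum>b | b ^ n = poly f a. b ^ k) = (if n dvd k then of_nat n * poly f a ^ (k div n) else 0)"
proof -
  obtain c where c: "c ^ n = poly f a" using f_power[of a] by metis
  have c0: "c \<noteq> 0" using c assms n_pos by (auto simp: nonroots_def power_0_left)
  have bij: "bij_betw (\<lambda>u. u * c) mu_n {b. b ^ n = poly f a}"
    by (rule bij_betwI[where g = "\<lambda>b. b / c"])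
       (use c c0 assms in \<open>auto simp: mu_n_def power_mult_distrib power_divide nonroots_def\<close>)
  show "card {b. b ^ n = poly f a} = n" using bij_betw_same_card[OF bij] card_mu_n by simp
  have "(\<Sum>b | b ^ n = poly f a. b ^ k) = (\<Sum>u\<in>mu_n. (u * c) ^ k)"
    by (rule sum.reindex_bij_betw[OF bij, symmetric])
  also have "\<dots> = (\<Sum>u\<in>mu_n. u ^ k) * c ^ k" by (simp add: power_mult_distrib sum_distrib_right)
  also have "(\<Sum>u\<in>mu_n. u ^ k) = (if n dvd k then of_nat n else 0)"
    unfolding mu_n_def by (rule sum_roots_of_unity_power[OF n_pos card_mu])
  finally show "(\<Sum>b | b ^ n = poly f a. b ^ k) = (if n dvd k then of_nat n * poly f a ^ (k div n) else 0)"
    by (auto simp: c[symmetric] simp flip: power_mult)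
qed

lemma finite_points [simp]: "finite points" and card_points: "card points = n * (CARD('k) - n * e)"
proof -
  show "finite points" by (rule finite_subset[OF subset_UNIV]) simp
  have "card points = (\<Sum>a\<in>nonroots. card {b. b ^ n = poly f a})"
    unfolding points_def by (rule card_SigmaI) auto
  also have "\<dots> = n * (CARD('k) - n * e)" by (simp add: nth_roots card_nonroots)
  finally show "card points = n * (CARD('k) - n * e)" .
qed

lemma finite_evals [simp]: "finite evals" and card_evals: "card evals = n * (CARD('k) - n * e)"
  using bij_betw_finite[OF bij_point] bij_betw_same_card[OF bij_point] card_points by simp_all

text \<open>
  The function \<open>\<Sum>j<n. A j * y ^ j\<close> is represented by the family of its coefficients.
\<close>

definition word :: "(nat \<Rightarrow> 'k poly) \<Rightarrow> 'k place \<Rightarrow> 'k" where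
  "word A v = (if v \<in> evals then \<Sum>j<n. poly (A j) (fst (point v)) * snd (point v) ^ j else 0)"

definition families :: "(nat \<Rightarrow> nat) \<Rightarrow> (nat \<Rightarrow> 'k poly) set" where
  "families c = {A. \<forall>j<n. A j \<in> polys_below (c j)}"

lemma residue_add:
  "v \<in> places Kxy \<Longrightarrow> residue_is v g b \<Longrightarrow> residue_is v h c \<Longrightarrow> residue_is v (g + h) (b + c)"
  using at_least_add[of v "g - cst b" 1 "h - cst c"] by (simp add: residue_is_def cst.add algebra_simps)

lemma residue_at_least: "v \<in> places Kxy \<Longrightarrow> residue_is v g b \<Longrightarrow> g \<in> at_least v 0"
  using at_least_add[of v "g - cst b" 0 "cst b"] at_least_mono[of v "g - cst b" 1 0] by (simp add: residue_is_def)

lemma residue_mult: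
  assumes v: "v \<in> places Kxy" and g: "residue_is v g b" and h: "residue_is v h c"
  shows "residue_is v (g * h) (b * c)"
proof -
  have "(g - cst b) * h \<in> at_least v (1 + 0)"
    by (rule at_least_mult[OF v _ residue_at_least[OF v h]]) (use g in \<open>simp add: residue_is_def\<close>)
  moreover have "cst b * (h - cst c) \<in> at_least v 1"
    by (rule at_least_scale[OF v]) (use h in \<open>simp add: residue_is_def\<close>)
  ultimately have "(g - cst b) * h + cst b * (h - cst c) \<in> at_least v 1"
    using at_least_add[OF v] by simp
  then show ?thesis by (simp add: residue_is_def cst.mult algebra_simps)
qed

lemma residue_cst: "v \<in> places Kxy \<Longrightarrow> residue_is v (cst c) c"
  by (simp add: residue_is_def)

lemma residue_power: "v \<in> places Kxy \<Longrightarrow> residue_is v g b \<Longrightarrow> residue_is v (g ^ k) (b ^ k)"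
  using residue_cst[of v 1] by (induction k) (auto intro: residue_mult)

lemma residue_sum:
  "v \<in> places Kxy \<Longrightarrow> (\<And>i. i \<in> A \<Longrightarrow> residue_is v (g i) (b i)) \<Longrightarrow> residue_is v (\<Sum>i\<in>A. g i) (\<Sum>i\<in>A. b i)"
  using residue_cst[of v 0] by (induction A rule: infinite_finite_induct) (auto intro: residue_add)

lemma eval_at_eq:
  assumes "v \<in> places Kxy" "residue_is v h c"
  shows "eval_at v h = c"
  unfolding eval_at_def
proof (rule the_equality)
  have h: "h \<in> Kxy" using residue_at_least[OF assms] by (simp add: at_least_def)
  show "h - cst c = 0 \<or> v (h - cst c) > 0" using assms(2) by (auto simp: residue_is_def at_least_def)
  fix c' assume "h - cst c' = 0 \<or> v (h - cst c') > 0"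
  then have "residue_is v h c'" using h by (auto simp: residue_is_def at_least_def)
  then show "c' = c" using residue_unique[OF assms(1)] assms(2) by blast
qed

lemma code_eq: "code f Kxy s = word ` families (pole_bound s)"
proof -
  have w: "(\<lambda>v. if v \<in> evals then eval_at v (\<Sum>j<n. cx (A j) * y ^ j) else 0) = word A" for A
  proof
    fix v show "(if v \<in> evals then eval_at v (\<Sum>j<n. cx (A j) * y ^ j) else 0) = word A v"
    proof (cases "v \<in> evals")
      case True
      note v = evals_point[OF True]
      have "residue_is v (\<Sum>j<n. cx (A j) * y ^ j) (\<Sum>j<n. poly (A j) (fst (point v)) * snd (point v) ^ j)"
        by (intro residue_sum residue_mult residue_power lies_over_residue v)
      then show ?thesis using True eval_at_eq[OF v(1)] by (simp add: word_def)
    qed (simp add: word_def)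
  qed
  have "code f Kxy s = (\<lambda>h. \<lambda>v. if v \<in> evals then eval_at v h else 0) ` normal_span (pole_bound s)"
    by (auto simp: code_def RR_space_D_inf)
  also have "normal_span (pole_bound s) = (\<lambda>A. \<Sum>j<n. cx (A j) * y ^ j) ` families (pole_bound s)"
    by (auto simp: normal_span_def families_def)
  finally show ?thesis by (simp add: image_image w)
qed

lemma word_diff: "word (\<lambda>j. A j - B j) v = word A v - word B v"
  by (simp add: word_def left_diff_distrib sum_subtractf)

text \<open>
  For fixed \<open>x = a\<close> a vanishing word is a polynomial of degree less than \<open>n\<close> in \<open>b\<close> with \<open>n\<close> roots; so each
  coefficient vanishes at all \<open>a\<close> that are not zeros of \<open>f\<close>, more points than its degree allows.
\<close>

lemma word_eq_0:
  assumes A: "A \<in> families (\<lambda>_. CARD('k) - n * e)" and w: "word A = (\<lambda>_. 0)" and j: "j < n"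
  shows "A j = 0"
proof (rule ccontr)
  assume nz: "A j \<noteq> 0"
  have "poly (A j) a = 0" if a: "a \<in> nonroots" for a
  proof -
    define P where "P = (\<Sum>j<n. monom (poly (A j) a) j)"
    have coeffP: "coeff P i = (if i < n then poly (A i) a else 0)" for i
      by (simp add: P_def coeff_sum if_distrib cong: if_cong)
    have "P = 0"
    proof (rule ccontr)
      assume P: "P \<noteq> 0"
      have "poly P b = 0" if b: "b ^ n = poly f a" for b
      proof -
        have "(a, b) \<in> points" using a b by (simp add: points_def)
        then obtain v where v: "v \<in> evals" "point v = (a, b)"
          using bij_point by (metis bij_betw_imp_surj_on imageE)
        have "word A v = 0" using w by simp
        then show ?thesis using v by (simp add: word_def P_def poly_sum poly_monom)
      qed
      then have "{b. b ^ n = poly f a} \<subseteq> {b. poly P b = 0}" by blast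
      then have "n \<le> card {b. poly P b = 0}"
        using card_mono[OF poly_roots_finite[OF P], of "{b. b ^ n = poly f a}"] nth_roots(1)[OF a] by simp
      also have "\<dots> \<le> degree P" by (rule card_poly_roots_bound[OF P])
      also have "\<dots> < n"
        using n_pos by (cases n) (auto simp: coeffP less_Suc_eq_le intro!: degree_le)
      finally show False by simp
    qed
    then show ?thesis using coeffP[of j] j by simp
  qed
  then have "nonroots \<subseteq> {a. poly (A j) a = 0}" by blast
  then have "card nonroots \<le> card {a. poly (A j) a = 0}"
    using card_mono[OF poly_roots_finite[OF nz]] by blast
  also have "\<dots> \<le> degree (A j)" by (rule card_poly_roots_bound[OF nz])
  finally show False using A j nz by (auto simp: card_nonroots families_def polys_below_iff)
qed

text \<open>
  Multiplication by \<open>y\<close>, reduced with \<open>y ^ n = f\<close>.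
\<close>

definition shift :: "(nat \<Rightarrow> 'k poly) \<Rightarrow> nat \<Rightarrow> 'k poly" where
  "shift B j = (if j = 0 then f * B (n - 1) else B (j - 1))"

lemma sum_shift:
  fixes g :: "nat \<Rightarrow> 'a::comm_monoid_add"
  shows "(\<Sum>j<n. g j) = g 0 + (\<Sum>j<n - 1. g (Suc j))" "(\<Sum>j<n. g j) = g (n - 1) + (\<Sum>j<n - 1. g j)"
proof -
  obtain m where "n = Suc m" using n_pos by (cases n) auto
  then show "(\<Sum>j<n. g j) = g 0 + (\<Sum>j<n - 1. g (Suc j))"
    by (simp add: sum.lessThan_Suc_shift del: sum.lessThan_Suc)
  from \<open>n = Suc m\<close> show "(\<Sum>j<n. g j) = g (n - 1) + (\<Sum>j<n - 1. g j)"
    by (simp add: add.commute)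
qed

lemma all_shift:
  "(\<forall>j<n. P j) \<longleftrightarrow> P 0 \<and> (\<forall>j<n - 1. P (Suc j))" "(\<forall>j<n. P j) \<longleftrightarrow> P (n - 1) \<and> (\<forall>j<n - 1. P j)"
proof -
  obtain m where "n = Suc m" using n_pos by (cases n) auto
  then show "(\<forall>j<n. P j) \<longleftrightarrow> P 0 \<and> (\<forall>j<n - 1. P (Suc j))" by (auto simp: less_Suc_eq_0_disj)
  from \<open>n = Suc m\<close> show "(\<forall>j<n. P j) \<longleftrightarrow> P (n - 1) \<and> (\<forall>j<n - 1. P j)" by (auto simp: less_Suc_eq)
qed

lemma word_shift:
  assumes v: "v \<in> evals"
  shows "word (shift B) v = (\<Sum>j<n. poly (B j) (fst (point v)) * snd (point v) ^ Suc j)"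
proof -
  define a b where "a = fst (point v)" and "b = snd (point v)"
  have b: "b ^ n = poly f a" using evals_point(4)[OF v] by (auto simp: points_def a_def b_def)
  have "b ^ Suc (n - 1) = poly f a" using n_pos b by simp
  moreover have "word (shift B) v = (\<Sum>j<n. poly (shift B j) a * b ^ j)"
    using v by (simp add: word_def a_def b_def)
  ultimately show ?thesis
    unfolding a_def[symmetric] b_def[symmetric] sum_shift(2)[of "\<lambda>j. poly (B j) a * b ^ Suc j"]
    by (simp add: sum_shift(1) shift_def mult_ac del: power_Suc)
qed

lemma shift_families:
  "shift B \<in> families (pole_bound t) \<longleftrightarrow> B \<in> families (pole_bound (t - int e))"
proof -
  have "shift B \<in> families (pole_bound t) \<longleftrightarrow> shift B 0 \<in> polys_below (pole_bound t 0) \<and>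
     (\<forall>j<n - 1. shift B (Suc j) \<in> polys_below (pole_bound t (Suc j)))"
    unfolding families_def mem_Collect_eq by (rule all_shift)
  also have "shift B 0 \<in> polys_below (pole_bound t 0) \<longleftrightarrow> B (n - 1) \<in> polys_below (pole_bound (t - int e) (n - 1))"
  proof (cases "B (n - 1) = 0")
    case False
    have ne: "n * e = (n - 1) * e + e" using n_pos by (cases n) auto
    have "degree (f * B (n - 1)) = (n - 1) * e + e + degree (B (n - 1))"
      unfolding degree_mult_eq[OF f_nonzero False] degree_f ne ..
    then have deg: "int (degree (f * B (n - 1))) = int (n - 1) * int e + int e + int (degree (B (n - 1)))"
      by (simp only: of_nat_add of_nat_mult)
    have nz: "(f * B (n - 1) = 0) = False" "(B (n - 1) = 0) = False" using False f_nonzero by auto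
    have "shift B 0 = f * B (n - 1)" by (simp add: shift_def)
    then show ?thesis
      unfolding in_polys_below_pole_bound by (simp only: nz simp_thms of_nat_0 mult_zero_left deg) (rule iffI; linarith)
  qed (simp add: shift_def)
  also have "(\<forall>j<n - 1. shift B (Suc j) \<in> polys_below (pole_bound t (Suc j))) \<longleftrightarrow>
     (\<forall>j<n - 1. B j \<in> polys_below (pole_bound (t - int e) j))"
    by (simp add: shift_def in_polys_below_pole_bound algebra_simps)
  finally show ?thesis unfolding families_def mem_Collect_eq all_shift(2) .
qed

text \<open>
  In the product of \<open>y * (\<Sum>k<n. B k * y ^ k)\<close> and \<open>\<Sum>j<n. A j * y ^ j\<close> the exponent \<open>k + 1 + j\<close> of \<open>y\<close> lies
  strictly between \<open>0\<close> and \<open>2 n\<close>, and the sum over \<open>b\<close> keeps only the exponent \<open>n\<close>.  The factor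
  \<open>b ^ n = f(a)\<close> extends the sum over \<open>a\<close> to the whole field, as it vanishes at the missing points.
\<close>

lemma pairing:
  "(\<Sum>v\<in>evals. word (shift B) v * word A v)
     = of_nat n * (\<Sum>k<n. \<Sum>a\<in>UNIV. poly (A (n - 1 - k) * B k * f) a)"
proof -
  have "(\<Sum>v\<in>evals. word (shift B) v * word A v)
     = (\<Sum>v\<in>evals. (\<lambda>(a, b). (\<Sum>k<n. poly (B k) a * b ^ Suc k) * (\<Sum>j<n. poly (A j) a * b ^ j)) (point v))"
    by (rule sum.cong) (simp_all add: word_shift word_def[of A] case_prod_unfold)
  also have "\<dots> = (\<Sum>(a, b)\<in>points. (\<Sum>k<n. poly (B k) a * b ^ Suc k) * (\<Sum>j<n. poly (A j) a * b ^ j))"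
    by (rule sum.reindex_bij_betw[OF bij_point])
  also have "\<dots> = (\<Sum>a\<in>nonroots. \<Sum>b | b ^ n = poly f a. (\<Sum>k<n. poly (B k) a * b ^ Suc k) * (\<Sum>j<n. poly (A j) a * b ^ j))"
    unfolding points_def by (rule sum.Sigma[symmetric]) auto
  also have "\<dots> = (\<Sum>a\<in>nonroots. \<Sum>k<n. of_nat n * poly (A (n - 1 - k) * B k * f) a)"
  proof (rule sum.cong[OF refl])
    fix a assume a: "a \<in> nonroots"
    have "(\<Sum>b | b ^ n = poly f a. (\<Sum>k<n. poly (B k) a * b ^ Suc k) * (\<Sum>j<n. poly (A j) a * b ^ j))
       = (\<Sum>b | b ^ n = poly f a. \<Sum>k<n. \<Sum>j<n. poly (B k) a * poly (A j) a * b ^ (Suc k + j))"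
      unfolding sum_product by (intro sum.cong refl) (simp only: power_add mult_ac)
    also have "\<dots> = (\<Sum>k<n. \<Sum>j<n. poly (B k) a * poly (A j) a * (\<Sum>b | b ^ n = poly f a. b ^ (Suc k + j)))"
      by (subst sum.swap, rule sum.cong[OF refl], subst sum.swap, rule sum.cong[OF refl])
         (simp only: sum_distrib_left)
    also have "\<dots> = (\<Sum>k<n. \<Sum>j<n. if j = n - 1 - k then of_nat n * poly (A (n - 1 - k) * B k * f) a else 0)"
    proof (intro sum.cong refl)
      fix k j assume "k \<in> {..<n}" "j \<in> {..<n}"
      then have kj: "k < n" "j < n" by auto
      have "n dvd Suc k + j \<longleftrightarrow> j = n - 1 - k"
      proof
        assume "n dvd Suc k + j"
        then obtain i where i: "Suc k + j = n * i" by blast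
        with kj have "n * i < n * 2" by linarith
        then have "i < 2" by simp
        moreover have "i \<noteq> 0" using i by (intro notI) simp
        ultimately have "i = 1" by simp
        with i show "j = n - 1 - k" by simp
      qed (use kj in simp)
      moreover have "(Suc k + (n - 1 - k)) div n = 1" using kj by simp
      ultimately show "poly (B k) a * poly (A j) a * (\<Sum>b | b ^ n = poly f a. b ^ (Suc k + j))
        = (if j = n - 1 - k then of_nat n * poly (A (n - 1 - k) * B k * f) a else 0)"
        unfolding nth_roots(2)[OF a] by (simp add: mult_ac)
    qed
    also have "\<dots> = (\<Sum>k<n. of_nat n * poly (A (n - 1 - k) * B k * f) a)"
      by (intro sum.cong refl) simp
    finally show "(\<Sum>b | b ^ n = poly f a. (\<Sum>k<n. poly (B k) a * b ^ Suc k) * (\<Sum>j<n. poly (A j) a * b ^ j))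
      = (\<Sum>k<n. of_nat n * poly (A (n - 1 - k) * B k * f) a)" .
  qed
  also have "\<dots> = (\<Sum>a\<in>UNIV. \<Sum>k<n. of_nat n * poly (A (n - 1 - k) * B k * f) a)"
    by (rule sum.mono_neutral_left) (auto simp: nonroots_def)
  also have "\<dots> = of_nat n * (\<Sum>k<n. \<Sum>a\<in>UNIV. poly (A (n - 1 - k) * B k * f) a)"
    by (subst sum.swap) (simp only: sum_distrib_left)
  finally show ?thesis .
qed

text \<open>
  The words of functions \<open>y * (\<Sum>k<n. B k * y ^ k)\<close> with coefficients of small degree are distinct, and
  there are as many of them as words.
\<close>

lemma words_interpolation:
  assumes "w \<in> words evals"
  shows "\<exists>B\<in>families (\<lambda>_. CARD('k) - n * e). w = word (shift B)"
proof -
  define r where "r = CARD('k) - n * e"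
  define Fam where "Fam = PiE {..<n} (\<lambda>_. polys_below r :: 'k poly set)"
  have cardF: "card Fam = CARD('k) ^ (n * r)"
    by (simp add: Fam_def card_PiE card_polys_below flip: power_mult) (simp add: mult.commute)
  have finF: "finite Fam" by (simp add: Fam_def finite_PiE card_polys_below)
  have inj: "inj_on (\<lambda>B. word (shift B)) Fam"
  proof (rule inj_onI)
    fix B C assume BC: "B \<in> Fam" "C \<in> Fam" "word (shift B) = word (shift C)"
    define A where "A j = B j - C j" for j
    have "word A v = 0" for v
    proof (cases "v \<in> evals")
      case True
      have "snd (point v) \<noteq> 0"
        using evals_point(4)[OF True] n_pos by (auto simp: points_def nonroots_def power_0_left)
      moreover have "snd (point v) * word A v = word (shift B) v - word (shift C) v"
        using True by (simp add: word_shift A_def word_def[of A] sum_distrib_left left_diff_distrib sum_subtractf mult_ac right_diff_distrib)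
      ultimately show ?thesis using BC(3) by simp
    qed (simp add: word_def)
    then have w0: "word A = (\<lambda>_. 0)" by blast
    have A: "A \<in> families (\<lambda>_. CARD('k) - n * e)"
      using BC(1,2) by (auto simp: families_def A_def Fam_def r_def polys_below_def PiE_def Pi_def)
    have "B j = C j" if "j < n" for j using word_eq_0[OF A w0 that] by (simp add: A_def)
    then show "B = C" using BC(1,2) unfolding Fam_def by (intro PiE_ext) auto
  qed
  define wd where "wd = (\<lambda>g v. if v \<in> evals then g v else (0::'k))"
  have words_eq: "words evals = wd ` (evals \<rightarrow>\<^sub>E (UNIV :: 'k set))"
  proof (intro equalityI subsetI)
    fix u assume "u \<in> words evals"
    then have "u = wd (restrict u evals)" by (auto simp: words_def wd_def)
    then show "u \<in> wd ` (evals \<rightarrow>\<^sub>E (UNIV :: 'k set))" by (intro image_eqI[of _ _ "restrict u evals"]) auto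
  qed (auto simp: words_def wd_def)
  have finW: "finite (words evals)" unfolding words_eq by (simp add: finite_PiE)
  have "card (words evals) \<le> card (evals \<rightarrow>\<^sub>E (UNIV :: 'k set))"
    unfolding words_eq by (rule card_image_le) (simp add: finite_PiE)
  also have "\<dots> = CARD('k) ^ (n * r)" by (simp add: card_PiE card_evals r_def)
  finally have le: "card (words evals) \<le> card Fam" by (simp add: cardF)
  have sub: "(\<lambda>B. word (shift B)) ` Fam \<subseteq> words evals" by (auto simp: words_def word_def)
  have "(\<lambda>B. word (shift B)) ` Fam = words evals"
    by (rule card_seteq[OF finW sub]) (simp add: card_image[OF inj] le)
  with assms obtain B where "B \<in> Fam" "w = word (shift B)" by blast
  then show ?thesis by (auto simp: families_def Fam_def r_def)
qed

text \<open>
  Interpolate a word of the dual by \<open>y * (\<Sum>k<n. B k * y ^ k)\<close>.  If some \<open>B k\<close> had too large a degree, the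
  monomial \<open>x ^ i * y ^ (n - 1 - k)\<close> that brings the degree of \<open>x ^ i * B k * f\<close> to exactly \<open>q - 1\<close> would lie in
  \<open>L(s D_inf)\<close>, and its pairing with the word would be \<open>- n\<close> times a leading coefficient.  Conversely all
  products in the pairing have degree at most \<open>q - 2\<close>.
\<close>

lemma dual_code_eq:
  "dual_code evals (code f Kxy s) = (\<lambda>B. word (shift B)) ` families (pole_bound (int CARD('k) - 2 - s - int e))"
proof (intro equalityI subsetI)
  fix w assume w: "w \<in> dual_code evals (code f Kxy s)"
  then have "w \<in> words evals" by (simp add: dual_code_def)
  from words_interpolation[OF this] obtain B where
    B: "B \<in> families (\<lambda>_. CARD('k) - n * e)" and wB: "w = word (shift B)" by blast
  have orth: "(\<Sum>v\<in>evals. word (shift B) v * word A v) = 0" if "A \<in> families (pole_bound s)" for A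
    using w that by (auto simp: dual_code_def code_eq wB)
  have "B k \<in> polys_below (pole_bound (int CARD('k) - 2 - s - int e) k)" if k: "k < n" for k
  proof (rule ccontr)
    assume "B k \<notin> polys_below (pole_bound (int CARD('k) - 2 - s - int e) k)"
    then have nz: "B k \<noteq> 0" and big: "int (degree (B k)) + int k * int e > int CARD('k) - 2 - s - int e"
      by (auto simp: in_polys_below_pole_bound)
    have degB: "degree (B k) < CARD('k) - n * e" using B k nz by (auto simp: families_def polys_below_iff)
    \<comment> \<open>The exponent for which \<open>x ^ i * B k * f\<close> has degree \<open>q - 1\<close>.\<close>
    define i where "i = CARD('k) - n * e - 1 - degree (B k)"
    define A where "A = (\<lambda>j. if j = n - 1 - k then monom (1::'k) i else 0)"
    have nk: "int (n - 1 - k) = int n - 1 - int k" using k by simp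
    have "int i = int CARD('k) - int n * int e - 1 - int (degree (B k))"
      using degB degree_le_card by (simp add: i_def of_nat_diff)
    then have "int i + int (n - 1 - k) * int e \<le> s"
      using big unfolding nk by (simp add: algebra_simps)
    then have "A \<in> families (pole_bound s)"
      by (simp add: families_def A_def in_polys_below_pole_bound degree_monom_eq)
    from orth[OF this] have "(\<Sum>k'<n. \<Sum>a\<in>UNIV. poly (A (n - 1 - k') * B k' * f) a) = 0"
      using n_nonzero by (simp add: pairing)
    also have "(\<Sum>k'<n. \<Sum>a\<in>UNIV. poly (A (n - 1 - k') * B k' * f) a)
       = (\<Sum>k'<n. if k' = k then (\<Sum>a\<in>UNIV. poly (monom 1 i * B k * f) a) else 0)"
      by (intro sum.cong refl) (use k in \<open>auto simp: A_def\<close>)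
    also have "\<dots> = (\<Sum>a\<in>UNIV. poly (monom 1 i * B k * f) a)" using k by simp
    finally have zero: "(\<Sum>a\<in>UNIV. poly (monom 1 i * B k * f) a) = 0" .
    define p where "p = monom 1 i * B k * f"
    have p0: "p \<noteq> 0" using nz f_nonzero by (simp add: p_def monom_eq_0_iff)
    have degp: "degree p = CARD('k) - 1"
      using nz f_nonzero degB degree_le_card
      by (simp add: p_def degree_mult_eq degree_monom_eq monom_eq_0_iff degree_f i_def)
    then have "p \<in> polys_below CARD('k)" using card_field_gt_1[where 'k = 'k] by (intro polys_belowI) simp
    from poly_sum_field[OF this] zero have "coeff p (CARD('k) - 1) = 0" by (simp add: p_def)
    with degp p0 show False by (metis leading_coeff_0_iff)
  qed
  then show "w \<in> (\<lambda>B. word (shift B)) ` families (pole_bound (int CARD('k) - 2 - s - int e))"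
    by (auto simp: families_def wB)
next
  fix w assume "w \<in> (\<lambda>B. word (shift B)) ` families (pole_bound (int CARD('k) - 2 - s - int e))"
  then obtain B where B: "B \<in> families (pole_bound (int CARD('k) - 2 - s - int e))" "w = word (shift B)" by blast
  have "(\<Sum>v\<in>evals. word (shift B) v * word A v) = 0" if A: "A \<in> families (pole_bound s)" for A
  proof -
    have "(\<Sum>a\<in>UNIV. poly (A (n - 1 - k) * B k * f) a) = 0" if k: "k < n" for k
    proof (cases "A (n - 1 - k) = 0 \<or> B k = 0")
      case False
      define p where "p = A (n - 1 - k) * B k * f"
      have "int (degree (A (n - 1 - k))) + int (n - 1 - k) * int e \<le> s"
      proof -
        have "A (n - 1 - k) \<in> polys_below (pole_bound s (n - 1 - k))" using A k by (simp add: families_def)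
        then show ?thesis using False unfolding in_polys_below_pole_bound by blast
      qed
      moreover have "int (degree (B k)) + int k * int e \<le> int CARD('k) - 2 - s - int e"
        using B k False by (auto simp: families_def in_polys_below_pole_bound)
      moreover have "int (n - 1 - k) = int n - 1 - int k" using k by simp
      moreover have "int (degree p) = int (degree (A (n - 1 - k))) + int (degree (B k)) + int n * int e"
        using False f_nonzero by (simp add: p_def degree_mult_eq degree_f)
      ultimately have "int (degree p) \<le> int CARD('k) - 2" by (simp add: algebra_simps)
      then have "degree p < CARD('k) - 1" using card_field_gt_1[where 'k = 'k] by linarith
      then have "p \<in> polys_below CARD('k)" "coeff p (CARD('k) - 1) = 0"
        by (simp_all add: polys_belowI coeff_eq_0)
      then have "(\<Sum>a\<in>UNIV. poly p a) = 0" by (simp add: poly_sum_field)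
      then show ?thesis unfolding p_def .
    qed auto
    then show ?thesis by (simp add: pairing)
  qed
  then show "w \<in> dual_code evals (code f Kxy s)"
    by (auto simp: dual_code_def code_eq B(2) words_def word_def[of "shift B"])
qed

lemma families_mono: "(\<And>j. j < n \<Longrightarrow> c j \<le> d j) \<Longrightarrow> families c \<subseteq> families d"
  unfolding families_def polys_below_def by (blast intro: le_trans)

text \<open>
  The two inequalities make evaluation injective on \<open>L(s D_inf)\<close> and on \<open>L((q - 2 - s) D_inf)\<close>, so a word
  of the hull comes from one function lying in both \<open>L(s D_inf)\<close> and \<open>y L((q - 2 - s - e) D_inf)\<close>.
\<close>

lemma hull_eq:
  assumes s: "s < int CARD('k) - int (n * e)" "int CARD('k) - 2 - s < int CARD('k) - int (n * e)"
  shows "code_hull evals (code f Kxy s)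
    = (\<lambda>B. word (shift B)) ` families (pole_bound (min s (int CARD('k) - 2 - s) - int e))"
proof (intro equalityI subsetI)
  fix w assume "w \<in> code_hull evals (code f Kxy s)"
  then have wc: "w \<in> code f Kxy s" "w \<in> dual_code evals (code f Kxy s)" by (simp_all add: code_hull_def)
  obtain A where A: "A \<in> families (pole_bound s)" "w = word A" using wc(1) unfolding code_eq by blast
  obtain B where B: "B \<in> families (pole_bound (int CARD('k) - 2 - s - int e))" "w = word (shift B)"
    using wc(2) unfolding dual_code_eq by blast
  have large: "families (pole_bound t) \<subseteq> families (\<lambda>_. CARD('k) - n * e)" if "t < int CARD('k) - int (n * e)" for t
    by (rule families_mono) (use that in \<open>simp add: pole_bound_def nat_le_iff\<close>, smt (verit) mult_nonneg_nonneg of_nat_0_le_iff of_nat_diff degree_le_card of_nat_mult)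
  have sB: "shift B \<in> families (pole_bound (int CARD('k) - 2 - s))" using B(1) shift_families by simp
  have "(\<lambda>j. A j - shift B j) \<in> families (\<lambda>_. CARD('k) - n * e)"
  proof -
    have "A \<in> families (\<lambda>_. CARD('k) - n * e)" "shift B \<in> families (\<lambda>_. CARD('k) - n * e)"
      using large[OF s(1)] large[OF s(2)] A(1) sB by blast+
    then show ?thesis by (simp add: families_def polys_below_def)
  qed
  moreover have "word (\<lambda>j. A j - shift B j) = (\<lambda>_. 0)"
    using A(2) B(2) by (simp add: fun_eq_iff word_diff)
  ultimately have "A j = shift B j" if "j < n" for j
    using word_eq_0[of "\<lambda>j. A j - shift B j" j] that by simp
  then have "shift B \<in> families (pole_bound s)" using A(1) by (simp add: families_def)
  then have "shift B \<in> families (pole_bound (min s (int CARD('k) - 2 - s)))"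
    using sB by (simp add: min_def)
  then have "B \<in> families (pole_bound (min s (int CARD('k) - 2 - s) - int e))" by (simp add: shift_families)
  then show "w \<in> (\<lambda>B. word (shift B)) ` families (pole_bound (min s (int CARD('k) - 2 - s) - int e))"
    using B(2) by blast
next
  fix w assume "w \<in> (\<lambda>B. word (shift B)) ` families (pole_bound (min s (int CARD('k) - 2 - s) - int e))"
  then obtain B where B: "B \<in> families (pole_bound (min s (int CARD('k) - 2 - s) - int e))" "w = word (shift B)" by blast
  have mono: "families (pole_bound t) \<subseteq> families (pole_bound t')" if "t \<le> t'" for t t'
    by (rule families_mono) (use that in \<open>simp add: pole_bound_def nat_mono\<close>)
  have "shift B \<in> families (pole_bound s)"
    unfolding shift_families by (rule subsetD[OF mono B(1)]) simp
  then have "w \<in> code f Kxy s" using B(2) unfolding code_eq by blast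
  moreover have "B \<in> families (pole_bound (int CARD('k) - 2 - s - int e))"
    by (rule subsetD[OF mono B(1)]) simp
  then have "w \<in> dual_code evals (code f Kxy s)" using B(2) unfolding dual_code_eq by blast
  ultimately show "w \<in> code_hull evals (code f Kxy s)"
    unfolding code_hull_def by blast
qed

lemma vector_space_words: "vector_space (\<lambda>(c::'k) (u :: 'k place \<Rightarrow> 'k). (\<lambda>v. c * u v))"
  by standard (auto simp: fun_eq_iff algebra_simps)

lemma code_dim_shift_families:
  assumes t: "t + int e < int CARD('k) - int (n * e)"
  shows "code_dim ((\<lambda>B. word (shift B)) ` families (pole_bound t)) = (\<Sum>j<n. pole_bound t j)"
proof -
  define W where "W = (\<lambda>B. word (shift B)) ` families (pole_bound t)"
  define Fam where "Fam = PiE {..<n} (\<lambda>j. polys_below (pole_bound t j) :: 'k poly set)"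
  have cong: "word (shift B) = word (shift C)" if "\<And>j. j < n \<Longrightarrow> B j = C j" for B C
    using that by (auto simp: fun_eq_iff word_def shift_def intro!: sum.cong)
  have W: "W = (\<lambda>B. word (shift B)) ` Fam"
  proof (intro equalityI subsetI)
    fix w assume "w \<in> W"
    then obtain B where B: "B \<in> families (pole_bound t)" "w = word (shift B)" by (auto simp: W_def)
    then have "w = word (shift (restrict B {..<n}))" using cong[of B "restrict B {..<n}"] by simp
    then show "w \<in> (\<lambda>B. word (shift B)) ` Fam"
      using B by (intro image_eqI[of _ _ "restrict B {..<n}"]) (auto simp: Fam_def families_def)
  next
    fix w assume "w \<in> (\<lambda>B. word (shift B)) ` Fam"
    then obtain B where "B \<in> Fam" "w = word (shift B)" by blast
    then show "w \<in> W" unfolding W_def by (intro image_eqI[of _ _ B]) (auto simp: Fam_def families_def)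
  qed
  have finF: "finite Fam" by (simp add: Fam_def finite_PiE card_polys_below)
  have inj: "inj_on (\<lambda>B. word (shift B)) Fam"
  proof (rule inj_onI)
    fix B C assume BC: "B \<in> Fam" "C \<in> Fam" "word (shift B) = word (shift C)"
    define A where "A j = B j - C j" for j
    have "A \<in> families (pole_bound t)"
      using BC(1,2) by (auto simp: families_def A_def Fam_def polys_below_def PiE_def Pi_def)
    then have "shift A \<in> families (pole_bound (t + int e))" by (simp add: shift_families)
    moreover have "families (pole_bound (t + int e)) \<subseteq> families (\<lambda>_. CARD('k) - n * e)"
    proof (rule families_mono)
      fix j
      have "int j * int e \<ge> 0" by simp
      then have "t + int e + 1 - int j * int e \<le> int CARD('k) - int (n * e)" using t by linarith
      then show "pole_bound (t + int e) j \<le> CARD('k) - n * e"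
        using degree_le_card by (simp add: pole_bound_def nat_le_iff of_nat_diff)
    qed
    ultimately have sA: "shift A \<in> families (\<lambda>_. CARD('k) - n * e)" by blast
    have "shift A = (\<lambda>j. shift B j - shift C j)" by (rule ext) (simp add: shift_def A_def right_diff_distrib)
    then have "word (shift A) v = 0" for v using word_diff[of "shift B" "shift C" v] BC(3) by simp
    then have "word (shift A) = (\<lambda>_. 0)" by blast
    then have sz: "shift A j = 0" if "j < n" for j using word_eq_0[OF sA] that by blast
    have "B j = C j" if j: "j < n" for j
    proof (cases "j = n - 1")
      case True
      then show ?thesis using sz[of 0] n_pos f_nonzero by (simp add: shift_def A_def)
    next
      case False
      then show ?thesis using sz[of "Suc j"] j by (simp add: shift_def A_def)
    qed
    then show "B = C" using BC(1,2) unfolding Fam_def by (intro PiE_ext) auto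
  qed
  have card: "card W = CARD('k) ^ (\<Sum>j<n. pole_bound t j)"
    unfolding W by (simp add: card_image[OF inj]) (simp add: Fam_def card_PiE card_polys_below power_sum)
  interpret V: vector_space "\<lambda>(c::'k) (u :: 'k place \<Rightarrow> 'k). (\<lambda>v. c * u v)" by (rule vector_space_words)
  have "V.subspace W"
    unfolding V.subspace_def
  proof (intro conjI ballI allI)
    have "word (shift (\<lambda>_. 0)) = 0" by (auto simp: fun_eq_iff word_def shift_def intro!: sum.neutral)
    then show "0 \<in> W" unfolding W_def by (intro image_eqI[of _ _ "\<lambda>_. 0"]) (auto simp: families_def)
  next
    fix u w assume "u \<in> W" "w \<in> W"
    then obtain B C where "B \<in> families (pole_bound t)" "C \<in> families (pole_bound t)"
      "u = word (shift B)" "w = word (shift C)" by (auto simp: W_def)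
    moreover have "word (shift B) + word (shift C) = word (shift (\<lambda>j. B j + C j))" for B C
      by (auto simp: fun_eq_iff word_def shift_def sum.distrib[symmetric] distrib_left distrib_right intro!: sum.cong)
    ultimately show "u + w \<in> W" unfolding W_def
      by (intro image_eqI[of _ _ "\<lambda>j. B j + C j"]) (auto simp: families_def polys_below_add)
  next
    fix c u assume "u \<in> W"
    then obtain B where "B \<in> families (pole_bound t)" "u = word (shift B)" by (auto simp: W_def)
    moreover have "(\<lambda>v. c * word (shift B) v) = word (shift (\<lambda>j. smult c (B j)))" for B
      by (auto simp: fun_eq_iff word_def shift_def sum_distrib_left mult_ac intro!: sum.cong)
    ultimately show "(\<lambda>v. c * u v) \<in> W" unfolding W_def
      by (intro image_eqI[of _ _ "\<lambda>j. smult c (B j)"]) (auto simp: families_def polys_below_smult)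
  qed
  moreover have "finite W" using finF by (simp add: W)
  ultimately have "card W = CARD('k) ^ V.dim W"
    by (rule card_subspace_eq_power_dim[OF vector_space_words])
  then have "V.dim W = (\<Sum>j<n. pole_bound t j)"
    using card card_field_gt_1[where 'k = 'k] by simp
  then show ?thesis by (simp add: code_dim_def W_def)
qed

lemma code_dim_hull:
  assumes s: "s < int CARD('k) - int (n * e)" "int CARD('k) - 2 - s < int CARD('k) - int (n * e)"
  defines "m \<equiv> min s (int CARD('k) - 2 - s)"
  assumes m: "m \<ge> int (n * e) - 1"
  shows "2 * int (code_dim (code_hull evals (code f Kxy s)))
    = 2 * int n * (m - int e + 1) - int e * int n * (int n - 1)"
proof -
  have "code_dim (code_hull evals (code f Kxy s)) = (\<Sum>j<n. pole_bound (m - int e) j)"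
    unfolding hull_eq[OF s] m_def by (rule code_dim_shift_families) (use s in linarith)
  moreover have "int ((n - 1) * e) = int (n * e) - int e"
    using n_pos by (cases n) (simp_all add: algebra_simps)
  then have "m - int e \<ge> int ((n - 1) * e) - 1" using m by linarith
  note sum_pole_bound[OF this]
  ultimately show ?thesis by simp
qed

end

section \<open>Quotients by roots of unity\<close>

text \<open>
  Here \<open>z\<close> generates the larger field, \<open>y\<close> the smaller one, and \<open>m\<close> is the order of the group.
\<close>

locale kummer_pair = H: kummer_galois f d z + Y: kummer_galois f n y
  for f :: "'k::field poly" and d n :: nat and z y :: "'k cover" +
  fixes m :: nat
  assumes d_eq: "d = n * m"
    and card_mu_m: "card {u::'k. u ^ m = 1} = m"
    and m_nonzero: "of_nat m \<noteq> (0::'k)"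
begin

abbreviation Kxz where "Kxz \<equiv> H.Kxy"
abbreviation mu_m :: "'k set" where "mu_m \<equiv> {u. u ^ m = 1}"

lemma m_pos: "m > 0" using H.n_pos d_eq by simp

lemma mu_m_subset: "u \<in> mu_m \<Longrightarrow> u \<in> H.mu_n"
  by (simp add: H.mu_n_def) (simp add: d_eq mult.commute[of n] power_mult)

lemma finite_mu_m [simp]: "finite mu_m"
  by (rule card_roots_of_unity_le(2)[OF m_pos])

definition tau :: "'k \<Rightarrow> 'k cover \<Rightarrow> 'k cover" where
  "tau u = restrict (H.sigma u) Kxz"

lemma tau_apply: "h \<in> Kxz \<Longrightarrow> tau u h = H.sigma u h"
  by (simp add: tau_def)

lemma tau_Bij: assumes u: "u \<in> H.mu_n" shows "tau u \<in> Bij Kxz"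
proof -
  have "bij_betw (H.sigma u) Kxz Kxz"
  proof (rule bij_betwI[where g = "H.sigma (inverse u)"])
    show "H.sigma u \<in> Kxz \<rightarrow> Kxz" "H.sigma (inverse u) \<in> Kxz \<rightarrow> Kxz"
      using u H.inverse_mu_n[OF u] by auto
    fix h assume "h \<in> Kxz"
    then show "H.sigma (inverse u) (H.sigma u h) = h" "H.sigma u (H.sigma (inverse u) h) = h"
      using u H.mu_n_nonzero[OF u] by (simp_all add: H.sigma_comp H.inverse_mu_n)
  qed
  then have "bij_betw (tau u) Kxz Kxz"
    by (rule bij_betw_cong[THEN iffD1, rotated]) (simp add: tau_apply)
  then show ?thesis by (simp add: Bij_def tau_def)
qed

lemma tau_inj: assumes "u \<in> H.mu_n" "w \<in> H.mu_n" "tau u = tau w" shows "u = w"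
proof -
  have "cst u * z = cst w * z"
    using assms(1,2) H.sigma_y by (metis assms(3) tau_apply H.y_Kxy)
  then show ?thesis using H.y_nonzero by simp
qed

lemma tau_mult:
  assumes "u \<in> H.mu_n" "w \<in> H.mu_n"
  shows "tau u \<otimes>\<^bsub>BijGroup Kxz\<^esub> tau w = tau (u * w)"
proof -
  have "tau u \<otimes>\<^bsub>BijGroup Kxz\<^esub> tau w = compose Kxz (tau u) (tau w)"
    by (simp add: BijGroup_def tau_Bij assms)
  also have "\<dots> = tau (u * w)"
  proof
    fix h show "compose Kxz (tau u) (tau w) h = tau (u * w) h"
      using assms by (cases "h \<in> Kxz") (simp_all add: compose_def tau_def H.sigma_comp)
  qed
  finally show ?thesis .
qed

lemma tau_one: "tau 1 = \<one>\<^bsub>BijGroup Kxz\<^esub>"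
  by (auto simp: BijGroup_def tau_def fun_eq_iff restrict_def)

interpretation B: group "BijGroup Kxz" by (rule group_BijGroup)

lemma tau_carrier: "u \<in> H.mu_n \<Longrightarrow> tau u \<in> carrier (BijGroup Kxz)"
  by (simp add: BijGroup_def tau_Bij)

lemma tau_inv: assumes u: "u \<in> H.mu_n" shows "inv\<^bsub>BijGroup Kxz\<^esub> tau u = tau (inverse u)"
proof (rule B.inv_equality)
  show "tau (inverse u) \<otimes>\<^bsub>BijGroup Kxz\<^esub> tau u = \<one>\<^bsub>BijGroup Kxz\<^esub>"
    using H.mu_n_nonzero[OF u] u by (simp add: tau_mult H.inverse_mu_n flip: tau_one)
qed (use u in \<open>simp_all add: tau_carrier H.inverse_mu_n\<close>)

lemma tau_subgroup:
  assumes "U \<subseteq> H.mu_n" "1 \<in> U" "\<And>u w. u \<in> U \<Longrightarrow> w \<in> U \<Longrightarrow> u * w \<in> U" "\<And>u. u \<in> U \<Longrightarrow> inverse u \<in> U"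
  shows "subgroup (tau ` U) (BijGroup Kxz)"
proof (rule B.subgroupI)
  show "tau ` U \<subseteq> carrier (BijGroup Kxz)" using assms(1) tau_carrier by blast
  show "tau ` U \<noteq> {}" using assms(2) by blast
next
  fix g assume "g \<in> tau ` U"
  then show "inv\<^bsub>BijGroup Kxz\<^esub> g \<in> tau ` U" using assms(1,4) tau_inv by blast
next
  fix g h assume "g \<in> tau ` U" "h \<in> tau ` U"
  then obtain u w where "u \<in> U" "w \<in> U" "g = tau u" "h = tau w" by blast
  then show "g \<otimes>\<^bsub>BijGroup Kxz\<^esub> h \<in> tau ` U" using assms(1,3) tau_mult[of u w] by auto
qed

definition G :: "('k cover \<Rightarrow> 'k cover) set" where "G = tau ` mu_m"

lemma card_G: "card G = m"
proof -
  have "inj_on tau mu_m"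
  proof (rule inj_onI)
    fix u w assume "u \<in> mu_m" "w \<in> mu_m" "tau u = tau w"
    then show "u = w" using tau_inj[OF mu_m_subset mu_m_subset] by blast
  qed
  then show ?thesis using card_mu_m by (simp add: G_def card_image)
qed

lemma subgroup_G: "subgroup G (BijGroup Kxz)"
  unfolding G_def
  by (rule tau_subgroup) (use mu_m_subset in \<open>auto simp: power_mult_distrib power_inverse\<close>)

text \<open>
  A subgroup of order \<open>m\<close> inside the group of all \<open>tau u\<close> corresponds to a group \<open>U\<close> of \<open>m\<close> roots of unity;
  multiplication by \<open>u\<close> permutes \<open>U\<close>, so \<open>u ^ m = 1\<close>.
\<close>

lemma subgroup_eq_G:
  assumes sub: "subgroup G' (BijGroup Kxz)" and le: "G' \<subseteq> tau ` H.mu_n" and card: "card G' = m"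
  shows "G' = G"
proof -
  define U where "U = {u \<in> H.mu_n. tau u \<in> G'}"
  have G': "G' = tau ` U" using le by (auto simp: U_def)
  have finU: "finite U" by (simp add: U_def)
  have inj: "inj_on tau U" using tau_inj by (auto intro!: inj_onI simp: U_def)
  have cardU: "card U = m" using card card_image[OF inj] by (simp add: G')
  have U_mult: "u * w \<in> U" if "u \<in> U" "w \<in> U" for u w
    using subgroup.m_closed[OF sub, of "tau u" "tau w"] that by (simp add: U_def tau_mult H.mult_mu_n)
  have "u ^ m = 1" if u: "u \<in> U" for u
  proof -
    have u0: "u \<noteq> 0" using u H.mu_n_nonzero by (simp add: U_def)
    have "(\<lambda>w. u * w) ` U = U"
      by (rule card_subset_eq[OF finU]) (use U_mult u u0 in \<open>auto simp: card_image inj_on_def\<close>)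
    moreover have "inj_on (\<lambda>w. u * w) U" using u0 by (simp add: inj_on_def)
    ultimately have "(\<Prod>w\<in>U. w) = (\<Prod>w\<in>U. u * w)" using prod.reindex[of "\<lambda>w. u * w" U "\<lambda>w. w"] by simp
    also have "\<dots> = u ^ m * (\<Prod>w\<in>U. w)" by (simp add: prod.distrib cardU)
    finally show ?thesis using finU H.mu_n_nonzero by (auto simp: U_def)
  qed
  then have "G' \<subseteq> G" by (auto simp: G' G_def)
  moreover have "finite G" by (simp add: G_def)
  ultimately show ?thesis using card_subset_eq card card_G by metis
qed

lemma tau_field_auts: assumes u: "u \<in> H.mu_n" shows "tau u \<in> field_auts Kxz"
proof -
  have "bij_betw (tau u) Kxz Kxz" using tau_Bij[OF u] by (simp add: Bij_def)
  then show ?thesis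
    using tau_Bij[OF u] u by (simp add: field_auts_def field_isos_def tau_apply H.sigma_add H.sigma_mult)
qed

lemma y_in_Kxz: "y \<in> Kxz" and y_eq: "\<exists>u. y = cst u * z ^ m"
proof -
  have zm: "(z ^ m) ^ n = cx f" using H.y_power by (simp add: d_eq mult.commute flip: power_mult)
  have z0: "z ^ m \<noteq> 0" using H.y_nonzero by simp
  define s where "s = y / z ^ m"
  have "s ^ n = 1" using zm Y.y_power Y.f_nonzero by (simp add: s_def power_divide)
  then have "(\<Prod>u\<in>Y.mu_n. s - cst (u * 1)) = 0" using Y.prod_mu_n[of s 1] by simp
  then obtain u where "s = cst u" by (auto simp: prod_zero_iff)
  then have "y = cst u * z ^ m" using z0 by (simp add: s_def field_simps)
  then show "\<exists>u. y = cst u * z ^ m" "y \<in> Kxz" by auto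
qed

text \<open>
  Averaging a fixed element over \<open>z \<mapsto> u z\<close> leaves only the powers of \<open>z ^ m\<close>, which is \<open>y\<close> up to a constant.
\<close>

lemma fixed_field_G: "fixed_field Kxz G = Y.Kxy"
proof (intro equalityI subsetI)
  fix h assume "h \<in> fixed_field Kxz G"
  then have h: "h \<in> Kxz" and fixed: "\<And>u. u \<in> mu_m \<Longrightarrow> H.sigma u h = h"
    by (auto simp: fixed_field_def G_def tau_apply)
  obtain a b where b: "b \<noteq> 0" and hab: "h = (\<Sum>j<d. cx (a j) * z ^ j) / cx b"
    using H.Kxy_normal_form[OF h] by blast
  have trm: "H.sigma u h = (\<Sum>j<d. cst (u ^ j) * (cx (a j) * z ^ j / cx b))" if u: "u \<in> mu_m" for u
  proof -
    have "cx (smult (u ^ j) (a j)) = cst (u ^ j) * cx (a j)" for j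
      by (simp add: cst_eq_cx flip: cx.mult)
    then show ?thesis
      unfolding hab H.sigma_normal_form[OF mu_m_subset[OF u] b] by (simp add: sum_divide_distrib mult_ac)
  qed
  have "cst (of_nat m) * h = (\<Sum>u\<in>mu_m. h)" by (simp only: sum_constant card_mu_m cst_of_nat)
  also have "\<dots> = (\<Sum>u\<in>mu_m. \<Sum>j<d. cst (u ^ j) * (cx (a j) * z ^ j / cx b))"
  proof (rule sum.cong[OF refl])
    fix u assume u: "u \<in> mu_m"
    show "h = (\<Sum>j<d. cst (u ^ j) * (cx (a j) * z ^ j / cx b))"
      using trm[OF u] unfolding fixed[OF u] .
  qed
  also have "\<dots> = (\<Sum>j<d. cst (\<Sum>u\<in>mu_m. u ^ j) * (cx (a j) * z ^ j / cx b))"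
    by (subst sum.swap) (simp only: cst.sum sum_distrib_right)
  also have "\<dots> \<in> Y.Kxy"
  proof (rule Y.Kxy_sum)
    fix j assume "j \<in> {..<d}"
    show "cst (\<Sum>u\<in>mu_m. u ^ j) * (cx (a j) * z ^ j / cx b) \<in> Y.Kxy"
    proof (cases "m dvd j")
      case True
      then obtain i where i: "j = m * i" by blast
      obtain u where u: "y = cst u * z ^ m" using y_eq by blast
      have "z ^ m = y / cst u" using u Y.y_nonzero by (auto simp: field_simps)
      then have "z ^ m \<in> Y.Kxy" by simp
      then have "z ^ j \<in> Y.Kxy" by (simp add: i power_mult)
      then show ?thesis by simp
    next
      case False
      then have "(\<Sum>u\<in>mu_m. u ^ j) = 0"
        using sum_roots_of_unity_power[OF m_pos card_mu_m, of j] by simp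
      then show ?thesis by simp
    qed
  qed
  finally have "cst (inverse (of_nat m)) * (cst (of_nat m) * h) \<in> Y.Kxy" by simp
  moreover have "cst (inverse (of_nat m :: 'k)) * cst (of_nat m) = 1"
    using m_nonzero by (simp flip: cst.mult)
  ultimately show "h \<in> Y.Kxy" by (metis mult.assoc mult_1)
next
  fix h assume h: "h \<in> Y.Kxy"
  have sub: "is_subfield (fixed_field Kxz G)"
    unfolding is_subfield_def
  proof (intro conjI ballI)
    show "0 \<in> fixed_field Kxz G" "1 \<in> fixed_field Kxz G"
      using H.sigma_cst[OF mu_m_subset, of _ 0] H.sigma_cst[OF mu_m_subset, of _ 1]
      by (auto simp: fixed_field_def G_def tau_apply)
  next
    fix g h assume "g \<in> fixed_field Kxz G" "h \<in> fixed_field Kxz G"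
    then have gh: "g \<in> Kxz" "h \<in> Kxz" "\<And>u. u \<in> mu_m \<Longrightarrow> H.sigma u g = g" "\<And>u. u \<in> mu_m \<Longrightarrow> H.sigma u h = h"
      by (auto simp: fixed_field_def G_def tau_apply)
    have "H.sigma u (g - h) = g - h" if u: "u \<in> mu_m" for u
      using H.sigma_add[OF mu_m_subset[OF u], of "g - h" h] gh(1,2) gh(3,4)[OF u] by (simp add: algebra_simps)
    then show "g - h \<in> fixed_field Kxz G" using gh by (auto simp: fixed_field_def G_def tau_apply)
    have "H.sigma u (g * h) = g * h" if u: "u \<in> mu_m" for u
      using H.sigma_mult[OF mu_m_subset[OF u], of g h] gh(1,2) gh(3,4)[OF u] by simp
    then show "g * h \<in> fixed_field Kxz G" using gh by (auto simp: fixed_field_def G_def tau_apply)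
  next
    fix h assume "h \<in> fixed_field Kxz G"
    then have h: "h \<in> Kxz" "\<And>u. u \<in> mu_m \<Longrightarrow> H.sigma u h = h"
      by (auto simp: fixed_field_def G_def tau_apply)
    have "H.sigma u (inverse h) = inverse h" if u: "u \<in> mu_m" for u
    proof (cases "h = 0")
      case True
      then show ?thesis using H.sigma_cst[OF mu_m_subset[OF u], of 0] by simp
    next
      case False
      have "H.sigma u (h * inverse h) = h * H.sigma u (inverse h)"
        using H.sigma_mult[OF mu_m_subset[OF u], of h "inverse h"] h(1) h(2)[OF u] by simp
      then have "h * H.sigma u (inverse h) = 1"
        using False H.sigma_cst[OF mu_m_subset[OF u], of 1] by simp
      then show ?thesis by (rule inverse_unique[symmetric])
    qed
    then show "inverse h \<in> fixed_field Kxz G" using h by (auto simp: fixed_field_def G_def tau_apply)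
  qed
  have cx_fixed: "cx p \<in> fixed_field Kxz G" for p
    using H.sigma_cx[OF mu_m_subset] by (auto simp: fixed_field_def G_def tau_apply)
  obtain w where w: "y = cst w * z ^ m" using y_eq by blast
  have "H.sigma u y = y" if u: "u \<in> mu_m" for u
  proof -
    have pow: "H.sigma u (z ^ k) = (cst u * z) ^ k" for k
      using H.sigma_cst[OF mu_m_subset[OF u], of 1]
      by (induction k) (simp_all add: H.sigma_mult[OF mu_m_subset[OF u]] H.sigma_y[OF mu_m_subset[OF u]])
    have "cst u ^ m = 1" using u by (simp flip: cst.power)
    then show ?thesis
      using H.sigma_mult[OF mu_m_subset[OF u], of "cst w" "z ^ m"] H.sigma_cst[OF mu_m_subset[OF u], of w]
      by (simp add: w pow power_mult_distrib)
  qed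
  then have "y \<in> fixed_field Kxz G" using y_in_Kxz by (auto simp: fixed_field_def G_def tau_apply)
  then have "range cst \<union> {xcoord, y} \<subseteq> fixed_field Kxz G"
    using cx_fixed by (auto simp: cst_eq_cx xcoord_eq_cx)
  then have "curve_field y \<subseteq> fixed_field Kxz G"
    unfolding curve_field_def by (rule hull_minimal) (rule sub)
  with h show "h \<in> fixed_field Kxz G" using Y.curve_field_eq by blast
qed

lemma quotient_curve: "is_quotient_curve Y.Kxy Kxz G"
  unfolding is_quotient_curve_def
proof (intro conjI)
  show "finite G" by (simp add: G_def)
  show "subgroup G (BijGroup Kxz)" by (rule subgroup_G)
  show "G \<subseteq> field_auts Kxz" using tau_field_auts mu_m_subset by (auto simp: G_def)
  have "id \<in> field_isos Y.Kxy (fixed_field Kxz G)" by (simp add: field_isos_def fixed_field_G)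
  then show "field_isos Y.Kxy (fixed_field Kxz G) \<noteq> {}" by blast
qed

text \<open>
  The powers of a primitive root of unity are distinct, hence they are all the roots of unity.
\<close>

lemma generate_tau:
  assumes \<zeta>: "primitive_root_of_unity d \<zeta>"
  shows "generate (BijGroup Kxz) {tau \<zeta>} = tau ` H.mu_n"
proof (intro equalityI)
  have \<zeta>n: "\<zeta> \<in> H.mu_n" using \<zeta> by (simp add: H.mu_n_def primitive_root_of_unity_def)
  have pow: "\<zeta> ^ k \<in> H.mu_n" for k by (induction k) (auto simp: H.mult_mu_n \<zeta>n)
  have "subgroup (tau ` H.mu_n) (BijGroup Kxz)"
    by (rule tau_subgroup) (auto simp: H.mult_mu_n H.inverse_mu_n)
  then show "generate (BijGroup Kxz) {tau \<zeta>} \<subseteq> tau ` H.mu_n"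
    by (intro B.generate_subgroup_incl) (use \<zeta>n in auto)
  have z0: "\<zeta> \<noteq> 0" by (rule H.mu_n_nonzero[OF \<zeta>n])
  have inj: "inj_on (\<lambda>k. \<zeta> ^ k) {..<d}"
  proof (rule linorder_inj_onI)
    fix i j assume ij: "i < j" "i \<in> {..<d}" "j \<in> {..<d}"
    have "\<zeta> ^ (j - i) \<noteq> 1" using \<zeta> ij unfolding primitive_root_of_unity_def by auto
    moreover have "\<zeta> ^ j = \<zeta> ^ (j - i) * \<zeta> ^ i" using ij by (simp flip: power_add)
    ultimately show "\<zeta> ^ i \<noteq> \<zeta> ^ j" using z0 by auto
  qed auto
  have "(\<lambda>k. \<zeta> ^ k) ` {..<d} = H.mu_n"
    by (rule card_subset_eq) (use pow in \<open>auto simp: card_image[OF inj] H.card_mu_n\<close>)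
  moreover have "tau (\<zeta> ^ k) \<in> generate (BijGroup Kxz) {tau \<zeta>}" for k
  proof (induction k)
    case 0
    show ?case using generate.one[of "BijGroup Kxz" "{tau \<zeta>}"] by (simp add: tau_one)
  next
    case (Suc k)
    have "tau \<zeta> \<otimes>\<^bsub>BijGroup Kxz\<^esub> tau (\<zeta> ^ k) \<in> generate (BijGroup Kxz) {tau \<zeta>}"
      by (rule generate.eng[OF generate.incl Suc]) simp
    then show ?case by (simp add: tau_mult \<zeta>n pow)
  qed
  ultimately show "tau ` H.mu_n \<subseteq> generate (BijGroup Kxz) {tau \<zeta>}"
    by (metis (no_types, lifting) image_iff image_subsetI)
qed

lemma quotient_statement:
  assumes \<zeta>: "primitive_root_of_unity d \<zeta>"
  shows "is_tau z \<zeta> (tau \<zeta>)"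
    "{G'. subgroup G' (BijGroup Kxz) \<and> G' \<subseteq> generate (BijGroup Kxz) {tau \<zeta>} \<and> card G' = m} = {G}"
proof -
  have \<zeta>n: "\<zeta> \<in> H.mu_n" using \<zeta> by (simp add: H.mu_n_def primitive_root_of_unity_def)
  show "is_tau z \<zeta> (tau \<zeta>)"
    unfolding is_tau_def H.curve_field_eq
    using tau_field_auts[OF \<zeta>n] H.sigma_cx[OF \<zeta>n] H.sigma_y[OF \<zeta>n] by (simp add: tau_apply xcoord_eq_cx)
  have "G \<subseteq> tau ` H.mu_n" using mu_m_subset by (auto simp: G_def)
  then show "{G'. subgroup G' (BijGroup Kxz) \<and> G' \<subseteq> generate (BijGroup Kxz) {tau \<zeta>} \<and> card G' = m} = {G}"
    unfolding generate_tau[OF \<zeta>] using subgroup_eq_G subgroup_G card_G by blast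
qed

end

section \<open>The Hermitian polynomial over a field of square order\<close>

text \<open>
  The \<open>q - 1\<close> nonzero elements are distributed over the at most \<open>k\<close> solutions of \<open>u ^ k = 1\<close>, with at most
  \<open>m\<close> of them over each; as \<open>m * k = q - 1\<close>, both bounds are attained.
\<close>

lemma card_power_fibres:
  assumes mk: "m * k = CARD('k) - 1"
  shows "card {u::'k::{field,finite}. u ^ k = 1} = k"
    and "\<And>u::'k. u ^ k = 1 \<Longrightarrow> card {b. b ^ m = u} = m"
proof -
  have pos: "m > 0" "k > 0" using mk card_field_gt_1[where 'k = 'k] by (auto intro!: Nat.gr0I)
  define U where "U = {u::'k. u ^ k = 1}"
  have U: "card U \<le> k" "finite U" using card_roots_of_unity_le[OF pos(2)] by (simp_all add: U_def)
  have fib: "card {b::'k. b ^ m = u} \<le> m" for u by (rule card_roots_of_unity_le[OF pos(1)])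
  have "UNIV - {0::'k} = (\<Union>u\<in>U. {b. b ^ m = u})"
  proof (intro equalityI subsetI)
    fix b :: 'k assume "b \<in> UNIV - {0}"
    then have "(b ^ m) ^ k = 1" using finite_field_power_card[of b] mk by (simp flip: power_mult)
    then show "b \<in> (\<Union>u\<in>U. {b. b ^ m = u})" by (simp add: U_def)
  next
    fix b :: 'k assume "b \<in> (\<Union>u\<in>U. {b. b ^ m = u})"
    then show "b \<in> UNIV - {0}" using pos by (auto simp: U_def power_0_left)
  qed
  then have "card (UNIV - {0::'k}) = card (\<Union>u\<in>U. {b::'k. b ^ m = u})" by simp
  also have "\<dots> = (\<Sum>u\<in>U. card {b::'k. b ^ m = u})"
    by (rule card_UN_disjoint) (use U(2) in auto)
  finally have sum: "m * k = (\<Sum>u\<in>U. card {b::'k. b ^ m = u})"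
    using mk by (simp add: card_Diff_singleton)
  have "(\<Sum>u\<in>U. card {b::'k. b ^ m = u}) \<le> (\<Sum>u\<in>U. m)" by (rule sum_mono) (rule fib)
  then have "m * k \<le> m * card U" using sum by (simp add: mult.commute)
  then have "k \<le> card U" using pos by simp
  then show cardU: "card {u::'k. u ^ k = 1} = k" using U(1) by (simp add: U_def)
  show "card {b. b ^ m = u} = m" if u: "u ^ k = 1" for u :: 'k
  proof (rule ccontr)
    assume "card {b. b ^ m = u} \<noteq> m"
    then have "card {b. b ^ m = u} < m" using fib[of u] by simp
    then have "(\<Sum>u\<in>U. card {b::'k. b ^ m = u}) < (\<Sum>u\<in>U. m)"
      using fib u U(2) by (intro sum_strict_mono_ex1) (auto simp: U_def)
    then show False using sum cardU by (simp add: U_def mult.commute)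
  qed
qed

lemma poly_splits_of_card_roots:
  fixes p :: "'a::field poly"
  assumes p: "p \<noteq> 0" and card: "card {a. poly p a = 0} = degree p"
  shows "p = smult (lead_coeff p) (\<Prod>a | poly p a = 0. [:- a, 1:])"
proof -
  define R where "R = {a. poly p a = 0}"
  have fin: "finite R" unfolding R_def by (rule poly_roots_finite[OF p])
  define q where "q = smult (lead_coeff p) (\<Prod>a\<in>R. [:- a, 1:])"
  have lc: "lead_coeff q = lead_coeff p" by (simp add: q_def lead_coeff_prod)
  have deg: "degree q = degree p"
    using p card by (simp add: q_def R_def degree_prod_eq_sum_degree)
  have "p - q = 0"
  proof (rule ccontr)
    assume nz: "p - q \<noteq> 0"
    have "R \<subseteq> {a. poly (p - q) a = 0}"
      using fin by (auto simp: q_def poly_prod R_def[symmetric] intro!: prod_zero) (auto simp: R_def)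
    then have "degree p \<le> card {a. poly (p - q) a = 0}"
      using card_mono[OF poly_roots_finite[OF nz], of R] card by (simp add: R_def)
    also have "\<dots> \<le> degree (p - q)" by (rule card_poly_roots_bound[OF nz])
    finally have "degree p \<le> degree (p - q)" .
    moreover have "degree (p - q) \<le> degree p" by (rule degree_diff_le) (simp_all add: deg)
    ultimately have "degree (p - q) = degree p" by simp
    moreover have "coeff (p - q) (degree p) = 0" using lc by (simp add: deg)
    ultimately show False using nz by (metis leading_coeff_0_iff)
  qed
  then show ?thesis by (simp add: q_def R_def)
qed

locale square_field =
  fixes q0 :: nat and ty :: "'k::{field,finite} itself"
  assumes primepow: "primepow q0" and card_k: "CARD('k) = q0 ^ 2"
begin

lemma q0_ge_2: "q0 \<ge> 2"
  using primepow_gt_Suc_0[OF primepow] by simp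

lemma q0_char: "prime CHAR('k)" "\<exists>k. q0 = CHAR('k) ^ k" "CHAR('k) dvd q0"
proof -
  obtain p k where p: "prime p" "k > 0" "q0 = p ^ k" using primepow by (auto simp: primepow_def)
  have "of_nat CARD('k) = (0 :: 'k)" by (rule of_nat_card_field)
  then have "of_nat p = (0 :: 'k)" using p by (simp add: card_k)
  then have "CHAR('k) dvd p" by (simp add: of_nat_eq_0_iff_char_dvd)
  moreover have "CHAR('k) \<noteq> 1" by (metis of_nat_CHAR of_nat_1 zero_neq_one)
  ultimately have "CHAR('k) = p" using p(1) by (auto simp: prime_nat_iff)
  with p show "prime CHAR('k)" "\<exists>k. q0 = CHAR('k) ^ k" "CHAR('k) dvd q0" by (auto simp: dvd_power)
qed

lemma coprime_char: assumes "n dvd q0 + 1" shows "coprime n CHAR('k)"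
proof -
  have "coprime (q0 + 1) q0" by simp
  then show ?thesis using assms q0_char(3) by (meson coprime_divisors)
qed

lemma of_nat_nonzero: assumes "n dvd q0 + 1" shows "of_nat n \<noteq> (0::'k)"
  using coprime_char[OF assms] q0_char(1)
  by (metis coprime_absorb_right not_prime_unit of_nat_eq_0_iff_char_dvd)

lemma q_minus_1: "CARD('k) - 1 = (q0 + 1) * (q0 - 1)"
proof -
  obtain r where "q0 = Suc r" using q0_ge_2 by (cases q0) auto
  then show ?thesis by (simp add: card_k power2_eq_square)
qed

lemma card_mu: assumes "n dvd q0 + 1" shows "card {u::'k. u ^ n = 1} = n"
proof -
  have "n dvd CARD('k) - 1" unfolding q_minus_1 using assms by (rule dvd_mult2)
  then obtain m where "CARD('k) - 1 = n * m" by blast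
  then have "m * n = CARD('k) - 1" by (simp only: mult.commute)
  from card_power_fibres(1)[OF this] show ?thesis .
qed

lemma norm_fibre: "u ^ (q0 - 1) = 1 \<Longrightarrow> card {b::'k. b ^ (q0 + 1) = u} = q0 + 1"
  by (rule card_power_fibres(2)[OF q_minus_1[symmetric]])

lemma power_q0_minus_1: assumes "u ^ q0 = u" "u \<noteq> (0::'k)" shows "u ^ (q0 - 1) = 1"
proof -
  have "u * u ^ (q0 - 1) = u ^ q0" using q0_ge_2 by (metis Suc_diff_1 Suc_le_lessD less_le_trans one_less_numeral_iff power_Suc semiring_norm(76) zero_less_one less_trans)
  then show ?thesis using assms by simp
qed

lemma neg_one: "(- 1 :: 'k) ^ q0 = - 1"
proof (cases "even q0")
  case True
  then have "even CHAR('k)" using q0_char(1,2) by auto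
  then have "CHAR('k) = 2" using q0_char(1) by (metis primes_dvd_imp_eq two_is_prime_nat)
  then show ?thesis using True by (simp add: uminus_CHAR_2)
next
  case False
  then show ?thesis by simp
qed

text \<open>
  Norms lie in the subfield fixed by \<open>u \<mapsto> u ^ q0\<close>, which is additive because \<open>q0\<close> is a power of the
  characteristic.
\<close>

lemma norm_plus_one: "(- (a ^ (q0 + 1) + 1) :: 'k) ^ q0 = - (a ^ (q0 + 1) + 1)"
proof -
  obtain k where k: "q0 = CHAR('k) ^ k" using q0_char(2) by blast
  have "(a ^ (q0 + 1)) ^ q0 = a ^ CARD('k) * a ^ q0"
    by (simp add: card_k power2_eq_square algebra_simps flip: power_mult power_add)
  also have "a ^ CARD('k) = a"
    using finite_field_power_card[of a] card_field_gt_1[where 'k = 'k]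
    by (cases "a = 0") (auto simp: power_eq_if[of a "CARD('k)"])
  finally have "(a ^ (q0 + 1)) ^ q0 = a ^ (q0 + 1)" by simp
  moreover have "(a ^ (q0 + 1) + 1) ^ q0 = (a ^ (q0 + 1)) ^ q0 + 1 ^ q0"
    unfolding k by (rule freshmans_dream'[OF q0_char(1) refl])
  ultimately have "(a ^ (q0 + 1) + 1) ^ q0 = a ^ (q0 + 1) + 1" by simp
  then show ?thesis using neg_one by (metis mult_minus1 power_mult_distrib)
qed

definition herm :: "'k poly" where "herm = - (monom 1 (q0 + 1) + 1)"

lemma poly_herm: "poly herm a = - (a ^ (q0 + 1) + 1)"
  by (simp add: herm_def poly_monom)

lemma degree_herm: "degree herm = q0 + 1" and lead_coeff_herm: "lead_coeff herm = - 1"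
proof -
  have c: "coeff herm i = (if i = q0 + 1 then - 1 else if i = 0 then - 1 else 0)" for i
    by (simp add: herm_def)
  show d: "degree herm = q0 + 1"
    by (rule antisym) (auto intro!: degree_le le_degree simp: c)
  show "lead_coeff herm = - 1" by (simp add: d c)
qed

lemma herm_nonzero: "herm \<noteq> 0" using lead_coeff_herm by auto

lemma neg_one_norm: "(- 1 :: 'k) ^ (q0 - 1) = 1"
  by (rule power_q0_minus_1[OF neg_one]) simp

lemma card_roots_herm: "card {a. poly herm a = 0} = q0 + 1"
proof -
  have "{a. poly herm a = 0} = {a::'k. a ^ (q0 + 1) = - 1}"
    by (simp only: poly_herm neg_equal_0_iff_equal add_eq_0_iff2)
  then show ?thesis using norm_fibre[OF neg_one_norm] by simp
qed

lemma herm_splits: "herm = smult (lead_coeff herm) (\<Prod>a | poly herm a = 0. [:- a, 1:])"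
  by (rule poly_splits_of_card_roots[OF herm_nonzero]) (simp add: card_roots_herm degree_herm)

lemma norm_power:
  assumes "n dvd q0 + 1" "u ^ (q0 - 1) = (1::'k)" shows "\<exists>b. b ^ n = u"
proof -
  have "{b::'k. b ^ (q0 + 1) = u} \<noteq> {}" using norm_fibre[OF assms(2)] by (metis add_is_0 card.empty one_neq_zero)
  then obtain b where "b ^ (q0 + 1) = u" by blast
  moreover obtain m where "q0 + 1 = n * m" using assms(1) by blast
  ultimately have "(b ^ m) ^ n = u" by (metis mult.commute power_mult)
  then show ?thesis by blast
qed

lemma herm_power: assumes n: "n dvd q0 + 1" shows "\<exists>b. b ^ n = poly herm a"
proof (cases "poly herm a = 0")
  case True
  moreover have "n > 0" using n by (auto intro!: Nat.gr0I)
  ultimately show ?thesis by (intro exI[of _ 0]) (simp add: power_0_left)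
next
  case False
  have "poly herm a ^ q0 = poly herm a" unfolding poly_herm by (rule norm_plus_one)
  then have "poly herm a ^ (q0 - 1) = 1" using False by (rule power_q0_minus_1)
  then show ?thesis by (rule norm_power[OF n])
qed

lemma order_root_herm: "\<exists>a. order a herm = 1"
proof -
  have "{a. poly herm a = 0} \<noteq> {}" using card_roots_herm by (metis add_is_0 card.empty one_neq_zero)
  then show ?thesis using order_eq_1_of_splits[OF herm_nonzero herm_splits] by blast
qed

lemma split_kummer_herm:
  assumes n: "n dvd q0 + 1" and y: "on_curve herm n y"
  shows "split_kummer herm n y ((q0 + 1) div n)"
proof
  show "y ^ n = cx herm" using y by (simp add: on_curve_iff)
  show "n > 0" using n by (auto intro!: Nat.gr0I)
  show "herm \<noteq> 0" by (rule herm_nonzero)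
  show "\<exists>a. order a herm = 1" by (rule order_root_herm)
  show "card {u::'k. u ^ n = 1} = n" by (rule card_mu[OF n])
  show "of_nat n \<noteq> (0::'k)" by (rule of_nat_nonzero[OF n])
  show "degree herm = n * ((q0 + 1) div n)" using n by (simp add: degree_herm)
  show "herm = smult (lead_coeff herm) (\<Prod>a | poly herm a = 0. [:- a, 1:])" by (rule herm_splits)
  show "\<exists>b. b ^ n = lead_coeff herm" unfolding lead_coeff_herm by (rule norm_power[OF n neg_one_norm])
  show "\<exists>b. b ^ n = poly herm a" for a by (rule herm_power[OF n])
qed

text \<open>
  Modulo the characteristic \<open>q0 = 0\<close>, so the derivative is \<open>- x ^ q0\<close> and \<open>f - x f' = - 1\<close>.
\<close>

lemma coprime_herm: "coprime herm (pderiv herm)"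
proof (rule coprimeI)
  fix c assume c: "c dvd herm" "c dvd pderiv herm"
  have "of_nat q0 = (0::'k)" using q0_char(3) by (simp add: of_nat_eq_0_iff_char_dvd)
  then have "pderiv herm = - monom 1 q0"
    by (simp add: herm_def pderiv_minus pderiv_add pderiv_diff pderiv_monom)
  then have "herm - [:0, 1:] * pderiv herm = - 1"
    by (simp add: herm_def monom_Suc)
  moreover have "c dvd herm - [:0, 1:] * pderiv herm" using c by (intro dvd_diff dvd_mult)
  ultimately show "is_unit c" by simp
qed

end

section \<open>Rational places and the Hermitian quotients\<close>

context split_kummer
begin

lemma ram_facts:
  "card (ram_places f Kxy) = n * e" "\<And>v. v \<in> ram_places f Kxy \<Longrightarrow> place_degree Kxy v = 1"
  "finite (ram_places f Kxy)"
proof -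
  define R where "R = {a. poly f a = 0}"
  define P where "P a = {v \<in> places Kxy. lies_over v a}" for a
  have P: "card (P a) = 1" "\<And>v. v \<in> P a \<Longrightarrow> place_degree Kxy v = 1" if "a \<in> R" for a
    using fibre_ramified(1,2)[OF order_root_f[of a]] that by (simp_all add: P_def R_def)
  have ram: "ram_places f Kxy = (\<Union>a\<in>R. P a)" by (auto simp: ram_places_def R_def P_def)
  then show "\<And>v. v \<in> ram_places f Kxy \<Longrightarrow> place_degree Kxy v = 1" using P(2) by blast
  have finR: "finite R" unfolding R_def by (rule poly_roots_finite[OF f_nonzero])
  have finP: "\<forall>a\<in>R. finite (P a)" using P(1) by (metis card.infinite zero_neq_one)
  show "finite (ram_places f Kxy)" unfolding ram using finR finP by blast
  have "card (ram_places f Kxy) = (\<Sum>a\<in>R. card (P a))"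
    unfolding ram
  proof (rule card_UN_disjoint[OF finR finP])
    show "\<forall>a\<in>R. \<forall>b\<in>R. a \<noteq> b \<longrightarrow> P a \<inter> P b = {}"
      using lies_over_unique by (auto simp: P_def)
  qed
  also have "\<dots> = n * e" using P(1) card_roots by (simp add: R_def)
  finally show "card (ram_places f Kxy) = n * e" .
qed

lemma ram_rational: "ram_places f Kxy \<subseteq> rational_places Kxy"
  using ram_facts(2) by (auto simp: rational_places_def ram_places_def)

lemma inf_rational: "inf_places Kxy \<subseteq> rational_places Kxy"
  using inf_facts(2) by (auto simp: rational_places_def inf_places_def)

lemma rational_places_eq: "rational_places Kxy = inf_places Kxy \<union> ram_places f Kxy \<union> evals"
proof (intro equalityI subsetI)
  fix v assume v: "v \<in> rational_places Kxy"
  then have vp: "v \<in> places Kxy" by (simp add: rational_places_def)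
  from rational_place_cases[OF v] show "v \<in> inf_places Kxy \<union> ram_places f Kxy \<union> evals"
    using vp by (auto simp: evals_eq ram_places_def nonroots_def)
next
  fix v assume "v \<in> inf_places Kxy \<union> ram_places f Kxy \<union> evals"
  then show "v \<in> rational_places Kxy"
    using inf_rational ram_rational by (auto simp: eval_places_def)
qed

lemma card_rational_places:
  "finite (rational_places Kxy)"
  "card (rational_places Kxy) = n + n * e + n * (CARD('k) - n * e)"
proof -
  have fin: "finite (inf_places Kxy)" "finite (ram_places f Kxy)" "finite evals" by (simp_all add: ram_facts(3))
  then show "finite (rational_places Kxy)" by (simp add: rational_places_eq)
  have off_inf: "v \<notin> inf_places Kxy" if "v \<in> places Kxy" "lies_over v a" for v a
    using lies_over_x[OF that] by (simp add: inf_places_def)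
  have "inf_places Kxy \<inter> ram_places f Kxy = {}" using off_inf by (auto simp: ram_places_def)
  moreover have "inf_places Kxy \<inter> evals = {}" using off_inf by (auto simp: evals_eq)
  moreover have "ram_places f Kxy \<inter> evals = {}" by (auto simp: eval_places_def)
  ultimately have "card (rational_places Kxy) = card (inf_places Kxy) + card (ram_places f Kxy) + card evals"
    unfolding rational_places_eq using fin by (simp add: card_Un_disjoint Int_Un_distrib2)
  then show "card (rational_places Kxy) = n + n * e + n * (CARD('k) - n * e)"
    by (simp add: inf_facts(1) ram_facts(1) card_evals)
qed

lemma div_degree_D_eval: "div_degree Kxy (D_eval f Kxy) = int (n * (CARD('k) - n * e))"
proof -
  have "div_degree Kxy (D_eval f Kxy) = (\<Sum>v\<in>evals. 1)"
    unfolding div_degree_def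
    by (rule sum.cong) (auto simp: D_eval_def reduced_divisor_def eval_places_def rational_places_def split: if_splits)
  then show ?thesis by (simp add: card_evals)
qed

end

theorem theorem7p10:
  fixes q0 n :: nat
    and f :: "'k::{field,finite} poly"
    and y :: "'k cover"
    and F :: "'k cover set"
  assumes "primepow q0"
    and "CARD('k) = q0 ^ 2"
    and "n \<ge> 2"
    and "n dvd q0 + 1"
    and "f = - (monom 1 (q0 + 1) + 1)"
    and "on_curve f n y"
    and "F = curve_field y"
  shows "gcd n (q0 + 1) = n
    \<and> coprime n CHAR('k) \<and> n dvd q0 ^ 2 - 1
    \<and> degree f = q0 + 1 \<and> degree f \<ge> 3 \<and> coprime f (pderiv f)
    \<and> (\<exists>S. finite S \<and> card S = degree f \<and> f = smult (lead_coeff f) (\<Prod>a\<in>S. [:- a, 1:]))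
    \<and> (\<forall>a. poly f a \<noteq> 0 \<longrightarrow> poly f a \<in> {b ^ n | b. b \<noteq> 0})
    \<and> delta f n = 0
    \<and> real_of_int (genus F) = (real n - 1) * (real q0 - 1) / 2
    \<and> div_degree F (D_eval f F) = int n * (int q0 ^ 2 - int q0 - 1)
    \<and> M_num f n = int q0 ^ 2 - 2
    \<and> (\<forall>\<zeta> z. primitive_root_of_unity (q0 + 1) \<zeta> \<and> on_curve f (q0 + 1) z \<longrightarrow>
         (\<exists>\<tau> G. is_tau z \<zeta> \<tau>
           \<and> {G'. subgroup G' (BijGroup (curve_field z))
                  \<and> G' \<subseteq> generate (BijGroup (curve_field z)) {\<tau>}
                  \<and> card G' = (q0 + 1) div n} = {G}
           \<and> is_quotient_curve F (curve_field z) G))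
    \<and> card (ram_places f F) = q0 + 1 \<and> ram_places f F \<subseteq> rational_places F
    \<and> card (inf_places F) = gcd n (q0 + 1) \<and> inf_places F \<subseteq> rational_places F
    \<and> is_maximal F q0
    \<and> (\<forall>s. t_num f n F s = int n * (int q0 - 1 - mu f n s))
    \<and> window f n F = {s. int q0 \<le> s \<and> s \<le> int q0 ^ 2 - 2 - int q0}
    \<and> (q0 \<ge> 3 \<longrightarrow> window f n F \<noteq> {})
    \<and> (\<forall>s \<in> window f n F.
         real (code_dim (code_hull (eval_places f F) (code f F s)))
           = real n * real_of_int (mu f n s) - real q0 - (real n - 1) * (real q0 - 1) / 2)"
proof -
  interpret S: square_field q0 "TYPE('k)" by standard (fact assms)+
  have f: "f = S.herm" by (simp add: assms(5) S.herm_def)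
  define e where "e = (q0 + 1) div n"
  have ne: "n * e = q0 + 1" using assms(4) by (simp add: e_def)
  interpret C: split_kummer f n y e
    unfolding f e_def by (rule S.split_kummer_herm) (use assms f in simp_all)
  have F: "F = C.Kxy" using C.curve_field_eq assms(7) by simp
  have q0: "q0 \<ge> 2" by (rule S.q0_ge_2)
  define q where "q = int q0"
  have q2: "q \<ge> 2" using q0 by (simp add: q_def)
  have qq: "q * q \<ge> 2 * q" using q2 by (intro mult_right_mono) auto
  have card: "int CARD('k) = q ^ 2" by (simp add: assms(2) q_def)
  have gcd: "gcd n (q0 + 1) = n" using assms(4) by (simp add: gcd_nat.absorb1)
  have deg: "degree f = q0 + 1" by (simp add: f S.degree_herm)
  have pow: "poly f a \<in> {b ^ n | b. b \<noteq> 0}" if "poly f a \<noteq> 0" for a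
  proof -
    obtain b where "b ^ n = poly f a" using C.f_power by blast
    moreover from this have "b \<noteq> 0" using that C.n_pos by (auto simp: power_0_left)
    ultimately show ?thesis by (metis (mono_tags, lifting) mem_Collect_eq)
  qed
  then have "{a. poly f a \<noteq> 0 \<and> poly f a \<notin> {b ^ n | b. b \<noteq> 0}} = {}" by blast
  then have delta: "delta f n = 0" unfolding delta_def by (simp only: card.empty)
  have genus: "2 * genus F = (int n - 1) * (q - 1)"
    using C.genus_formula unfolding F ne by (simp add: q_def)
  have M: "M_num f n = q ^ 2 - 2"
    using C.n_pos by (simp add: M_num_def deg gcd card del: One_nat_def)
  have diff: "int (CARD('k) - n * e) = q ^ 2 - q - 1"
    using C.degree_le_card card by (simp add: of_nat_diff ne q_def)
  have t: "t_num f n F s = int n * (q - 1 - mu f n s)" for s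
  proof -
    have "t_num f n F s = (int n - 1) * (q - 1) - 2 - int n * mu f n s + q + 1"
      unfolding t_num_def deg gcd delta genus by (simp add: q_def)
    then show ?thesis by (simp add: algebra_simps)
  qed
  have mu: "mu f n s = min s (q ^ 2 - 2 - s)" for s by (simp add: mu_def M)
  have window: "window f n F = {s. q \<le> s \<and> s \<le> q ^ 2 - 2 - q}"
  proof -
    have "t_num f n F s < 0 \<longleftrightarrow> q \<le> s \<and> s \<le> q ^ 2 - 2 - q" for s
      using C.n_pos unfolding t mu by (auto simp: mult_less_0_iff)
    then show ?thesis using q2 by (auto simp: window_def)
  qed
  have split: "\<exists>S. finite S \<and> card S = degree f \<and> f = smult (lead_coeff f) (\<Prod>a\<in>S. [:- a, 1:])"
    by (rule exI[of _ "{a. poly f a = 0}"])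
       (use C.card_roots C.f_splits C.degree_f poly_roots_finite[OF C.f_nonzero] in simp)
  have div_deg: "div_degree F (D_eval f F) = int n * (q ^ 2 - q - 1)"
    unfolding F C.div_degree_D_eval of_nat_mult diff ..
  have maximal: "is_maximal F q0"
    unfolding is_maximal_def
  proof (intro conjI)
    show "finite (rational_places F)" unfolding F by (rule C.card_rational_places)
    have "int (card (rational_places F)) = int n + (q + 1) + int n * (q ^ 2 - q - 1)"
      unfolding F C.card_rational_places of_nat_add of_nat_mult diff
      using ne by (metis of_nat_1 of_nat_add of_nat_mult q_def)
    also have "\<dots> = q ^ 2 + 1 + 2 * genus F * q"
      unfolding genus by (simp add: algebra_simps power2_eq_square)
    finally show "int (card (rational_places F)) = int q0 ^ 2 + 1 + 2 * genus F * int q0" by (simp add: q_def)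
  qed (fact assms)
  have hull: "real (code_dim (code_hull (eval_places f F) (code f F s)))
           = real n * real_of_int (mu f n s) - real q0 - (real n - 1) * (real q0 - 1) / 2"
    if "s \<in> window f n F" for s
  proof -
    have s: "q \<le> s" "s \<le> q ^ 2 - 2 - q" using that by (simp_all add: window)
    have nei: "int (n * e) = q + 1" by (simp add: ne q_def)
    have "2 * int (code_dim (code_hull (eval_places f F) (code f F s)))
       = 2 * int n * (min s (int CARD('k) - 2 - s) - int e + 1) - int e * int n * (int n - 1)"
      unfolding F
    proof (rule C.code_dim_hull)
      show "s < int CARD('k) - int (n * e)" "int CARD('k) - 2 - s < int CARD('k) - int (n * e)"
        unfolding nei card using s by linarith+
      show "min s (int CARD('k) - 2 - s) \<ge> int (n * e) - 1" unfolding nei card using s by simp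
    qed
    also have "\<dots> = 2 * int n * (mu f n s + 1) - 2 * (int n * int e) - (int n * int e) * (int n - 1)"
      unfolding mu card by (simp add: algebra_simps)
    also have "int n * int e = q + 1" using nei by simp
    finally have "2 * int (code_dim (code_hull (eval_places f F) (code f F s)))
      = 2 * int n * mu f n s - 2 * q - (int n - 1) * (q - 1)" by (simp add: algebra_simps)
    then have "real_of_int (2 * int (code_dim (code_hull (eval_places f F) (code f F s))))
      = real_of_int (2 * int n * mu f n s - 2 * q - (int n - 1) * (q - 1))" by simp
    then show ?thesis by (simp add: q_def field_simps)
  qed
  have quotient: "\<exists>\<tau> G. is_tau z \<zeta> \<tau>
           \<and> {G'. subgroup G' (BijGroup (curve_field z))
                  \<and> G' \<subseteq> generate (BijGroup (curve_field z)) {\<tau>}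
                  \<and> card G' = (q0 + 1) div n} = {G}
           \<and> is_quotient_curve F (curve_field z) G"
    if \<zeta>: "primitive_root_of_unity (q0 + 1) \<zeta>" and z: "on_curve f (q0 + 1) z" for \<zeta> z
  proof -
    interpret H: split_kummer f "q0 + 1" z "(q0 + 1) div (q0 + 1)"
      unfolding f by (rule S.split_kummer_herm) (use z f in simp_all)
    have edvd: "e dvd q0 + 1" by (metis ne dvd_triv_right)
    interpret P: kummer_pair f "q0 + 1" n z y e
      by standard (use ne S.card_mu[OF edvd] S.of_nat_nonzero[OF edvd] in simp_all)
    show ?thesis
      using P.quotient_statement[OF \<zeta>] P.quotient_curve
      unfolding H.curve_field_eq F e_def by blast
  qed
  show ?thesis
  proof (intro conjI allI impI ballI)
    show "gcd n (q0 + 1) = n" by (rule gcd)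
    show "coprime n CHAR('k)" by (rule S.coprime_char[OF assms(4)])
    have "q0 ^ 2 - 1 = (q0 + 1) * (q0 - 1)" using S.q_minus_1 by (simp only: assms(2))
    then show "n dvd q0 ^ 2 - 1" using dvd_mult2[OF assms(4), of "q0 - 1"] by (simp only:)
    show "degree f = q0 + 1" by (rule deg)
    show "degree f \<ge> 3" using deg q0 by simp
    show "coprime f (pderiv f)" unfolding f by (rule S.coprime_herm)
    show "\<exists>S. finite S \<and> card S = degree f \<and> f = smult (lead_coeff f) (\<Prod>a\<in>S. [:- a, 1:])" by (rule split)
    show "poly f a \<in> {b ^ n | b. b \<noteq> 0}" if "poly f a \<noteq> 0" for a by (rule pow[OF that])
    show "delta f n = 0" by (rule delta)
    have "2 * real_of_int (genus F) = real_of_int ((int n - 1) * (q - 1))" by (simp flip: genus)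
    then show "real_of_int (genus F) = (real n - 1) * (real q0 - 1) / 2" by (simp add: q_def)
    show "div_degree F (D_eval f F) = int n * (int q0 ^ 2 - int q0 - 1)" using div_deg by (simp add: q_def)
    show "M_num f n = int q0 ^ 2 - 2" using M by (simp add: q_def)
    show "card (ram_places f F) = q0 + 1" unfolding F using C.ram_facts(1) ne by simp
    show "ram_places f F \<subseteq> rational_places F" unfolding F by (rule C.ram_rational)
    show "card (inf_places F) = gcd n (q0 + 1)" unfolding F gcd by (rule C.inf_facts(1))
    show "inf_places F \<subseteq> rational_places F" unfolding F by (rule C.inf_rational)
    show "is_maximal F q0" by (rule maximal)
    show "t_num f n F s = int n * (int q0 - 1 - mu f n s)" for s using t by (simp add: q_def)
    show "window f n F = {s. int q0 \<le> s \<and> s \<le> int q0 ^ 2 - 2 - int q0}" using window by (simp add: q_def)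
    assume "q0 \<ge> 3"
    then have "q \<ge> 3" by (simp add: q_def)
    then have "3 * q \<le> q * q" by (intro mult_right_mono) auto
    then have "q \<le> q ^ 2 - 2 - q" unfolding power2_eq_square using \<open>q \<ge> 3\<close> by linarith
    then have "q \<in> window f n F" by (simp add: window)
    then show "window f n F \<noteq> {}" by blast
  next
    fix s assume "s \<in> window f n F"
    then show "real (code_dim (code_hull (eval_places f F) (code f F s)))
           = real n * real_of_int (mu f n s) - real q0 - (real n - 1) * (real q0 - 1) / 2" by (rule hull)
  next
    fix \<zeta> :: 'k and z assume "primitive_root_of_unity (q0 + 1) \<zeta> \<and> on_curve f (q0 + 1) z"
    then show "\<exists>\<tau> G. is_tau z \<zeta> \<tau>
           \<and> {G'. subgroup G' (BijGroup (curve_field z))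
                  \<and> G' \<subseteq> generate (BijGroup (curve_field z)) {\<tau>}
                  \<and> card G' = (q0 + 1) div n} = {G}
           \<and> is_quotient_curve F (curve_field z) G" using quotient by blast
  qed
qed

end
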